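(* Let $\Omega\subset\mathbb R^2$ be a strictly convex billiard domain of perimeter $1$ with $C^\infty$ (or $C^\omega$) smooth boundary, and let $\zeta_\infty(y)=y+\sum_{i\ge1}c_{2i+1}y^{2i+1}$ be the formal series of the Birkhoff normal form of its billiard map (see context). Then the $\beta$-function of the billiard map can be formalized by $$\beta(h)=\frac{\sqrt2}{3}\,c^{3/2}+\sum_{i=1}^{+\infty}\frac{2i+1}{2i+3}\,c_{2i+1}\sqrt{2^{2i+1}}\;c^{\frac{2i+3}{2}}\qquad\text{with}\qquad c=\frac12\big[\zeta_\infty^{-1}(h)\big]^2,$$ where $\zeta_\infty^{-1}$ is the inverse function of $\zeta_\infty$, and this is also symplectic invariant.
   Context: Billiard map: $\partial\Omega$ has perimeter $1$ and is parametrized by arc length as $\xi(s)$, $s\in[0,1]$ (taken mod $1$). A particle moves along straight lines inside $\Omega$ and is reflected elastically at $\partial\Omega$. For a particle leaving $\xi(s)$ at angle $v\in[0,\pi]$ to the positive tangent direction, $\xi(\bar s)$ is the next point where it hits $\partial\Omega$ and $\bar v$ is the angle with the positive tangent at which it leaves $\xi(\bar s)$. The billiard map is $\phi:(s,v)\mapsto(\bar s,\bar v)$ on the annulus $\mathbb A=[0,1]\times[0,\pi]$ (first coordinate mod $1$). It preserves $\omega=\sin v\,dv\wedge ds=d\alpha$ with $\alpha=-\cos v\,ds$. Its generating function on the universal cover is $h_\Omega(x,\bar x)=-\|\xi([x])-\xi([\bar x])\|$, where $[x]\equiv x$ mod $1$. $\beta$-function: for $p/q\in\mathbb Q\cap(0,1/2]$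 in lowest terms, let $$\mathcal B(s,p/q)=\min\sum_{i=0}^{q-1}h_\Omega(x_i,x_{i+1}),$$ the minimum being over all $p/q$-configurations with $x_0\equiv s$, i.e. real sequences with $x_q=x_0+p$ and $x_i\le x_{i+1}\le x_i+1$ (period $q$, winding number $p$). Put $\beta(p/q)=\frac1q\min_{s\in[0,1]}\mathcal B(s,p/q)$. For irrational $h\in(0,1/2]$, put $\beta(h)=\lim_{n\to\infty}\beta(p_n/q_n)$ for any rational sequence $p_n/q_n\to h$. Exact symplectic and symplectic invariant: a symplectic change of coordinates of the annulus is exact symplectic if it has a generating function $g$ with $dg=\beta'-\alpha$, where $\beta'$ is a new $1$-form on the annulus with $d\beta'=\omega$. Symplectic invariant means unchanged under exact symplectic transformations of the billiard map. Birkhoff normal form: there is a $C^\infty$ exact symplectic diffeomorphism $\Phi:\mathbb A\to\mathbb A$ such that $\Phi^{-1}\circ\phi\circ\Phi$ has the form $(x,y)\mapsto(x+\zeta_\infty(y),\,y)$, where formally $\zeta_\infty(y)=y+\sum_{i=1}^\infty c_{2i+1}y^{2i+1}$ as $y\to0$ (a description of the jet at $\{y=0\}$ to arbitrarily high order), the preserved symplectic form in these coordinates being $y\,dy\wedge dx$. The numbers $c_{2i+1}$ in the claim are these coefficients. The formula for $\beta(h)$ is accordingly a formal expression for small $h>0$.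
   Formalization: The formula is corrected to β(h) = κh + μ·(displayed series), where the normal form preserves μ y dy∧dx with 1-form (κ+μy²/2)dx (κ = −1 is forced); as displayed it fails, e.g. for the disc, where β(h) = −sin(πh)/π = −h+… but the series starts with h³/6. *)

theory Defs
  imports
    "HOL-Analysis.Analysis"
    "HOL-Library.Landau_Symbols"
    "HOL-Computational_Algebra.Formal_Power_Series"
begin

section \<open>Smooth functions\<close>

primrec Ck_on :: "nat \<Rightarrow> ('a::real_normed_vector \<Rightarrow> 'b::real_normed_vector) \<Rightarrow> 'a set \<Rightarrow> bool" where
  "Ck_on 0 f U \<longleftrightarrow> continuous_on U f"
| "Ck_on (Suc k) f U \<longleftrightarrow>
     (\<forall>z\<in>U. f differentiable (at z)) \<and> (\<forall>w. Ck_on k (\<lambda>z. frechet_derivative f (at z) w) U)"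

text \<open>On a set that is not open (such as a closed strip), smooth up to the boundary is
  expressed by smoothness on an open neighbourhood.\<close>

definition smooth_on :: "('a::real_normed_vector \<Rightarrow> 'b::real_normed_vector) \<Rightarrow> 'a set \<Rightarrow> bool" where
  "smooth_on f S \<longleftrightarrow> (\<exists>U. open U \<and> S \<subseteq> U \<and> (\<forall>k. Ck_on k f U))"


section \<open>Billiard tables and the billiard map\<close>

text \<open>The plane is \<^typ>\<open>complex\<close>. The boundary is described by a 1-periodic unit-speed
  curve that is injective on a period, so its length is 1; the last clause says that the
  curve runs counterclockwise (multiplication by \<^term>\<open>\<i>\<close> turns the tangent inwards).\<close>

definition tangent :: "(real \<Rightarrow> complex) \<Rightarrow> real \<Rightarrow> complex" where
  "tangent \<xi> s = vector_derivative \<xi> (at s)"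

definition billiard_domain :: "complex set \<Rightarrow> (real \<Rightarrow> complex) \<Rightarrow> bool" where
  "billiard_domain \<Omega> \<xi> \<longleftrightarrow>
     open \<Omega> \<and> bounded \<Omega> \<and> \<Omega> \<noteq> {} \<and>
     (\<forall>a\<in>closure \<Omega>. \<forall>b\<in>closure \<Omega>. a \<noteq> b \<longrightarrow> open_segment a b \<subseteq> \<Omega>) \<and>
     smooth_on \<xi> UNIV \<and> (\<forall>s. norm (tangent \<xi> s) = 1) \<and>
     (\<forall>s. \<xi> (s + 1) = \<xi> s) \<and> inj_on \<xi> {0..<1} \<and> range \<xi> = frontier \<Omega> \<and>
     (\<forall>s. \<exists>t>0. \<xi> s + of_real t * \<i> * tangent \<xi> s \<in> \<Omega>)"

text \<open>Maps of the annulus are given by their lifts to the strip.\<close>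

definition annulus :: "(real \<times> real) set" where
  "annulus = UNIV \<times> {0..pi}"

text \<open>The map \<open>w \<mapsto> \<tau>\<^sup>2 * cnj w\<close> is the reflection in the line spanned by the unit vector
  \<open>\<tau>\<close>. The lift is the one that fixes the boundary \<open>v = 0\<close> pointwise; it is then the unit
  translation on the boundary \<open>v = pi\<close>, and \<open>s < s' < s + 1\<close> in between.\<close>

definition billiard_step :: "(real \<Rightarrow> complex) \<Rightarrow> real \<times> real \<Rightarrow> real \<times> real \<Rightarrow> bool" where
  "billiard_step \<xi> = (\<lambda>(s, v) (s', v').
     let d = tangent \<xi> s * cis v in
       s < s' \<and> s' < s + 1 \<and> 0 < v' \<and> v' < pi \<and>
       (\<exists>t>0. \<xi> s' = \<xi> s + of_real t * d) \<and>
       tangent \<xi> s' * cis v' = (tangent \<xi> s')\<^sup>2 * cnj d)"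

definition billiard_map :: "(real \<Rightarrow> complex) \<Rightarrow> real \<times> real \<Rightarrow> real \<times> real" where
  "billiard_map \<xi> = (\<lambda>(s, v).
     if 0 < v \<and> v < pi then (THE z'. billiard_step \<xi> (s, v) z')
     else if v = pi then (s + 1, v)
     else (s, v))"


section \<open>The beta function\<close>

definition gen_fun :: "(real \<Rightarrow> complex) \<Rightarrow> real \<Rightarrow> real \<Rightarrow> real" where
  "gen_fun \<xi> x x' = - norm (\<xi> x - \<xi> x')"

text \<open>Only the entries \<open>x 0, \<dots>, x q\<close> of a configuration matter.\<close>

definition configurations :: "int \<Rightarrow> nat \<Rightarrow> real \<Rightarrow> (nat \<Rightarrow> real) set" where
  "configurations p q s =
     {x. x 0 - s \<in> \<int> \<and> x q = x 0 + of_int p \<and> (\<forall>i<q. x i \<le> x (Suc i) \<and> x (Suc i) \<le> x i + 1)}"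

text \<open>The infima below are attained, by compactness.\<close>

definition min_action :: "(real \<Rightarrow> complex) \<Rightarrow> int \<Rightarrow> nat \<Rightarrow> real \<Rightarrow> real" where
  "min_action \<xi> p q s = (INF x\<in>configurations p q s. \<Sum>i<q. gen_fun \<xi> (x i) (x (Suc i)))"

definition beta_rat :: "(real \<Rightarrow> complex) \<Rightarrow> rat \<Rightarrow> real" where
  "beta_rat \<xi> r =
     (case quotient_of r of (p, q) \<Rightarrow> (INF s\<in>{0..1}. min_action \<xi> p (nat q) s) / of_int q)"

definition beta :: "(real \<Rightarrow> complex) \<Rightarrow> real \<Rightarrow> real" where
  "beta \<xi> h =
     (if h \<in> \<rat> then beta_rat \<xi> (inv of_rat h)
      else Lim (at h within \<rat> \<inter> {0<..1/2}) (\<lambda>x. beta_rat \<xi> (inv of_rat x)))"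


section \<open>One-forms and exact symplectic changes of coordinates\<close>

text \<open>A one-form on the annulus assigns to each point of the strip a linear functional,
  periodically in the first coordinate.\<close>

type_synonym form1 = "real \<times> real \<Rightarrow> real \<times> real \<Rightarrow> real"

definition one_form_on :: "(real \<times> real) set \<Rightarrow> form1 \<Rightarrow> bool" where
  "one_form_on S \<theta> \<longleftrightarrow>
     (\<forall>z\<in>S. linear (\<theta> z)) \<and> (\<forall>w. smooth_on (\<lambda>z. \<theta> z w) S) \<and> (\<forall>z\<in>S. \<theta> (z + (1, 0)) = \<theta> z)"

definition ext_deriv :: "form1 \<Rightarrow> real \<times> real \<Rightarrow> real \<times> real \<Rightarrow> real \<times> real \<Rightarrow> real" where
  "ext_deriv \<theta> z u w =
     frechet_derivative (\<lambda>z. \<theta> z w) (at z) u - frechet_derivative (\<lambda>z. \<theta> z u) (at z) w"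

text \<open>This is \<open>- cos v ds\<close>; its exterior derivative is \<open>sin v dv \<and> ds\<close>.\<close>

definition billiard_form :: form1 where
  "billiard_form = (\<lambda>(s, v) (ds, dv). - cos v * ds)"

text \<open>Lift of a diffeomorphism, onto its image, of an annulus into the annulus that has degree
  one and preserves the lower boundary.\<close>

definition annulus_chart :: "(real \<times> real) set \<Rightarrow> (real \<times> real \<Rightarrow> real \<times> real) \<Rightarrow> bool" where
  "annulus_chart S \<Psi> \<longleftrightarrow>
     smooth_on \<Psi> S \<and> inj_on \<Psi> S \<and> \<Psi> ` S \<subseteq> annulus \<and>
     (\<forall>z\<in>S. bij (frechet_derivative \<Psi> (at z))) \<and>
     (\<forall>z\<in>S. \<Psi> (z + (1, 0)) = \<Psi> z + (1, 0)) \<and>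
     (\<forall>x. snd (\<Psi> (x, 0)) = 0)"

text \<open>\<open>\<Psi>\<close> expresses the old coordinates by the new ones. The new one-form \<open>\<theta>'\<close> satisfies
  \<open>d \<theta>' = \<Psi>* (d \<theta>)\<close>, and the generating function \<open>g\<close> satisfies \<open>dg = \<theta>' - \<Psi>* \<theta>\<close>; \<open>g\<close> is
  periodic, i.e. a function on the annulus.\<close>

definition exact_symplectic ::
  "(real \<times> real) set \<Rightarrow> (real \<times> real \<Rightarrow> real \<times> real) \<Rightarrow> form1 \<Rightarrow> form1 \<Rightarrow> bool" where
  "exact_symplectic S \<Psi> \<theta> \<theta>' \<longleftrightarrow>
     annulus_chart S \<Psi> \<and> one_form_on S \<theta>' \<and>
     (\<forall>z\<in>S. \<forall>u w. ext_deriv \<theta>' z u w =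
        ext_deriv \<theta> (\<Psi> z) (frechet_derivative \<Psi> (at z) u) (frechet_derivative \<Psi> (at z) w)) \<and>
     (\<exists>g::real \<times> real \<Rightarrow> real. smooth_on g S \<and> (\<forall>z\<in>S. g (z + (1, 0)) = g z) \<and>
        (\<forall>z\<in>S. \<forall>w. frechet_derivative g (at z) w =
           \<theta>' z w - \<theta> (\<Psi> z) (frechet_derivative \<Psi> (at z) w)))"

text \<open>The map \<open>f'\<close>, with one-form \<open>\<theta>'\<close>, is \<open>\<Psi>\<inverse> \<circ> f \<circ> \<Psi>\<close> for a global exact symplectic change
  of coordinates \<open>\<Psi>\<close> of the closed annulus.\<close>

definition exact_symplectic_transform ::
  "(real \<times> real \<Rightarrow> real \<times> real) \<Rightarrow> form1 \<Rightarrow> (real \<times> real \<Rightarrow> real \<times> real) \<Rightarrow> form1 \<Rightarrow> bool" where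
  "exact_symplectic_transform f \<theta> f' \<theta>' \<longleftrightarrow>
     (\<exists>\<Psi>. exact_symplectic annulus \<Psi> \<theta> \<theta>' \<and> \<Psi> ` annulus = annulus \<and>
        (\<forall>z\<in>annulus. f' z \<in> annulus \<and> \<Psi> (f' z) = f (\<Psi> z)))"


section \<open>Birkhoff normal form at the boundary\<close>

text \<open>The new one-form is the general primitive \<open>(\<kappa> + \<mu> y\<^sup>2 / 2) dx\<close>, up to differentials, of
  \<open>\<mu> y dy \<and> dx\<close>. Neither constant is a free choice. Exactness gives \<open>\<kappa> = -1\<close> for a billiard
  map, because \<open>- cos v ds\<close> has integral \<open>-1\<close> over the boundary circle \<open>v = 0\<close>. The factor \<open>\<mu>\<close>
  is determined by the normalisation \<open>\<zeta>(y) = y + \<dots>\<close> and the period 1 of \<open>x\<close>: it is \<open>C\<^sup>3 / 4\<close>,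
  where \<open>C\<close> is the integral of the curvature to the power \<open>2/3\<close> over the boundary (\<open>pi\<^sup>2\<close> for a
  disc). The chart is defined near the boundary only, and conjugates \<open>f\<close> to
  \<open>(x, y) \<mapsto> (x + \<zeta>(y), y)\<close> to infinite order at \<open>y = 0\<close>.\<close>

definition normal_form_one_form :: "real \<Rightarrow> real \<Rightarrow> form1" where
  "normal_form_one_form \<kappa> \<mu> = (\<lambda>(x, y) (dx, dy). (\<kappa> + \<mu> * y\<^sup>2 / 2) * dx)"

definition birkhoff_normal_form ::
  "(real \<times> real \<Rightarrow> real \<times> real) \<Rightarrow> form1 \<Rightarrow> (real \<times> real \<Rightarrow> real \<times> real) \<Rightarrow>
     real fps \<Rightarrow> real \<Rightarrow> real \<Rightarrow> bool" where
  "birkhoff_normal_form f \<theta> \<Phi> \<zeta> \<kappa> \<mu> \<longleftrightarrow>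
     fps_nth \<zeta> 1 = 1 \<and> (\<forall>k. even k \<longrightarrow> fps_nth \<zeta> k = 0) \<and> \<mu> > 0 \<and>
     (\<exists>\<epsilon>>0. let S = UNIV \<times> {0..<\<epsilon>} in
        exact_symplectic S \<Phi> \<theta> (normal_form_one_form \<kappa> \<mu>) \<and>
        (\<forall>N. \<exists>C. \<exists>\<delta>>0. \<forall>x. \<forall>y\<in>{0..<\<delta>}. \<exists>z'\<in>S. \<Phi> z' = f (\<Phi> (x, y)) \<and>
           norm (z' - (x + (\<Sum>k\<le>N. fps_nth \<zeta> k * y ^ k), y)) \<le> C * y ^ Suc N))"


section \<open>The formal expression\<close>

text \<open>The quantity \<open>c\<close> is a formal power series in \<open>h\<close> starting with \<open>h\<^sup>2 / 2\<close>, so its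
  half-integer powers are the odd powers of its square root with positive leading coefficient.
  The infinite sum converges in the topology of formal power series.\<close>

definition formal_c :: "real fps \<Rightarrow> real fps" where
  "formal_c \<zeta> = fps_const (1 / 2) * (fps_inv \<zeta>)\<^sup>2"

definition formal_sqrt :: "real fps \<Rightarrow> real fps" where
  "formal_sqrt c = (THE r. r\<^sup>2 = c \<and> fps_nth r (subdegree r) > 0)"

definition formal_sum :: "real fps \<Rightarrow> real fps" where
  "formal_sum \<zeta> =
     fps_const (sqrt 2 / 3) * formal_sqrt (formal_c \<zeta>) ^ 3 +
     (\<Sum>j. let i = Suc j in
        fps_const (real (2 * i + 1) / real (2 * i + 3) * fps_nth \<zeta> (2 * i + 1) * sqrt (2 ^ (2 * i + 1)))
          * formal_sqrt (formal_c \<zeta>) ^ (2 * i + 3))"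

text \<open>With respect to the primitive \<open>y\<^sup>2 / 2 dx\<close>, i.e. \<open>\<kappa> = 0\<close> and \<open>\<mu> = 1\<close>, this is
  \<^term>\<open>formal_sum \<zeta>\<close>; the primitive \<open>(\<kappa> + \<mu> y\<^sup>2 / 2) dx\<close> scales it by \<open>\<mu>\<close> and adds \<open>\<kappa> h\<close>.\<close>

definition formal_beta :: "real \<Rightarrow> real \<Rightarrow> real fps \<Rightarrow> real fps" where
  "formal_beta \<kappa> \<mu> \<zeta> = fps_const \<kappa> * fps_X + fps_const \<mu> * formal_sum \<zeta>"

definition asymptotic_series :: "(real \<Rightarrow> real) \<Rightarrow> real fps \<Rightarrow> bool" where
  "asymptotic_series F A \<longleftrightarrow>
     (\<forall>N. (\<lambda>h. F h - (\<Sum>k\<le>N. fps_nth A k * h ^ k)) \<in> O[at_right 0](\<lambda>h. h ^ Suc N))"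

end

theory Submission
  imports Defs "HOL-Library.Multiset" "HOL-Computational_Algebra.Polynomial_FPS"
begin

text \<open>
  If there is an invariant circle of rotation number \<open>h\<close>, then the slope of the beta
  function at \<open>h\<close> is the integral of the one-form \<open>- cos v ds\<close> over it. In the
  normal form the circles are \<open>y = const\<close>; the circle at height \<open>y\<close> has
  rotation number \<open>\<zeta> y\<close>, and by exactness of the chart the integral is
  \<open>\<kappa> + \<mu> y\<^sup>2 / 2\<close>. Integrating this slope along 
  \<open>h = \<zeta> y\<close> gives the series of the theorem. The normal form holds only to infinite order at the
  boundary, so there need not be any invariant circle, and the argument has to work with circles that
  are invariant up to \<open>O(h\<^sup>N)\<close>.

  A single variational estimate replaces invariant circles. Write \<open>S\<close>, \<open>V\<close> for
  the two coordinates of the curve \<open>y = const\<close> in the chart and \<open>K\<close> for a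
  primitive of \<open>cos V dS\<close>. For the modified generating function 
  \<open>F x x' = gen_fun \<xi> (S x) (S x') + K x' - K x\<close>, the twist property of chords
  (a chord from a given point turns left as its
  end point advances) gives the sign of \<open>\<partial>F / \<partial>x\<close> everywhere, not only
  near the curve, so \<open>F\<close> is almost minimal along the curve, where it is almost constant.
  Sums of \<open>F\<close> and of \<open>gen_fun\<close> over a periodic configuration differ by the winding
  number times the integral of the one-form. This bounds the action of every configuration from below by
  an affine function of its rotation number, and the points of the curve themselves form a configuration
  of rotation number \<open>h\<close> that almost attains the bound: \<open>beta\<close> has an
  approximate supporting line at every small rational \<open>h\<close>, of the slope described above
  (\<open>least_action_support\<close>, \<open>beta_support\<close>). Such lines at all rationals
  determine the expansion (\<open>expansion_from_slopes\<close>, \<open>beta_asymptotic_series\<close>).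
  For irrational \<open>h\<close> the limit that defines \<open>beta\<close> exists since
  \<open>beta\<close> is 1-Lipschitz on the rationals (\<open>beta_lipschitz\<close>). This rests on the
  fact that \<open>k\<close> periods of a configuration cannot do better than \<open>k\<close> times the
  best single period: sorting the translates of a configuration does not increase the action
  (\<open>least_action_multiple\<close>).

  The estimate is made for charts with continuous first derivatives (\<open>boundary_chart\<close>). The
  composition of a normal form of a transformed map with the change of coordinates is such a chart, so
  both normal forms yield an expansion of the same beta function, and uniqueness of asymptotic series
  makes the formal expression invariant.

  That conjugate billiards have the same beta function is a statement about periodic orbits: a
  minimizing configuration is a billiard orbit (\<open>minimizing_orbit\<close>), the conjugacy maps
  orbits to orbits with the same period and winding number, and by exactness it changes the action of a
  chord by the increment of a function on the annulus, which cancels along a periodic orbit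
  (\<open>orbit_action\<close>).
\<close>

section \<open>The geometry of chords\<close>

locale billiard =
  fixes \<Omega> :: "complex set" and \<xi> :: "real \<Rightarrow> complex"
  assumes domain: "billiard_domain \<Omega> \<xi>"
begin

abbreviation \<tau> :: "real \<Rightarrow> complex" where "\<tau> \<equiv> tangent \<xi>"

lemma open_table: "open \<Omega>" and nonempty_table: "\<Omega> \<noteq> {}"
  and strictly_convex: "a \<in> closure \<Omega> \<Longrightarrow> b \<in> closure \<Omega> \<Longrightarrow> a \<noteq> b \<Longrightarrow> open_segment a b \<subseteq> \<Omega>"
  and norm_tangent [simp]: "norm (\<tau> s) = 1"
  and curve_periodic [simp]: "\<xi> (s + 1) = \<xi> s"
  and inj_curve: "inj_on \<xi> {0..<1}"
  and range_curve: "range \<xi> = frontier \<Omega>"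
  and tangent_inward: "\<exists>t>0. \<xi> s + of_real t * \<i> * \<tau> s \<in> \<Omega>"
  using domain unfolding billiard_domain_def by blast+

lemma curve_differentiable: "\<xi> differentiable (at s)"
  and continuous_frechet: "continuous_on UNIV (\<lambda>s. frechet_derivative \<xi> (at s) 1)"
proof -
  have "smooth_on \<xi> UNIV"
    using domain unfolding billiard_domain_def by blast
  then obtain U where "UNIV \<subseteq> U" "\<forall>k. Ck_on k \<xi> U"
    unfolding smooth_on_def by blast
  hence "Ck_on (Suc 0) \<xi> UNIV"
    by (simp add: top.extremum_unique)
  thus "\<xi> differentiable (at s)" "continuous_on UNIV (\<lambda>s. frechet_derivative \<xi> (at s) 1)"
    by auto
qed

lemma tangent_eq_frechet: "\<tau> s = frechet_derivative \<xi> (at s) 1"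
proof -
  have "(\<xi> has_derivative frechet_derivative \<xi> (at s)) (at s)"
    using curve_differentiable frechet_derivative_works by blast
  moreover have "linear (frechet_derivative \<xi> (at s))"
    using curve_differentiable linear_frechet_derivative by blast
  ultimately have "(\<xi> has_vector_derivative frechet_derivative \<xi> (at s) 1) (at s)"
    unfolding has_vector_derivative_def
    by (simp flip: linear_scale[of "frechet_derivative \<xi> (at s)"])
  thus ?thesis
    unfolding tangent_def by (rule vector_derivative_at)
qed

lemma continuous_tangent: "continuous_on UNIV \<tau>"
  using continuous_frechet by (simp add: tangent_eq_frechet)

lemma curve_derivative: "(\<xi> has_vector_derivative \<tau> s) (at s within A)"
  unfolding tangent_def
  using curve_differentiable vector_derivative_works has_vector_derivative_at_within by blast

lemma continuous_curve: "continuous_on A \<xi>"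
  using curve_derivative has_vector_derivative_continuous
  by (metis continuous_at_imp_continuous_on)

lemma curve_periodic_int [simp]: "\<xi> (s + of_int k) = \<xi> s"
proof -
  have nat: "\<xi> (s + of_nat n) = \<xi> s" for s n
  proof (induction n)
    case (Suc n)
    thus ?case using curve_periodic[of "s + of_nat n"] by (simp add: ac_simps)
  qed simp
  show ?thesis
  proof (cases "k \<ge> 0")
    case True
    thus ?thesis using nat[of s "nat k"] by simp
  next
    case False
    thus ?thesis using nat[of "s + of_int k" "nat (- k)"] by simp
  qed
qed

lemma tangent_periodic [simp]: "\<tau> (s + 1) = \<tau> s"
proof -
  have "((\<lambda>t. \<xi> (t + 1)) has_vector_derivative \<tau> (s + 1)) (at s)"
    using vector_diff_chain_at[of "\<lambda>t. t + 1" 1 s \<xi> "\<tau> (s + 1)"]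
      curve_derivative[of "s + 1" UNIV]
    by (simp add: o_def has_vector_derivative_add_const has_vector_derivative_id)
  hence "(\<xi> has_vector_derivative \<tau> (s + 1)) (at s)" by simp
  thus ?thesis
    unfolding tangent_def by (metis vector_derivative_at tangent_def)
qed

lemma curve_in_closure: "\<xi> s \<in> closure \<Omega>" and curve_notin_table: "\<xi> s \<notin> \<Omega>"
proof -
  have *: "\<xi> s \<in> frontier \<Omega>" using range_curve by blast
  show "\<xi> s \<in> closure \<Omega>" using * by (simp add: frontier_def)
  show "\<xi> s \<notin> \<Omega>" using * open_table by (simp add: frontier_def interior_open)
qed

lemma curve_distinct:
  assumes "s < a" "a < s + 1"
  shows "\<xi> a \<noteq> \<xi> s"
proof
  assume eq: "\<xi> a = \<xi> s"
  have "\<xi> (frac a) = \<xi> a" "\<xi> (frac s) = \<xi> s"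
    using curve_periodic_int[of a "- \<lfloor>a\<rfloor>"] curve_periodic_int[of s "- \<lfloor>s\<rfloor>"]
    by (simp_all add: frac_def)
  hence "frac a = frac s"
    using eq inj_curve by (auto simp: inj_on_def frac_lt_1)
  hence "a - s = of_int (\<lfloor>a\<rfloor> - \<lfloor>s\<rfloor>)" by (simp add: frac_def)
  hence "0 < \<lfloor>a\<rfloor> - \<lfloor>s\<rfloor>" "\<lfloor>a\<rfloor> - \<lfloor>s\<rfloor> < 1" using assms by linarith+
  thus False by linarith
qed

lemma curve_lipschitz: "norm (\<xi> a - \<xi> b) \<le> \<bar>a - b\<bar>"
proof -
  have "norm (\<xi> a - \<xi> b) \<le> 1 * norm (a - b)"
    by (rule differentiable_bound[where S = UNIV and f' = "\<lambda>s t. t *\<^sub>R \<tau> s"])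
       (use curve_derivative in \<open>auto simp: has_vector_derivative_def onorm_scaleR_left
          intro!: onorm_le\<close>)
  thus ?thesis by simp
qed

text \<open>Convexity gives a supporting line at each boundary point. The curve stays on one side of it,
  so the line is the tangent; the side is known from the orientation of the curve.\<close>

lemma table_left_of_tangent:
  assumes "w \<in> closure \<Omega>"
  shows "0 \<le> Im (cnj (\<tau> s) * (w - \<xi> s))"
proof -
  have "convex \<Omega>"
    unfolding convex_contains_open_segment using strictly_convex closure_subset
    by (metis open_segment_idem empty_subsetI subsetD)
  moreover have "\<xi> s \<notin> \<Omega>" by (rule curve_notin_table)
  ultimately obtain a b where "a \<noteq> 0" and ab: "a \<bullet> \<xi> s \<le> b" "\<And>w. w \<in> \<Omega> \<Longrightarrow> a \<bullet> w \<ge> b"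
    using separating_hyperplane_sets[of "{\<xi> s}" \<Omega>] nonempty_table by auto
  have closed: "a \<bullet> \<xi> s \<le> a \<bullet> w" if "w \<in> closure \<Omega>" for w
  proof -
    have "closure \<Omega> \<subseteq> {w. a \<bullet> w \<ge> b}"
      by (rule closure_minimal) (use ab closed_halfspace_ge in auto)
    thus ?thesis using ab that by fastforce
  qed
  \<comment> \<open>\<open>a\<close> is normal to the tangent, as \<open>a \<bullet> \<xi> t\<close> is smallest at \<open>t = s\<close>; so it is a multiple \<open>k\<close> of
    the normal \<open>\<i> * \<tau> s\<close>, and an interior point on that normal shows \<open>k > 0\<close>.\<close>
  have "((\<lambda>t. a \<bullet> \<xi> t) has_real_derivative a \<bullet> \<tau> s) (at s)"
    using bounded_linear.has_vector_derivative[OF bounded_linear_inner_right curve_derivative]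
    by (simp add: has_real_derivative_iff_has_vector_derivative)
  moreover have "\<forall>t. \<bar>s - t\<bar> < 1 \<longrightarrow> a \<bullet> \<xi> s \<le> a \<bullet> \<xi> t"
    using closed curve_in_closure by blast
  ultimately have perp: "a \<bullet> \<tau> s = 0"
    using DERIV_local_min[of "\<lambda>t. a \<bullet> \<xi> t" _ s 1] by simp
  define k where "k = Im (cnj (\<tau> s) * a)"
  have tau: "cnj (\<tau> s) * \<tau> s = 1"
    by (metis complex_norm_square mult.commute norm_tangent of_real_1 one_power2)
  have "Re (cnj (\<tau> s) * a) = 0"
    using perp by (simp add: inner_complex_def algebra_simps)
  hence "cnj (\<tau> s) * a = of_real k * \<i>"
    by (simp add: k_def complex_eq_iff)
  hence "(cnj (\<tau> s) * \<tau> s) * a = of_real k * \<i> * \<tau> s"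
    by (metis mult.assoc mult.commute)
  hence a: "a = of_real k * \<i> * \<tau> s" by (simp add: tau)
  have inner_a: "a \<bullet> z = k * Im (cnj (\<tau> s) * z)" for z
    unfolding a by (simp add: inner_complex_def algebra_simps)
  obtain t where t: "t > 0" "\<xi> s + of_real t * \<i> * \<tau> s \<in> \<Omega>"
    using tangent_inward by blast
  have "a \<bullet> \<xi> s \<le> a \<bullet> (\<xi> s + of_real t * \<i> * \<tau> s)"
    using closed t closure_subset by blast
  hence "0 \<le> a \<bullet> (of_real t * \<i> * \<tau> s)" by (simp add: inner_add_right)
  hence "0 \<le> k * t"
  proof -
    have "cnj (\<tau> s) * (of_real t * \<i> * \<tau> s) = of_real t * \<i>"
      using tau by (simp add: mult.left_commute)
    moreover have "Im (of_real t * \<i>) = t" by simp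
    ultimately show ?thesis using \<open>0 \<le> a \<bullet> _\<close> by (metis inner_a)
  qed
  moreover have "k \<noteq> 0" using a \<open>a \<noteq> 0\<close> by auto
  ultimately have "k > 0" using t by (simp add: zero_le_mult_iff)
  moreover have "0 \<le> k * Im (cnj (\<tau> s) * (w - \<xi> s))"
    using closed[OF assms] unfolding inner_a[symmetric] by (simp add: inner_diff_right)
  ultimately show ?thesis by (simp add: zero_le_mult_iff)
qed

text \<open>A point of the closed table on the tangent line would, with the point of contact, span a
  segment inside the open table that touches the tangent line, which openness forbids.\<close>

lemma chord_left_of_tangent:
  assumes "w \<in> closure \<Omega>" "w \<noteq> \<xi> s"
  shows "0 < Im (cnj (\<tau> s) * (w - \<xi> s))"
proof (rule ccontr)
  assume "\<not> ?thesis"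
  hence eq: "Im (cnj (\<tau> s) * (w - \<xi> s)) = 0"
    using table_left_of_tangent[OF assms(1), of s] by linarith
  define m where "m = midpoint (\<xi> s) w"
  have "m \<in> open_segment (\<xi> s) w"
    using assms(2) by (simp add: m_def)
  hence "m \<in> \<Omega>"
    using strictly_convex[of "\<xi> s" w] assms curve_in_closure by auto
  then obtain e where e: "e > 0" "ball m e \<subseteq> \<Omega>"
    using open_table open_contains_ball by blast
  define z where "z = m - of_real (e / 2) * \<i> * \<tau> s"
  have tau: "cnj (\<tau> s) * \<tau> s = 1"
    by (metis complex_norm_square mult.commute norm_tangent of_real_1 one_power2)
  have "dist m z = e / 2"
    using e by (simp add: z_def dist_norm norm_mult)
  hence "z \<in> closure \<Omega>" using e closure_subset by force
  hence "0 \<le> Im (cnj (\<tau> s) * (z - \<xi> s))" by (rule table_left_of_tangent)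
  moreover have "z - \<xi> s = (w - \<xi> s) / 2 - of_real (e / 2) * \<i> * \<tau> s"
    by (simp add: z_def m_def midpoint_def scaleR_conv_of_real field_simps)
  hence "cnj (\<tau> s) * (z - \<xi> s) = (cnj (\<tau> s) * (w - \<xi> s)) / 2 - of_real (e / 2) * \<i>"
    using tau by (simp add: right_diff_distrib mult.left_commute)
  ultimately have "0 \<le> Im (cnj (\<tau> s) * (w - \<xi> s) / 2) - e / 2" by simp
  thus False using eq e by simp
qed

lemma departure_upward:
  assumes "s < a" "a < s + 1"
  shows "0 < Im (cnj (\<tau> s) * (\<xi> a - \<xi> s))"
  using chord_left_of_tangent curve_in_closure curve_distinct[OF assms] by blast

lemma arrival_downward:
  assumes "s < a" "a < s + 1"
  shows "Im (cnj (\<tau> a) * (\<xi> a - \<xi> s)) < 0"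
proof -
  have "0 < Im (cnj (\<tau> a) * (\<xi> s - \<xi> a))"
    using chord_left_of_tangent curve_in_closure curve_distinct[OF assms] by metis
  thus ?thesis by (simp add: algebra_simps)
qed

text \<open>Of three points on a line one lies between the other two, hence inside the open table.\<close>

lemma not_collinear:
  assumes "s < a" "a < b" "b < s + 1"
  shows "Im (cnj (\<xi> a - \<xi> s) * (\<xi> b - \<xi> s)) \<noteq> 0"
proof
  let ?u = "\<xi> a - \<xi> s" and ?w = "\<xi> b - \<xi> s"
  assume eq: "Im (cnj ?u * ?w) = 0"
  have ne: "\<xi> a \<noteq> \<xi> s" "\<xi> b \<noteq> \<xi> s" "\<xi> b \<noteq> \<xi> a"
    using curve_distinct[of s a] curve_distinct[of s b] curve_distinct[of a b] assms by auto
  have off: "\<not> (\<xi> x \<in> open_segment (\<xi> y) (\<xi> z) \<and> \<xi> y \<noteq> \<xi> z)" for x y z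
    using strictly_convex curve_in_closure curve_notin_table by blast
  define r where "r = Re (cnj ?u * ?w) / (norm ?u)\<^sup>2"
  have "cnj ?u * ?w = of_real (Re (cnj ?u * ?w))"
    using eq by (simp add: complex_eq_iff)
  hence "?u * cnj ?u * ?w = of_real (Re (cnj ?u * ?w)) * ?u"
    by (metis mult.assoc mult.commute)
  hence "of_real ((norm ?u)\<^sup>2) * ?w = of_real (Re (cnj ?u * ?w)) * ?u"
    by (simp only: complex_norm_square)
  moreover have "(of_real ((norm ?u)\<^sup>2) :: complex) \<noteq> 0" using ne by simp
  ultimately have "?w = of_real r * ?u"
    unfolding r_def of_real_divide by (metis nonzero_mult_div_cancel_left times_divide_eq_left)
  hence b: "\<xi> b = \<xi> s + r *\<^sub>R ?u"
    by (simp add: scaleR_conv_of_real algebra_simps)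
  have "r \<noteq> 0" "r \<noteq> 1" using b ne by auto
  then consider "r < 0" | "0 < r" "r < 1" | "1 < r" by linarith
  thus False
  proof cases
    case 1
    have "\<xi> s \<in> open_segment (\<xi> b) (\<xi> a)"
      unfolding in_segment
    proof (intro conjI exI[of _ "- r / (1 - r)"])
      show "\<xi> s = (1 - - r / (1 - r)) *\<^sub>R \<xi> b + (- r / (1 - r)) *\<^sub>R \<xi> a"
      proof -
        have "1 - - r / (1 - r) = 1 / (1 - r)" using 1 by (simp add: field_simps)
        moreover have "(1 - r) *\<^sub>R \<xi> s = \<xi> b - r *\<^sub>R \<xi> a" by (simp add: b algebra_simps)
        hence "\<xi> s = (1 / (1 - r)) *\<^sub>R (\<xi> b - r *\<^sub>R \<xi> a)"
          using 1 by (metis diff_gt_0_iff_gt divide_self_if less_trans scaleR_one scaleR_scaleR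
              times_divide_eq_left mult_1 less_irrefl zero_less_one)
        ultimately show ?thesis by (simp add: scaleR_diff_right)
      qed
    qed (use 1 ne in \<open>auto simp: field_simps\<close>)
    thus False using off ne by blast
  next
    case 2
    have "\<xi> b \<in> open_segment (\<xi> s) (\<xi> a)"
      unfolding in_segment
      by (intro conjI exI[of _ r]) (use 2 ne b in \<open>auto simp: algebra_simps\<close>)
    thus False using off ne by metis
  next
    case 3
    have "\<xi> a \<in> open_segment (\<xi> s) (\<xi> b)"
      unfolding in_segment
    proof (intro conjI exI[of _ "1 / r"])
      have "(1 / r) *\<^sub>R (\<xi> b - \<xi> s) = \<xi> a - \<xi> s" using b 3 by simp
      thus "\<xi> a = (1 - 1 / r) *\<^sub>R \<xi> s + (1 / r) *\<^sub>R \<xi> b" by (simp add: algebra_simps)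
    qed (use 3 ne in auto)
    thus False using off ne by metis
  qed
qed

text \<open>The triangle degenerates for no \<open>a\<close> strictly between \<open>s\<close> and \<open>b\<close>, so its orientation is
  constant there; near \<open>a = s\<close> it is the side of the tangent on which the chord to \<open>b\<close> lies.\<close>

lemma chords_turn_left:
  assumes "s < a" "a < b" "b < s + 1"
  shows "0 < Im (cnj (\<xi> a - \<xi> s) * (\<xi> b - \<xi> s))"
proof (rule ccontr)
  define f where "f t = Im (cnj (\<xi> t - \<xi> s) * (\<xi> b - \<xi> s))" for t
  assume "\<not> ?thesis"
  hence fa: "f a < 0" using not_collinear[OF assms] by (simp add: f_def)
  have "(f has_real_derivative Im (cnj (\<tau> s) * (\<xi> b - \<xi> s))) (at s)"
    unfolding f_def has_real_derivative_iff_has_vector_derivative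
    by (rule bounded_linear.has_vector_derivative[OF bounded_linear_Im])
       (auto intro!: derivative_eq_intros curve_derivative
          bounded_linear.has_vector_derivative[OF bounded_linear_cnj])
  moreover have "0 < Im (cnj (\<tau> s) * (\<xi> b - \<xi> s))"
    using departure_upward[of s b] assms by simp
  ultimately obtain d where d: "d > 0" "\<And>h. 0 < h \<Longrightarrow> h < d \<Longrightarrow> f s < f (s + h)"
    using DERIV_pos_inc_right by blast
  define t where "t = s + min (d / 2) ((a - s) / 2)"
  have t: "s < t" "t < a" using d(1) assms by (auto simp: t_def min_def field_simps)
  have "0 < f t"
    using d(2)[of "t - s"] t d(1) assms by (auto simp: f_def t_def min_def split: if_splits)
  moreover have "continuous_on {t..a} f"
    unfolding f_def by (intro continuous_intros continuous_curve)
  ultimately obtain r where r: "t \<le> r" "r \<le> a" "f r = 0"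
    using IVT2'[of f a 0 t] fa t by auto
  thus False using not_collinear[of s r b] t assms by (simp add: f_def)
qed

end

text \<open>In the upper half plane a larger argument means a smaller cosine.\<close>

lemma cos_antimono_upper_half_plane:
  fixes z w :: complex
  assumes "0 < Im z" "0 < Im w" "0 \<le> Im (cnj z * w)"
  shows "Re w / norm w \<le> Re z / norm z"
proof -
  \<comment> \<open>Compare the slopes \<open>Re / Im\<close>; the cosine is an increasing function of the slope.\<close>
  have mono: "x / sqrt (x\<^sup>2 + 1) \<le> y / sqrt (y\<^sup>2 + 1)" if "x \<le> y" for x y :: real
  proof -
    have "DERIV (\<lambda>x. x / sqrt (x\<^sup>2 + 1)) t :> 1 / ((t\<^sup>2 + 1) * sqrt (t\<^sup>2 + 1))" for t :: real
    proof -
      have p: "t\<^sup>2 + 1 > 0" by (simp add: add_nonneg_pos)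
      show ?thesis
        apply (rule derivative_eq_intros refl | use p in simp; fail)+
        using p by (auto simp: field_simps power2_eq_square)
    qed
    thus ?thesis
      by (intro DERIV_nonneg_imp_nondecreasing[OF that])
         (metis zero_le_divide_1_iff zero_le_mult_iff add_nonneg_nonneg zero_le_power2
           real_sqrt_ge_zero zero_le_one)
  qed
  have form: "Re v / norm v = (Re v / Im v) / sqrt ((Re v / Im v)\<^sup>2 + 1)" if "0 < Im v" for v :: complex
  proof -
    have "(Re v / Im v)\<^sup>2 + 1 = (norm v / Im v)\<^sup>2"
      using that by (simp add: cmod_power2 field_simps)
    hence "sqrt ((Re v / Im v)\<^sup>2 + 1) = norm v / Im v" using that by simp
    thus ?thesis using that by simp
  qed
  have "Im z * Re w \<le> Re z * Im w" using assms by (simp add: algebra_simps)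
  hence "Re w / Im w \<le> Re z / Im z"
    using assms by (simp add: field_simps)
  thus ?thesis using mono form assms by metis
qed

section \<open>Angles of chords and the billiard map\<close>

text \<open>The cosines of the angles between a chord and the tangents at its two ends. By the law of
  reflection, \<open>arrival_cos\<close> is also the cosine of the angle at which the particle leaves the end of
  the chord. Working with cosines avoids choosing branches of angles.\<close>

definition departure_cos :: "(real \<Rightarrow> complex) \<Rightarrow> real \<Rightarrow> real \<Rightarrow> real" where
  "departure_cos \<xi> s a = tangent \<xi> s \<bullet> (\<xi> a - \<xi> s) / norm (\<xi> a - \<xi> s)"

definition arrival_cos :: "(real \<Rightarrow> complex) \<Rightarrow> real \<Rightarrow> real \<Rightarrow> real" where
  "arrival_cos \<xi> s a = tangent \<xi> a \<bullet> (\<xi> a - \<xi> s) / norm (\<xi> a - \<xi> s)"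

lemma Re_cnj_mult: "Re (cnj z * w) = z \<bullet> w"
  by (simp add: inner_complex_def)

lemma polar_upper_half_plane:
  assumes "0 < Im z"
  shows "0 < arccos (Re z / norm z)" "arccos (Re z / norm z) < pi"
    "z = of_real (norm z) * cis (arccos (Re z / norm z))"
proof -
  have n: "norm z > 0" using assms by auto
  have *: "\<bar>Re z\<bar> < norm z"
    using assms by (simp add: cmod_def real_less_rsqrt)
  hence r: "-1 < Re z / norm z" "Re z / norm z < 1" using n by (simp_all add: field_simps)
  show "0 < arccos (Re z / norm z)" "arccos (Re z / norm z) < pi"
    using arccos_lt_bounded[OF r] by auto
  have "1 - (Re z / norm z)\<^sup>2 = (Im z / norm z)\<^sup>2"
  proof -
    have "(norm z)\<^sup>2 \<noteq> 0" using n by simp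
    moreover have "(norm z)\<^sup>2 - (Re z)\<^sup>2 = (Im z)\<^sup>2" by (simp add: cmod_power2)
    ultimately show ?thesis unfolding power_divide by (metis diff_divide_distrib divide_self)
  qed
  hence "sin (arccos (Re z / norm z)) = Im z / norm z"
    using r assms n by (simp add: sin_arccos)
  thus "z = of_real (norm z) * cis (arccos (Re z / norm z))"
    using n r by (simp add: complex_eq_iff)
qed

lemma abs_Re_div_norm_le_1: "\<bar>Re z / norm z\<bar> \<le> 1"
  using abs_Re_le_cmod[of z] by (cases "z = 0") (auto simp: abs_divide)

context billiard
begin

lemma tangent_cancel [simp]: "cnj (\<tau> s) * \<tau> s = 1" "\<tau> s * cnj (\<tau> s) = 1"
  by (metis complex_norm_square mult.commute norm_tangent of_real_1 one_power2)+

lemma rotate_by_tangent: "cnj (\<tau> s) * w = z \<longleftrightarrow> w = \<tau> s * z"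
proof
  assume "cnj (\<tau> s) * w = z"
  hence "\<tau> s * z = (\<tau> s * cnj (\<tau> s)) * w" by (simp only: mult.assoc)
  thus "w = \<tau> s * z" by (simp only: tangent_cancel mult_1)
next
  assume "w = \<tau> s * z"
  hence "cnj (\<tau> s) * w = (cnj (\<tau> s) * \<tau> s) * z" by (simp only: mult.assoc)
  thus "cnj (\<tau> s) * w = z" by (simp only: tangent_cancel mult_1)
qed

abbreviation dep where "dep \<equiv> departure_cos \<xi>"
abbreviation arr where "arr \<equiv> arrival_cos \<xi>"

lemma departure_cos_polar:
  "dep s a = Re (cnj (\<tau> s) * (\<xi> a - \<xi> s)) / norm (cnj (\<tau> s) * (\<xi> a - \<xi> s))"
  unfolding departure_cos_def Re_cnj_mult by (simp add: norm_mult)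

lemma arrival_cos_polar:
  "arr s a = Re (cnj (cnj (\<tau> a) * (\<xi> a - \<xi> s))) / norm (cnj (cnj (\<tau> a) * (\<xi> a - \<xi> s)))"
  unfolding arrival_cos_def cnj.sel complex_mod_cnj Re_cnj_mult norm_mult norm_tangent mult_1 ..

lemma departure_cos_eqI:
  assumes "cnj (\<tau> s) * (\<xi> a - \<xi> s) = of_real t * w" "norm (\<xi> a - \<xi> s) = t" "t > 0"
  shows "dep s a = Re w"
  unfolding departure_cos_def Re_cnj_mult[symmetric] assms(1,2) using assms(3) by simp

lemma arrival_cos_eqI:
  assumes "cnj (\<tau> a) * (\<xi> a - \<xi> s) = of_real t * w" "norm (\<xi> a - \<xi> s) = t" "t > 0"
  shows "arr s a = Re w"
  unfolding arrival_cos_def Re_cnj_mult[symmetric] assms(1,2) using assms(3) by simp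

text \<open>The twist property in terms of angles: advancing the end of a chord turns it to the left.\<close>

lemma departure_cos_antimono:
  assumes "s < a" "a \<le> b" "b < s + 1"
  shows "dep s b \<le> dep s a"
proof (cases "a = b")
  case False
  hence "0 < Im (cnj (\<xi> a - \<xi> s) * (\<xi> b - \<xi> s))"
    using chords_turn_left assms by simp
  also have "cnj (\<xi> a - \<xi> s) * (\<xi> b - \<xi> s) =
      (\<tau> s * cnj (\<tau> s)) * (cnj (\<xi> a - \<xi> s) * (\<xi> b - \<xi> s))" by (simp only: tangent_cancel mult_1)
  also have "\<dots> = cnj (cnj (\<tau> s) * (\<xi> a - \<xi> s)) * (cnj (\<tau> s) * (\<xi> b - \<xi> s))"
    by (simp add: mult_ac)
  finally show ?thesis
    unfolding departure_cos_polar
    by (intro cos_antimono_upper_half_plane departure_upward) (use assms in auto)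
qed simp

lemma arrival_cos_mono:
  assumes "a < b" "b < d" "d < a + 1"
  shows "arr a d \<le> arr b d"
proof -
  let ?z = "cnj (cnj (\<tau> d) * (\<xi> d - \<xi> b))" and ?w = "cnj (cnj (\<tau> d) * (\<xi> d - \<xi> a))"
  have "0 < Im (cnj (\<xi> b - \<xi> a) * (\<xi> d - \<xi> a))"
    using chords_turn_left assms by simp
  also have "\<dots> = Im ((\<xi> d - \<xi> b) * cnj (\<xi> d - \<xi> a))"
    by (simp add: algebra_simps)
  also have "(\<xi> d - \<xi> b) * cnj (\<xi> d - \<xi> a) =
      (cnj (\<tau> d) * \<tau> d) * ((\<xi> d - \<xi> b) * cnj (\<xi> d - \<xi> a))" by (simp only: tangent_cancel mult_1)
  also have "\<dots> = cnj ?z * ?w"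
    by (simp add: mult_ac)
  finally have "0 < Im (cnj ?z * ?w)" .
  moreover have "0 < Im ?z" "0 < Im ?w"
    unfolding cnj.sel using arrival_downward[of b d] arrival_downward[of a d] assms by linarith+
  ultimately show ?thesis
    unfolding arrival_cos_polar by (intro cos_antimono_upper_half_plane) auto
qed

text \<open>A chord determines its angles, so the steps of the billiard map correspond to the chords
  \<open>s < a < s + 1\<close>. This turns statements about orbits into statements about configurations.\<close>

lemma billiard_step_iff:
  "billiard_step \<xi> (s, v) (a, v') \<and> 0 < v \<and> v < pi \<longleftrightarrow>
     s < a \<and> a < s + 1 \<and> v = arccos (dep s a) \<and> v' = arccos (arr s a)"
proof (intro iffI conjI)
  assume *: "billiard_step \<xi> (s, v) (a, v') \<and> 0 < v \<and> v < pi"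
  then obtain t where t: "t > 0" "\<xi> a = \<xi> s + of_real t * (\<tau> s * cis v)"
    and a: "s < a" "a < s + 1" and v: "0 < v" "v < pi" "0 < v'" "v' < pi"
    and refl: "\<tau> a * cis v' = (\<tau> a)\<^sup>2 * cnj (\<tau> s * cis v)"
    by (auto simp: billiard_step_def Let_def)
  show "s < a" "a < s + 1" by fact+
  have u: "\<xi> a - \<xi> s = of_real t * (\<tau> s * cis v)" and n: "norm (\<xi> a - \<xi> s) = t"
    using t by (simp_all add: norm_mult)
  have "cnj (\<tau> s) * (\<xi> a - \<xi> s) = of_real t * cis v"
    unfolding rotate_by_tangent u by (simp only: mult.left_commute)
  hence "dep s a = cos v"
    using departure_cos_eqI n t by (metis cis.sel(1))
  thus "v = arccos (dep s a)" using v by (simp add: arccos_cos)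
  have "cis v' = \<tau> a * cnj (\<tau> s * cis v)"
  proof -
    have "\<tau> a * cis v' = \<tau> a * (\<tau> a * cnj (\<tau> s * cis v))"
      using refl by (simp only: power2_eq_square mult.assoc)
    moreover have "\<tau> a \<noteq> 0" using norm_tangent[of a] by fastforce
    ultimately show ?thesis by (metis mult_left_cancel)
  qed
  hence "cnj (\<tau> a) * (\<tau> s * cis v) = cnj (cis v')"
    by (simp only: complex_cnj_mult complex_cnj_cnj)
  hence "cnj (\<tau> a) * (\<xi> a - \<xi> s) = of_real t * cnj (cis v')"
    unfolding u by (simp only: mult.left_commute)
  hence "arr s a = cos v'"
    using arrival_cos_eqI n t by (metis cis.sel(1) cnj.sel(1))
  thus "v' = arccos (arr s a)" using v by (simp add: arccos_cos)
next
  assume *: "s < a \<and> a < s + 1 \<and> v = arccos (dep s a) \<and> v' = arccos (arr s a)"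
  let ?u = "\<xi> a - \<xi> s"
  have n: "norm ?u > 0" using curve_distinct * by simp
  have n1: "norm (cnj (\<tau> s) * ?u) = norm ?u" and n2: "norm (cnj (cnj (\<tau> a) * ?u)) = norm ?u"
    unfolding complex_mod_cnj norm_mult norm_tangent mult_1 by (rule refl)+
  have "0 < Im (cnj (\<tau> s) * ?u)" using departure_upward * by blast
  note P = polar_upper_half_plane[OF this, folded departure_cos_polar, unfolded n1]
  have "v = arccos (dep s a)" using * by blast
  note P = P[folded this]
  have "0 < Im (cnj (cnj (\<tau> a) * ?u))"
    unfolding cnj.sel using arrival_downward * neg_0_less_iff_less by blast
  note Q = polar_upper_half_plane[OF this, folded arrival_cos_polar, unfolded n2]
  have "v' = arccos (arr s a)" using * by blast
  note Q = Q[folded this]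
  show "0 < v" "v < pi" by fact+
  have u: "?u = of_real (norm ?u) * (\<tau> s * cis v)"
    using P(3) unfolding rotate_by_tangent by (simp only: mult.left_commute)
  have "of_real (norm ?u) * cis v' = \<tau> a * cnj ?u" using Q(3) by (simp only: complex_cnj_mult complex_cnj_cnj)
  also have "cnj ?u = of_real (norm ?u) * cnj (\<tau> s * cis v)"
    using arg_cong[OF u, of cnj] by (simp only: complex_cnj_mult complex_cnj_complex_of_real)
  finally have "of_real (norm ?u) * cis v' = of_real (norm ?u) * (\<tau> a * cnj (\<tau> s * cis v))"
    by (simp only: mult.left_commute)
  moreover have "complex_of_real (norm ?u) \<noteq> 0" using n by simp
  ultimately have "cis v' = \<tau> a * cnj (\<tau> s * cis v)" by (metis mult_left_cancel)
  hence "\<tau> a * cis v' = (\<tau> a)\<^sup>2 * cnj (\<tau> s * cis v)"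
    by (simp only: power2_eq_square mult.assoc)
  moreover have "\<xi> a = \<xi> s + of_real (norm ?u) * (\<tau> s * cis v)"
    using u by (simp only: diff_eq_eq add.commute)
  ultimately show "billiard_step \<xi> (s, v) (a, v')"
    using * P(1,2) Q(1,2) n unfolding billiard_step_def Let_def split by metis
qed

text \<open>The ray meets the boundary once more only, since otherwise three boundary points would be
  collinear.\<close>

lemma billiard_step_unique:
  assumes "billiard_step \<xi> (s, v) z" "billiard_step \<xi> (s, v) z'" "0 < v" "v < pi"
  shows "z = z'"
proof -
  obtain a w b w' where z: "z = (a, w)" "z' = (b, w')" by fastforce
  have A: "s < a" "a < s + 1" "w = arccos (arr s a)" and B: "s < b" "b < s + 1" "w' = arccos (arr s b)"
    using assms billiard_step_iff z by auto
  have nless: "\<not> a < b" if st: "billiard_step \<xi> (s, v) (a, w)" "billiard_step \<xi> (s, v) (b, w')"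
    "s < a" "b < s + 1" for a b w w'
  proof
    assume "a < b"
    have "\<exists>t. \<xi> a = \<xi> s + of_real t * (\<tau> s * cis v)" "\<exists>t. \<xi> b = \<xi> s + of_real t * (\<tau> s * cis v)"
      using st by (auto simp: billiard_step_def Let_def)
    then obtain t t' where "\<xi> a - \<xi> s = of_real t * (\<tau> s * cis v)"
      "\<xi> b - \<xi> s = of_real t' * (\<tau> s * cis v)"
      by (metis add_diff_cancel_left')
    hence "cnj (\<xi> a - \<xi> s) * (\<xi> b - \<xi> s) = of_real (t * t') * ((\<tau> s * cis v) * cnj (\<tau> s * cis v))"
      by simp
    also have "(\<tau> s * cis v) * cnj (\<tau> s * cis v) = 1"
      unfolding complex_norm_square[symmetric] by (simp add: norm_mult)
    finally have "Im (cnj (\<xi> a - \<xi> s) * (\<xi> b - \<xi> s)) = 0" by (simp only: mult_1_right Im_complex_of_real)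
    thus False using not_collinear[of s a b] st \<open>a < b\<close> by simp
  qed
  have "a = b" using nless[of a w b w'] nless[of b w' a w] assms z A B by force
  thus ?thesis using z A B by simp
qed

text \<open>The ray from \<open>\<xi> s\<close> at angle \<open>v\<close> has the start of the boundary arc on its right and
  the end of the arc on its left.\<close>

lemma billiard_step_exists:
  assumes "0 < v" "v < pi"
  shows "\<exists>z. billiard_step \<xi> (s, v) z"
proof -
  define d where "d = \<tau> s * cis v"
  define f where "f t = Im (cnj d * (\<xi> t - \<xi> s))" for t
  have "((\<lambda>t. cnj d * (\<xi> t - \<xi> s)) has_vector_derivative cnj d * \<tau> t) (at t)" for t
    by (rule has_vector_derivative_mult_right[THEN has_vector_derivative_eq_rhs])
       (auto intro!: derivative_eq_intros curve_derivative)
  hence der: "(f has_real_derivative Im (cnj d * \<tau> t)) (at t)" for t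
    unfolding f_def has_real_derivative_iff_has_vector_derivative
    by (rule bounded_linear.has_vector_derivative[OF bounded_linear_Im])
  have "cnj d * \<tau> s = cnj (cis v) * (cnj (\<tau> s) * \<tau> s)" by (simp add: d_def mult_ac)
  hence neg: "Im (cnj d * \<tau> s) < 0"
    using sin_gt_zero assms by simp
  obtain e1 where e1: "e1 > 0" "\<And>h. 0 < h \<Longrightarrow> h < e1 \<Longrightarrow> f s > f (s + h)"
    using DERIV_neg_dec_right[OF der neg] by blast
  have "Im (cnj d * \<tau> (s + 1)) < 0" using neg by simp
  then obtain e2 where e2: "e2 > 0" "\<And>h. 0 < h \<Longrightarrow> h < e2 \<Longrightarrow> f (s + 1) < f (s + 1 - h)"
    using DERIV_neg_dec_left[OF der] by blast
  define a where "a = s + min (e1 / 2) (1 / 3)"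
  define b where "b = s + 1 - min (e2 / 2) (1 / 3)"
  have fs: "f s = 0" "f (s + 1) = 0" by (simp_all add: f_def)
  have ab: "s < a" "a < b" "b < s + 1" using e1(1) e2(1) by (auto simp: a_def b_def min_def)
  have "f a < 0" using e1(2)[of "a - s"] e1(1) fs by (auto simp: a_def min_def split: if_splits)
  moreover have "f b > 0"
    using e2(2)[of "s + 1 - b"] e2(1) fs by (auto simp: b_def min_def split: if_splits)
  moreover have "continuous_on {a..b} f"
    unfolding f_def by (intro continuous_intros continuous_curve)
  ultimately obtain c where c: "a \<le> c" "c \<le> b" "f c = 0"
    using IVT'[of f a 0 b] ab by auto
  have sc: "s < c" "c < s + 1" using c ab by auto
  define r where "r = Re (cnj d * (\<xi> c - \<xi> s))"
  have dd: "d * cnj d = 1"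
    unfolding d_def complex_norm_square[symmetric] by (simp add: norm_mult)
  have "cnj d * (\<xi> c - \<xi> s) = of_real r"
    using c(3) by (simp only: r_def f_def complex_eq_iff Re_complex_of_real Im_complex_of_real simp_thms)
  hence "d * (cnj d * (\<xi> c - \<xi> s)) = d * of_real r" by simp
  hence u: "\<xi> c - \<xi> s = of_real r * d"
    by (simp only: mult.assoc[symmetric] dd mult_1 mult.commute)
  have w: "cnj (\<tau> s) * (\<xi> c - \<xi> s) = of_real r * cis v"
    unfolding rotate_by_tangent u d_def by (simp only: mult.left_commute)
  hence "0 < Im (of_real r * cis v)"
    using departure_upward[OF sc] by metis
  hence r: "r > 0" using sin_gt_zero[OF assms] by (simp add: zero_less_mult_iff)
  have "norm (\<xi> c - \<xi> s) = r" unfolding u d_def using r by (simp add: norm_mult)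
  hence "dep s c = cos v"
    using departure_cos_eqI w r by (metis cis.sel(1))
  hence "v = arccos (dep s c)" using assms by (simp add: arccos_cos)
  thus ?thesis using billiard_step_iff sc by blast
qed

lemma billiard_map_step:
  assumes "0 < v" "v < pi"
  shows "billiard_step \<xi> (s, v) (billiard_map \<xi> (s, v))"
proof -
  have "billiard_map \<xi> (s, v) = (THE z'. billiard_step \<xi> (s, v) z')"
    using assms by (simp add: billiard_map_def)
  thus ?thesis
    using theI'[of "billiard_step \<xi> (s, v)"] billiard_step_exists billiard_step_unique assms by metis
qed

lemma billiard_map_interior:
  assumes "0 < v" "v < pi"
  obtains a v' where "billiard_map \<xi> (s, v) = (a, v')" "s < a" "a < s + 1" "0 < v'" "v' < pi"
    "dep s a = cos v" "arr s a = cos v'"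
proof -
  obtain a v' where z: "billiard_map \<xi> (s, v) = (a, v')" by fastforce
  have st: "billiard_step \<xi> (s, v) (a, v')" using billiard_map_step[OF assms] z by metis
  hence *: "s < a" "a < s + 1" "v = arccos (dep s a)" "v' = arccos (arr s a)"
    using billiard_step_iff assms by blast+
  have "0 < v'" "v' < pi" using st by (auto simp: billiard_step_def Let_def)
  moreover
  have "\<bar>dep s a\<bar> \<le> 1" "\<bar>arr s a\<bar> \<le> 1"
    unfolding departure_cos_polar arrival_cos_polar by (rule abs_Re_div_norm_le_1)+
  hence "cos v = dep s a" "cos v' = arr s a"
    unfolding *(3,4) by (simp_all add: cos_arccos_abs)
  ultimately show ?thesis
    using that[OF z] *(1,2) by simp
qed

lemma billiard_map_chord:
  assumes "s < a" "a < s + 1"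
  shows "billiard_map \<xi> (s, arccos (dep s a)) = (a, arccos (arr s a))"
    "0 < arccos (dep s a)" "arccos (dep s a) < pi"
    "0 < arccos (arr s a)" "arccos (arr s a) < pi"
    "cos (arccos (dep s a)) = dep s a" "cos (arccos (arr s a)) = arr s a"
proof -
  have st: "billiard_step \<xi> (s, arccos (dep s a)) (a, arccos (arr s a))"
    and v: "0 < arccos (dep s a)" "arccos (dep s a) < pi"
    using billiard_step_iff[of s "arccos (dep s a)" a "arccos (arr s a)"] assms by simp_all
  show eq: "billiard_map \<xi> (s, arccos (dep s a)) = (a, arccos (arr s a))"
    using billiard_step_unique[OF billiard_map_step[OF v] st v] .
  show "0 < arccos (dep s a)" "arccos (dep s a) < pi" by fact+
  show "0 < arccos (arr s a)" "arccos (arr s a) < pi"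
    using st by (auto simp: billiard_step_def Let_def)
  show "cos (arccos (dep s a)) = dep s a" "cos (arccos (arr s a)) = arr s a"
    by (rule billiard_map_interior[OF v, of s]; simp add: eq)+
qed

lemma billiard_map_annulus: "z \<in> annulus \<Longrightarrow> billiard_map \<xi> z \<in> annulus"
proof -
  assume "z \<in> annulus"
  then obtain s v where z: "z = (s, v)" "0 \<le> v" "v \<le> pi" by (auto simp: annulus_def)
  show ?thesis
  proof (cases "0 < v \<and> v < pi")
    case True
    then obtain a v' where "billiard_map \<xi> (s, v) = (a, v')" "0 < v'" "v' < pi"
      using billiard_map_interior by metis
    thus ?thesis using z by (simp add: annulus_def)
  next
    case False
    thus ?thesis using z by (auto simp: annulus_def billiard_map_def)
  qed
qed

subsection \<open>The generating function\<close>

abbreviation h where "h \<equiv> gen_fun \<xi>"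

lemma gen_fun_le_0 [simp]: "h x y \<le> 0"
  and gen_fun_refl [simp]: "h x x = 0"
  by (simp_all add: gen_fun_def)

lemma gen_fun_shift [simp]: "h (x + of_int k) (y + of_int k) = h x y"
  by (simp add: gen_fun_def)

lemma gen_fun_lipschitz: "\<bar>h x y - h x' y'\<bar> \<le> \<bar>x - x'\<bar> + \<bar>y - y'\<bar>"
proof -
  have "\<bar>h x y - h x' y'\<bar> \<le> norm ((\<xi> x - \<xi> y) - (\<xi> x' - \<xi> y'))"
    unfolding gen_fun_def using norm_triangle_ineq3[of "\<xi> x - \<xi> y" "\<xi> x' - \<xi> y'"] by linarith
  also have "\<dots> = norm ((\<xi> x - \<xi> x') - (\<xi> y - \<xi> y'))" by (simp add: algebra_simps)
  also have "\<dots> \<le> norm (\<xi> x - \<xi> x') + norm (\<xi> y - \<xi> y')" by (rule norm_triangle_ineq4)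
  finally show ?thesis using curve_lipschitz[of x x'] curve_lipschitz[of y y'] by linarith
qed

text \<open>A chord is not longer than either of the two arcs that it cuts off.\<close>

lemma gen_fun_ge: "h x y \<ge> - \<bar>y - x\<bar>" and gen_fun_ge_turn: "h x y \<ge> - \<bar>1 - (y - x)\<bar>"
proof -
  show "h x y \<ge> - \<bar>y - x\<bar>"
    using curve_lipschitz[of x y] by (simp add: gen_fun_def abs_minus_commute)
  show "h x y \<ge> - \<bar>1 - (y - x)\<bar>"
  proof -
    have "norm (\<xi> x - \<xi> y) \<le> \<bar>x + 1 - y\<bar>"
      using curve_lipschitz[of "x + 1" y] unfolding curve_periodic .
    also have "x + 1 - y = 1 - (y - x)" by simp
    finally show ?thesis unfolding gen_fun_def by linarith
  qed
qed

lemma continuous_gen_fun [continuous_intros]: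
  "continuous_on A f \<Longrightarrow> continuous_on A g \<Longrightarrow> continuous_on A (\<lambda>z. h (f z) (g z))"
  unfolding gen_fun_def
  by (intro continuous_intros continuous_on_compose2[OF continuous_curve]) auto

text \<open>The first variation formula: \<open>dh\<close> is the difference of the one-form \<open>- cos v ds\<close> at the end
  and at the start of the chord.\<close>

lemma gen_fun_has_derivative:
  assumes "(f has_derivative f') (at z within A)" "(g has_derivative g') (at z within A)"
    and "\<xi> (f z) \<noteq> \<xi> (g z)"
  shows "((\<lambda>z. h (f z) (g z)) has_derivative
    (\<lambda>w. dep (f z) (g z) * f' w - arr (f z) (g z) * g' w)) (at z within A)"
proof -
  have cd: "(\<xi> has_derivative (\<lambda>t. t *\<^sub>R \<tau> s)) (at s)" for s
    using curve_derivative[of s UNIV] by (simp add: has_vector_derivative_def)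
  have "((\<lambda>z. \<xi> (f z) - \<xi> (g z)) has_derivative
      (\<lambda>w. f' w *\<^sub>R \<tau> (f z) - g' w *\<^sub>R \<tau> (g z))) (at z within A)"
    by (intro has_derivative_diff has_derivative_compose[OF assms(1) cd]
        has_derivative_compose[OF assms(2) cd])
  moreover have "(norm has_derivative (\<lambda>w. w \<bullet> sgn (\<xi> (f z) - \<xi> (g z)))) (at (\<xi> (f z) - \<xi> (g z)))"
    using assms(3) by (intro has_derivative_norm) auto
  ultimately have "((\<lambda>z. norm (\<xi> (f z) - \<xi> (g z))) has_derivative
      (\<lambda>w. (f' w *\<^sub>R \<tau> (f z) - g' w *\<^sub>R \<tau> (g z)) \<bullet> sgn (\<xi> (f z) - \<xi> (g z)))) (at z within A)"
    by (rule has_derivative_compose)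
  from has_derivative_minus[OF this] show ?thesis
    unfolding gen_fun_def
  proof (rule has_derivative_eq_rhs, intro ext)
    fix w
    define u where "u = \<xi> (f z) - \<xi> (g z)"
    have u: "\<xi> (f z) - \<xi> (g z) = u" "\<xi> (g z) - \<xi> (f z) = - u" by (simp_all add: u_def)
    have "sgn u = (1 / norm u) *\<^sub>R u" by (simp add: sgn_div_norm divide_inverse)
    thus "- ((f' w *\<^sub>R \<tau> (f z) - g' w *\<^sub>R \<tau> (g z)) \<bullet> sgn (\<xi> (f z) - \<xi> (g z))) =
      dep (f z) (g z) * f' w - arr (f z) (g z) * g' w"
      unfolding departure_cos_def arrival_cos_def u
      by (simp add: inner_diff_left diff_divide_distrib mult.commute)
  qed
qed

text \<open>The twist property in its integrated form. Since \<open>arr\<close> increases with the starting point,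
  \<open>h a t - h b t\<close> is nondecreasing in \<open>t\<close>.\<close>

lemma gen_fun_monge:
  assumes "a \<le> b" "b \<le> c" "c \<le> d" "d \<le> a + 1"
  shows "h a c + h b d \<le> h a d + h b c"
proof (cases "a = b")
  case False
  have "h a c - h b c \<le> h a d - h b d"
  proof (rule DERIV_nonneg_imp_increasing_open[OF assms(3)])
    fix t assume t: "c < t" "t < d"
    have lt: "a < b" "b < t" "t < a + 1" using False assms t by auto
    have "\<xi> a \<noteq> \<xi> t" "\<xi> b \<noteq> \<xi> t"
      using curve_distinct[of a t] curve_distinct[of b t] lt by auto
    hence "((\<lambda>t. h a t - h b t) has_derivative
        (\<lambda>w. (dep a t * 0 - arr a t * w) - (dep b t * 0 - arr b t * w))) (at t)"
      by (intro has_derivative_diff gen_fun_has_derivative) auto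
    hence "((\<lambda>t. h a t - h b t) has_real_derivative (arr b t - arr a t)) (at t)"
      unfolding has_field_derivative_def by (rule has_derivative_eq_rhs) (auto simp: algebra_simps)
    moreover have "0 \<le> arr b t - arr a t" using arrival_cos_mono lt by simp
    ultimately show "\<exists>y. ((\<lambda>t. h a t - h b t) has_real_derivative y) (at t) \<and> 0 \<le> y" by blast
  qed (intro continuous_intros)
  thus ?thesis by simp
qed simp

end

section \<open>The least action of a rotation number\<close>

definition action :: "(real \<Rightarrow> complex) \<Rightarrow> nat \<Rightarrow> (nat \<Rightarrow> real) \<Rightarrow> real" where
  "action \<xi> q x = (\<Sum>i<q. gen_fun \<xi> (x i) (x (Suc i)))"

text \<open>Configurations without a prescribed base point. They are closed under the shifts and sortings
  used below, and their infimum is the iterated infimum in the definition of \<^const>\<open>beta_rat\<close>.\<close>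

definition all_configurations :: "int \<Rightarrow> nat \<Rightarrow> (nat \<Rightarrow> real) set" where
  "all_configurations p q =
     {x. x q = x 0 + of_int p \<and> (\<forall>i<q. x i \<le> x (Suc i) \<and> x (Suc i) \<le> x i + 1)}"

definition least_action :: "(real \<Rightarrow> complex) \<Rightarrow> int \<Rightarrow> nat \<Rightarrow> real" where
  "least_action \<xi> p q = (INF x\<in>all_configurations p q. action \<xi> q x)"

lemma all_configurations_D:
  assumes "x \<in> all_configurations p q"
  shows "x q = x 0 + of_int p" "i < q \<Longrightarrow> x i \<le> x (Suc i)" "i < q \<Longrightarrow> x (Suc i) \<le> x i + 1"
  using assms by (auto simp: all_configurations_def)

lemma all_configurations_nonempty:
  assumes "0 \<le> p" "p \<le> int q"
  shows "all_configurations p q \<noteq> {}"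
proof (cases "q = 0")
  case True
  thus ?thesis using assms by (auto simp: all_configurations_def)
next
  case False
  have "real_of_int p \<le> real q" using assms by linarith
  hence "(\<lambda>i. real i * of_int p / real q) \<in> all_configurations p q"
    using assms False by (auto simp: all_configurations_def field_simps)
  thus ?thesis by blast
qed

lemma all_configurations_UN: "all_configurations p q = (\<Union>s\<in>{0..1}. configurations p q s)"
proof (intro equalityI subsetI)
  fix x assume x: "x \<in> all_configurations p q"
  have "x 0 - frac (x 0) \<in> \<int>" by (simp add: frac_def)
  hence "x \<in> configurations p q (frac (x 0))"
    using x by (auto simp: all_configurations_def configurations_def)
  moreover have "frac (x 0) \<in> {0..1}" using frac_ge_0 frac_lt_1[of "x 0"] by (auto intro: less_imp_le)
  ultimately show "x \<in> (\<Union>s\<in>{0..1}. configurations p q s)" by blast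
qed (auto simp: all_configurations_def configurations_def)

lemma configurations_nonempty:
  assumes "0 \<le> p" "p \<le> int q"
  shows "configurations p q s \<noteq> {}"
proof -
  obtain x where x: "x \<in> all_configurations p q"
    using all_configurations_nonempty[OF assms] by blast
  hence "(\<lambda>i. x i - x 0 + s) \<in> configurations p q s"
    by (auto simp: all_configurations_def configurations_def)
  thus ?thesis by blast
qed

lemma periodic_extension:
  assumes x: "x \<in> all_configurations p q" and "0 < q"
  obtains y where "\<And>i. i \<le> q \<Longrightarrow> y i = x i" "\<And>n. y (n + q) = y n + of_int p"
    "\<And>n. y n \<le> y (Suc n)" "\<And>n. y (Suc n) \<le> y n + 1"
proof -
  note xD = all_configurations_D[OF x]
  define y where "y n = x (n mod q) + real (n div q) * of_int p" for n
  have ySuc: "y (Suc n) = x (Suc (n mod q)) + real (n div q) * of_int p" for n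
  proof (cases "Suc (n mod q) = q")
    case True
    thus ?thesis using xD(1) by (simp add: y_def mod_Suc div_Suc algebra_simps)
  next
    case False
    thus ?thesis by (simp add: y_def mod_Suc div_Suc)
  qed
  show thesis
  proof (rule that[of y])
    show "y i = x i" if "i \<le> q" for i
      using that xD(1) assms(2) by (cases "i = q") (simp_all add: y_def)
    show "y (n + q) = y n + of_int p" for n
      using assms(2) by (simp add: y_def algebra_simps)
    show "y n \<le> y (Suc n)" "y (Suc n) \<le> y n + 1" for n
      using xD(2,3)[of "n mod q"] assms(2) unfolding ySuc by (simp_all add: y_def)
  qed
qed

lemma sorted_list_of_multiset_add_max:
  assumes "\<And>y. y \<in># A \<Longrightarrow> y \<le> x"
  shows "sorted_list_of_multiset (add_mset x A) = sorted_list_of_multiset A @ [x]"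
proof -
  have "sorted (sorted_list_of_multiset A @ [x])"
    using assms by (simp add: sorted_append)
  hence "sort (sorted_list_of_multiset A @ [x]) = sorted_list_of_multiset A @ [x]"
    by (rule sorted_sort_id)
  moreover have "sort (sorted_list_of_multiset A @ [x]) =
      sorted_list_of_multiset (mset (sorted_list_of_multiset A @ [x]))"
    by (rule sorted_list_of_multiset_mset[symmetric])
  ultimately show ?thesis by (simp del: sorted_list_of_multiset_mset)
qed

lemma sorted_list_of_multiset_shift:
  fixes A :: "real multiset"
  shows "sorted_list_of_multiset (image_mset (\<lambda>x. x + c) A) =
    map (\<lambda>x. x + c) (sorted_list_of_multiset A)"
proof -
  have "sorted (map (\<lambda>x. x + c) (sorted_list_of_multiset A))"
    by (simp add: sorted_map)
  hence "sort (map (\<lambda>x. x + c) (sorted_list_of_multiset A)) =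
      map (\<lambda>x. x + c) (sorted_list_of_multiset A)"
    by (rule sorted_sort_id)
  thus ?thesis
    by (metis mset_map mset_sorted_list_of_multiset sorted_list_of_multiset_mset)
qed

lemma sum_blocks:
  fixes f :: "nat \<Rightarrow> real"
  shows "(\<Sum>j<k. \<Sum>i<q. f (j * q + i)) = sum f {..<k * q}"
proof -
  have "(\<Sum>i<q. f (j * q + i)) = sum f {j * q..<j * q + q}" for j
    using sum.shift_bounds_nat_ivl[of f 0 "j * q" q] by (simp add: lessThan_atLeast0 add.commute)
  thus ?thesis using sum.nat_group[of f q k] by simp
qed

context billiard
begin

lemma action_ge:
  assumes "x \<in> all_configurations p q"
  shows "- of_int p \<le> action \<xi> q x"
proof -
  have "(\<Sum>i<q. - (x (Suc i) - x i)) \<le> action \<xi> q x"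
    unfolding action_def
  proof (rule sum_mono)
    fix i assume "i \<in> {..<q}"
    thus "- (x (Suc i) - x i) \<le> h (x i) (x (Suc i))"
      using gen_fun_ge[of "x (Suc i)" "x i"] all_configurations_D(2)[OF assms, of i] by auto
  qed
  moreover have "(\<Sum>i<q. - (x (Suc i) - x i)) = - (x q - x 0)"
    by (simp only: sum_negf sum_lessThan_telescope)
  ultimately show ?thesis using all_configurations_D(1)[OF assms] by simp
qed

lemma action_nonpos: "action \<xi> q x \<le> 0"
  unfolding action_def by (rule sum_nonpos) simp

lemma bdd_below_action: "bdd_below (action \<xi> q ` all_configurations p q)"
  using action_ge by (auto simp: bdd_below_def)

lemma least_action_le: "x \<in> all_configurations p q \<Longrightarrow> least_action \<xi> p q \<le> action \<xi> q x"
  unfolding least_action_def by (rule cINF_lower[OF bdd_below_action])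

lemma least_action_greatest:
  assumes "0 \<le> p" "p \<le> int q" "\<And>x. x \<in> all_configurations p q \<Longrightarrow> c \<le> action \<xi> q x"
  shows "c \<le> least_action \<xi> p q"
  unfolding least_action_def by (intro cINF_greatest all_configurations_nonempty assms)

lemma beta_rat_least_action:
  assumes "quotient_of r = (p, q)" "0 \<le> p" "p \<le> q"
  shows "beta_rat \<xi> r = least_action \<xi> p (nat q) / of_int q"
proof -
  have "q > 0" using assms quotient_of_denom_pos by blast
  have "(INF s\<in>{0..1}. min_action \<xi> p (nat q) s) = least_action \<xi> p (nat q)"
    unfolding least_action_def all_configurations_UN min_action_def action_def
  proof (rule cINF_UNION[symmetric])
    show "bdd_below (\<Union>s\<in>{0..1}. (\<lambda>x. \<Sum>i<nat q. h (x i) (x (Suc i))) ` configurations p (nat q) s)"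
      using bdd_below_action[of "nat q" p] unfolding all_configurations_UN action_def image_UN .
  qed (use configurations_nonempty assms \<open>q > 0\<close> in auto)
  thus ?thesis using assms by (simp add: beta_rat_def)
qed

text \<open>Exchanging the partners of the largest source and the largest target keeps all jumps in
  \<open>[0, 1]\<close> and, by the Monge inequality, does not raise the action; this sorts the matching.\<close>

lemma sorted_matching_least:
  fixes M :: "(real \<times> real) multiset"
  assumes "\<And>x y. (x, y) \<in># M \<Longrightarrow> x \<le> y \<and> y \<le> x + 1"
  shows "(\<forall>(x, y)\<in>set (zip (sorted_list_of_multiset (image_mset fst M))
            (sorted_list_of_multiset (image_mset snd M))). x \<le> y \<and> y \<le> x + 1) \<and>
    (\<Sum>(x, y)\<leftarrow>zip (sorted_list_of_multiset (image_mset fst M))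
            (sorted_list_of_multiset (image_mset snd M)). h x y) \<le> (\<Sum>(x, y)\<in>#M. h x y)"
    (is "?P M")
  using assms
proof (induction "size M" arbitrary: M)
  case 0
  thus ?case by simp
next
  case (Suc n)
  note valid = Suc.prems
  have ne: "M \<noteq> {#}" using Suc.hyps(2) by auto
  define X where "X = Max (fst ` set_mset M)"
  define Y where "Y = Max (snd ` set_mset M)"
  have leX: "x \<le> X" and leY: "y \<le> Y" if "(x, y) \<in># M" for x y
    unfolding X_def Y_def using that by (force intro!: Max_ge)+
  have "X \<in> fst ` set_mset M" "Y \<in> snd ` set_mset M"
    unfolding X_def Y_def using ne by (auto intro!: Max_in)
  then obtain b a where b: "(X, b) \<in># M" and a: "(a, Y) \<in># M" by auto
  have "\<exists>N. M = add_mset (X, Y) N \<or>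
      (\<exists>a b. M = add_mset (X, b) (add_mset (a, Y) N))"
  proof (cases "(X, Y) \<in># M")
    case True
    thus ?thesis by (metis multi_member_split)
  next
    case False
    then obtain N where N: "M = add_mset (X, b) N" using b by (metis multi_member_split)
    have "(a, Y) \<in># N" using a N False by auto
    thus ?thesis using N by (metis multi_member_split)
  qed
  then obtain N where "M = add_mset (X, Y) N \<or> (\<exists>a b. M = add_mset (X, b) (add_mset (a, Y) N))"
    by blast
  then obtain M' where M': "size M' = n" "\<And>x y. (x, y) \<in># M' \<Longrightarrow> x \<le> y \<and> y \<le> x + 1"
    "image_mset fst M = add_mset X (image_mset fst M')"
    "image_mset snd M = add_mset Y (image_mset snd M')"
    "X \<le> Y" "Y \<le> X + 1"
    "h X Y + (\<Sum>(x, y)\<in>#M'. h x y) \<le> (\<Sum>(x, y)\<in>#M. h x y)"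
  proof (elim disjE exE)
    assume M: "M = add_mset (X, Y) N"
    show thesis
      by (rule that[of N]) (use Suc.hyps(2) M valid[of X Y] valid in auto)
  next
    fix a b assume M: "M = add_mset (X, b) (add_mset (a, Y) N)"
    have v: "X \<le> b" "b \<le> X + 1" "a \<le> Y" "Y \<le> a + 1" and le: "a \<le> X" "b \<le> Y"
      using valid[of X b] valid[of a Y] leX[of a Y] leY[of X b] M by auto
    have "h a b + h X Y \<le> h a Y + h X b"
      by (rule gen_fun_monge) (use v le in auto)
    show thesis
    proof -
      have "a \<le> b" "b \<le> a + 1" "X \<le> Y" "Y \<le> X + 1" using v le by linarith+
      thus thesis
        by (intro that[of "add_mset (a, b) N"])
           (use Suc.hyps(2) M valid \<open>h a b + h X Y \<le> h a Y + h X b\<close> in auto)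
    qed
  qed
  have mX: "x \<le> X" if "x \<in># image_mset fst M'" for x
  proof -
    have "x \<in># image_mset fst M" using that M'(3) by auto
    thus ?thesis using leX by auto
  qed
  have mY: "y \<le> Y" if "y \<in># image_mset snd M'" for y
  proof -
    have "y \<in># image_mset snd M" using that M'(4) by auto
    thus ?thesis using leY by auto
  qed
  have "?P M'" using Suc.hyps(1)[OF M'(1)[symmetric]] M'(2) by blast
  moreover have "length (sorted_list_of_multiset (image_mset fst M')) =
      length (sorted_list_of_multiset (image_mset snd M'))"
    by (metis mset_sorted_list_of_multiset size_image_mset size_mset)
  moreover have "sorted_list_of_multiset (image_mset fst M) =
      sorted_list_of_multiset (image_mset fst M') @ [X]"
    unfolding M'(3) by (rule sorted_list_of_multiset_add_max[OF mX])
  moreover have "sorted_list_of_multiset (image_mset snd M) =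
      sorted_list_of_multiset (image_mset snd M') @ [Y]"
    unfolding M'(4) by (rule sorted_list_of_multiset_add_max[OF mY])
  ultimately show ?case using M'(5,6,7) by auto
qed

text \<open>The \<open>k\<close> translates of a configuration by multiples of one period, sorted at each time, are
  \<open>k\<close> configurations of the smaller period.\<close>

lemma least_action_multiple_le_action:
  assumes x: "x \<in> all_configurations (int k * p) (k * q)"
  shows "real k * least_action \<xi> p q \<le> action \<xi> (k * q) x"
proof -
  define X where "X j i = x (j * q + i) - real j * of_int p" for j i
  define A where "A i = image_mset (\<lambda>j. X j i) (mset_set {..<k})" for i
  \<comment> \<open>Advancing all translates by one period permutes them up to the shift by \<open>p\<close>, so the sorted
    values at time \<open>q\<close> are those at time 0 shifted by \<open>p\<close>.\<close>
  define y where "y i = sorted_list_of_multiset (A i)" for i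
  have len: "length (y i) = k" for i
    by (metis A_def y_def card_lessThan mset_sorted_list_of_multiset size_image_mset size_mset
        size_mset_set)
  have idx: "j * q + i < k * q" if "j < k" "i < q" for i j
  proof -
    have "j * q + i < Suc j * q" using that by simp
    also have "\<dots> \<le> k * q" using that by (intro mult_right_mono) auto
    finally show ?thesis .
  qed
  have matching: "(\<forall>(a, b)\<in>set (zip (y i) (y (Suc i))). a \<le> b \<and> b \<le> a + 1) \<and>
      (\<Sum>(a, b)\<leftarrow>zip (y i) (y (Suc i)). h a b) \<le> (\<Sum>j<k. h (X j i) (X j (Suc i)))" if "i < q" for i
  proof -
    define M where "M = image_mset (\<lambda>j. (X j i, X j (Suc i))) (mset_set {..<k})"
    have "a \<le> b \<and> b \<le> a + 1" if ab: "(a, b) \<in># M" for a b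
    proof -
      obtain j where j: "j < k" "a = X j i" "b = X j (Suc i)" using ab by (auto simp: M_def)
      show ?thesis
        using all_configurations_D(2,3)[OF x idx[OF j(1) \<open>i < q\<close>]] j by (simp add: X_def)
    qed
    note sorted_matching_least[of M, OF this]
    moreover have "image_mset fst M = A i" "image_mset snd M = A (Suc i)"
      by (simp_all add: M_def A_def image_mset.compositionality o_def)
    moreover have "(\<Sum>(a, b)\<in>#M. h a b) = (\<Sum>j<k. h (X j i) (X j (Suc i)))"
      by (simp add: M_def image_mset.compositionality o_def sum_unfold_sum_mset)
    ultimately show ?thesis by (simp add: y_def)
  qed
  have "A q = image_mset (\<lambda>a. a + of_int p) (A 0)"
  proof -
    have step: "X j q = X (Suc j) 0 + of_int p" for j
      by (simp add: X_def algebra_simps)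
    have last: "X k 0 = X 0 0"
      using all_configurations_D(1)[OF x] by (simp add: X_def)
    have "A q = image_mset (\<lambda>j. X j 0 + of_int p) (image_mset Suc (mset_set {..<k}))"
      by (simp add: A_def step image_mset.compositionality o_def)
    also have "image_mset Suc (mset_set {..<k}) = mset_set {Suc 0..k}"
      by (subst image_mset_mset_set) (auto simp: lessThan_atLeast0 image_Suc_atLeastLessThan
          atLeastLessThanSuc_atLeastAtMost)
    also have "image_mset (\<lambda>j. X j 0 + of_int p) (mset_set {Suc 0..k}) =
        image_mset (\<lambda>j. X j 0 + of_int p) (mset_set {..<k})"
    proof (cases k)
      case (Suc m)
      have "{Suc 0..k} = insert k {Suc 0..<k}" "{..<k} = insert 0 {Suc 0..<k}" using Suc by auto
      thus ?thesis using last Suc by simp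
    qed simp
    finally show ?thesis by (simp add: A_def image_mset.compositionality o_def)
  qed
  hence yq: "y q = map (\<lambda>a. a + of_int p) (y 0)"
    by (simp add: y_def sorted_list_of_multiset_shift)
  have conf: "(\<lambda>i. y i ! m) \<in> all_configurations p q" if "m < k" for m
    unfolding all_configurations_def
  proof (intro CollectI conjI allI impI)
    show "y q ! m = y 0 ! m + of_int p" using yq len that by simp
    fix i assume i: "i < q"
    have "(y i ! m, y (Suc i) ! m) \<in> set (zip (y i) (y (Suc i)))"
      using len that by (metis in_set_zip fst_conv snd_conv)
    thus "y i ! m \<le> y (Suc i) ! m" "y (Suc i) ! m \<le> y i ! m + 1"
      using matching[OF i] by blast+
  qed
  have "real k * least_action \<xi> p q = (\<Sum>m<k. least_action \<xi> p q)" by simp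
  also have "\<dots> \<le> (\<Sum>m<k. action \<xi> q (\<lambda>i. y i ! m))"
    by (intro sum_mono least_action_le conf) simp
  also have "\<dots> = (\<Sum>i<q. \<Sum>m<k. h (y i ! m) (y (Suc i) ! m))"
    unfolding action_def by (rule sum.swap)
  also have "\<dots> = (\<Sum>i<q. \<Sum>(a, b)\<leftarrow>zip (y i) (y (Suc i)). h a b)"
    by (intro sum.cong refl) (simp add: sum_list_sum_nth len lessThan_atLeast0)
  also have "\<dots> \<le> (\<Sum>i<q. \<Sum>j<k. h (X j i) (X j (Suc i)))"
    by (intro sum_mono) (use matching in auto)
  also have "\<dots> = (\<Sum>j<k. \<Sum>i<q. h (x (j * q + i)) (x (Suc (j * q + i))))"
    unfolding sum.swap[of _ "{..<q}"]
  proof (intro sum.cong refl)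
    fix j i
    have "h (X j i) (X j (Suc i)) =
        h (x (j * q + i) + of_int (- (int j * p))) (x (Suc (j * q + i)) + of_int (- (int j * p)))"
      by (simp add: X_def)
    thus "h (X j i) (X j (Suc i)) = h (x (j * q + i)) (x (Suc (j * q + i)))"
      by (simp only: gen_fun_shift)
  qed
  also have "\<dots> = action \<xi> (k * q) x"
    unfolding action_def by (rule sum_blocks)
  finally show ?thesis .
qed

lemma least_action_multiple_le:
  assumes "0 \<le> p" "p \<le> int q" "0 < q"
  shows "least_action \<xi> (int k * p) (k * q) \<le> real k * least_action \<xi> p q"
proof -
  have main: "least_action \<xi> (int k * p) (k * q) \<le> real k * action \<xi> q x"
    if x: "x \<in> all_configurations p q" for x
  proof -
    obtain y where y: "\<And>i. i \<le> q \<Longrightarrow> y i = x i" "\<And>n. y (n + q) = y n + of_int p"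
      "\<And>n. y n \<le> y (Suc n)" "\<And>n. y (Suc n) \<le> y n + 1"
      by (rule periodic_extension[OF x assms(3)], rule that)
    have shift: "y (j * q + i) = y i + of_int (int j * p)" for j i
    proof (induction j)
      case (Suc j)
      have e: "Suc j * q + i = (j * q + i) + q" by simp
      show ?case unfolding e y(2) Suc.IH by (simp add: algebra_simps)
    qed simp
    have "y \<in> all_configurations (int k * p) (k * q)"
      using shift[of k 0] y(3,4) by (simp add: all_configurations_def)
    hence "least_action \<xi> (int k * p) (k * q) \<le> action \<xi> (k * q) y" by (rule least_action_le)
    also have "action \<xi> (k * q) y = (\<Sum>j<k. \<Sum>i<q. h (y (j * q + i)) (y (Suc (j * q + i))))"
      unfolding action_def by (rule sum_blocks[symmetric])
    also have "\<dots> = (\<Sum>j<k. action \<xi> q x)"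
      unfolding action_def
    proof (intro sum.cong refl)
      fix j i assume "i \<in> {..<q}"
      thus "h (y (j * q + i)) (y (Suc (j * q + i))) = h (x i) (x (Suc i))"
        using shift[of j i] shift[of j "Suc i"] y(1)[of i] y(1)[of "Suc i"]
        by (simp only: add_Suc_right gen_fun_shift) simp
    qed
    finally show ?thesis by simp
  qed
  show ?thesis
  proof (cases "k = 0")
    case True
    thus ?thesis using main all_configurations_nonempty[OF assms(1,2)] by fastforce
  next
    case False
    have "least_action \<xi> (int k * p) (k * q) / real k \<le> least_action \<xi> p q"
      by (rule least_action_greatest[OF assms(1,2)]) (use main False in \<open>simp add: field_simps\<close>)
    thus ?thesis using False by (simp add: field_simps)
  qed
qed

lemma least_action_multiple:
  assumes "0 \<le> p" "p \<le> int q" "0 < q"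
  shows "least_action \<xi> (int k * p) (k * q) = real k * least_action \<xi> p q"
proof (rule antisym)
  show "real k * least_action \<xi> p q \<le> least_action \<xi> (int k * p) (k * q)"
  proof (rule least_action_greatest)
    show "int k * p \<le> int (k * q)" using assms by (simp add: mult_left_mono)
  qed (use assms least_action_multiple_le_action in auto)
qed (rule least_action_multiple_le[OF assms])

text \<open>A configuration of winding number \<open>p\<close> is cut off at height \<open>x 0 + p'\<close> when \<open>p' \<le> p\<close>, and
  continued by full turns, whose action is 0, when \<open>p' \<ge> p\<close>.\<close>

lemma least_action_lipschitz:
  assumes "0 \<le> p" "p \<le> int q" "0 \<le> p'" "p' \<le> int q"
  shows "least_action \<xi> p' q \<le> least_action \<xi> p q + \<bar>of_int p' - of_int p\<bar>"
proof -
  have "\<exists>y\<in>all_configurations p' q. action \<xi> q y \<le> action \<xi> q x + \<bar>of_int p' - of_int p\<bar>"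
    if x: "x \<in> all_configurations p q" for x
  proof -
    note xD = all_configurations_D[OF x]
    have mono: "x 0 \<le> x i" if "i \<le> q" for i
      using that
    proof (induction i)
      case (Suc i)
      thus ?case using xD(2)[of i] by auto
    qed simp
    have max: "x q - x i \<le> real (q - i)" if "i \<le> q" for i
      using that
    proof (induction "q - i" arbitrary: i)
      case (Suc n)
      thus ?case using Suc.hyps(1)[of "Suc i"] xD(3)[of i] by (simp add: of_nat_diff) linarith
    qed simp
    have finish: ?thesis
      if y: "y \<in> all_configurations p' q" and e: "\<And>i. i < q \<Longrightarrow>
        h (y i) (y (Suc i)) \<le> h (x i) (x (Suc i)) + (e (Suc i) - e i)"
        and "e q - e 0 \<le> \<bar>of_int p' - of_int p\<bar>" for y e
    proof -
      have "action \<xi> q y \<le> (\<Sum>i<q. h (x i) (x (Suc i)) + (e (Suc i) - e i))"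
        unfolding action_def by (intro sum_mono e) simp
      also have "\<dots> = action \<xi> q x + (e q - e 0)"
        by (simp only: sum.distrib sum_lessThan_telescope action_def)
      finally show ?thesis using y that(3) by (intro bexI[of _ y]) auto
    qed
    show ?thesis
    proof (cases "p' \<le> p")
      case True
      hence pp: "real_of_int p' \<le> of_int p" by simp
      define c where "c = x 0 + of_int p'"
      show ?thesis
      proof (rule finish[of "\<lambda>i. min (x i) c" "\<lambda>i. x i - min (x i) c"])
        show "(\<lambda>i. min (x i) c) \<in> all_configurations p' q"
          using xD assms pp by (auto simp: all_configurations_def c_def min_def) (smt (verit))+
        fix i assume i: "i < q"
        note xi = xD(2,3)[OF i]
        consider "x (Suc i) \<le> c" | "x i \<le> c" "c < x (Suc i)" | "c < x i" using xi by linarith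
        thus "h (min (x i) c) (min (x (Suc i)) c) \<le> h (x i) (x (Suc i)) +
            (x (Suc i) - min (x (Suc i)) c - (x i - min (x i) c))"
        proof cases
          case 1
          thus ?thesis using xi by (simp add: min_def)
        next
          case 2
          thus ?thesis using xi gen_fun_lipschitz[of "x i" c "x i" "x (Suc i)"] by (simp add: min_def)
        next
          case 3
          thus ?thesis using xi gen_fun_ge[of "x (Suc i)" "x i"] by (simp add: min_def)
        qed
      next
        show "x q - min (x q) c - (x 0 - min (x 0) c) \<le> \<bar>of_int p' - of_int p\<bar>"
          using xD(1) pp assms by (auto simp: c_def min_def)
      qed
    next
      case False
      hence pp: "real_of_int p \<le> of_int p'" by simp
      have pq: "real_of_int p' \<le> real q" using assms by linarith
      define c where "c i = x 0 + of_int p' - real q + real i" for i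
      show ?thesis
      proof (rule finish[of "\<lambda>i. max (x i) (c i)" "\<lambda>i. max (x i) (c i) - x i"])
        have "max (x i) (c i) \<le> max (x (Suc i)) (c (Suc i)) \<and>
            max (x (Suc i)) (c (Suc i)) \<le> max (x i) (c i) + 1" if "i < q" for i
          using xD(2,3)[OF that] by (auto simp: c_def max_def)
        moreover have "max (x q) (c q) = max (x 0) (c 0) + of_int p'"
          using xD(1) pp pq by (auto simp: c_def max_def)
        ultimately show "(\<lambda>i. max (x i) (c i)) \<in> all_configurations p' q"
          by (simp add: all_configurations_def)
        fix i assume i: "i < q"
        note xi = xD(2,3)[OF i]
        have cS: "c (Suc i) = c i + 1" by (simp add: c_def)
        consider "c (Suc i) \<le> x (Suc i)" | "c i \<le> x i" "x (Suc i) < c (Suc i)" | "x i < c i"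
          by linarith
        thus "h (max (x i) (c i)) (max (x (Suc i)) (c (Suc i))) \<le> h (x i) (x (Suc i)) +
            (max (x (Suc i)) (c (Suc i)) - x (Suc i) - (max (x i) (c i) - x i))"
        proof cases
          case 1
          hence "c i \<le> x i" using xi cS by linarith
          thus ?thesis using 1 by (simp add: max_absorb1)
        next
          case 2
          thus ?thesis using xi cS gen_fun_lipschitz[of "x i" "c (Suc i)" "x i" "x (Suc i)"]
            by (simp add: max_def)
        next
          case 3
          note gen_fun_le_0[of "c i" "c i + 1"]
          thus ?thesis using 3 xi cS gen_fun_ge_turn[of "x (Suc i)" "x i"]
            by (simp add: max_def del: gen_fun_le_0)
        qed
      next
        show "max (x q) (c q) - x q - (max (x 0) (c 0) - x 0) \<le> \<bar>of_int p' - of_int p\<bar>"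
          using xD(1) pp pq by (auto simp: c_def max_def)
      qed
    qed
  qed
  hence "least_action \<xi> p' q - \<bar>of_int p' - of_int p\<bar> \<le> action \<xi> q x"
    if "x \<in> all_configurations p q" for x
    using that least_action_le by fastforce
  hence "least_action \<xi> p' q - \<bar>of_int p' - of_int p\<bar> \<le> least_action \<xi> p q"
    by (rule least_action_greatest[OF assms(1,2)])
  thus ?thesis by simp
qed

end

section \<open>The beta function on the rationals\<close>

context billiard
begin

lemma beta_of_rat: "beta \<xi> (of_rat r) = beta_rat \<xi> r"
  by (simp add: beta_def inv_f_f inj_def)

text \<open>By homogeneity of the least action the fraction need not be in lowest terms, so two
  rationals can be compared over a common denominator.\<close>

lemma beta_quotient:
  assumes "0 \<le> p" "p \<le> int q" "0 < q"
  shows "beta \<xi> (of_int p / real q) = least_action \<xi> p q / real q"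
proof -
  define g where "g = gcd p (int q)"
  have g: "g > 0" using assms by (simp add: g_def)
  define a b where "a = p div g" and "b = int q div g"
  have ab: "p = g * a" "int q = g * b" by (simp_all add: a_def b_def g_def)
  hence b: "b > 0" using assms g by (metis of_nat_0_less_iff zero_less_mult_pos)
  have a: "0 \<le> a" "a \<le> b"
    using assms g ab by (simp_all add: zero_le_mult_iff)
  have q: "q = nat g * nat b" using ab(2) g b
    by (metis less_imp_le nat_int nat_mult_distrib)
  define r :: rat where "r = Fract p (int q)"
  have "quotient_of r = (a, b)"
    using assms(3) by (simp add: r_def quotient_of_Fract Rat.normalize_def Let_def a_def b_def g_def)
  hence "beta \<xi> (of_rat r) = least_action \<xi> a (nat b) / of_int b"
    using beta_rat_least_action a by (simp add: beta_of_rat)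
  moreover have "least_action \<xi> p q = real (nat g) * least_action \<xi> a (nat b)"
    using least_action_multiple[of a "nat b" "nat g"] a b g ab q by simp
  moreover have "(of_rat r :: real) = of_int p / real q"
    using assms(3) by (simp add: r_def of_rat_rat)
  moreover have "real q = real (nat g) * of_int b" using ab(2) g
    by (metis of_int_mult of_int_of_nat_eq of_nat_nat less_imp_le)
  ultimately show ?thesis using g by simp
qed

lemma rational_quotient:
  assumes "t \<in> \<rat>" "0 < t" "t \<le> 1"
  obtains p q where "0 < p" "p \<le> int q" "0 < q" "t = of_int p / real q"
proof -
  obtain p q where pq: "q > 0" "t = of_int p / of_int q"
    using assms(1) by (elim Rats_cases') auto
  show thesis
    by (rule that[of p "nat q"]) (use assms pq in \<open>auto simp: field_simps\<close>)
qed

lemma beta_lipschitz: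
  assumes "x \<in> \<rat>" "y \<in> \<rat>" "0 < x" "x \<le> 1" "0 < y" "y \<le> 1"
  shows "\<bar>beta \<xi> x - beta \<xi> y\<bar> \<le> \<bar>x - y\<bar>"
proof -
  have *: "beta \<xi> x \<le> beta \<xi> y + \<bar>x - y\<bar>"
    if xy: "x \<in> \<rat>" "y \<in> \<rat>" "0 < x" "x \<le> 1" "0 < y" "y \<le> 1" for x y
  proof -
    obtain p q where p: "0 < p" "p \<le> int q" "0 < q" "x = of_int p / real q"
      using rational_quotient xy by metis
    obtain p' q' where p': "0 < p'" "p' \<le> int q'" "0 < q'" "y = of_int p' / real q'"
      using rational_quotient xy by metis
    have x: "x = of_int (int q' * p) / real (q' * q)" and y: "y = of_int (int q * p') / real (q' * q)"
      using p p' by (simp_all add: field_simps)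
    have b: "0 \<le> int q' * p" "int q' * p \<le> int (q' * q)"
      "0 \<le> int q * p'" "int q * p' \<le> int (q' * q)" "0 < q' * q"
      using p p' by (simp_all add: mult_left_mono mult.commute mult_mono)
    have "beta \<xi> x \<le> (least_action \<xi> (int q * p') (q' * q) +
        \<bar>of_int (int q' * p) - of_int (int q * p')\<bar>) / real (q' * q)"
      unfolding x beta_quotient[OF b(1,2,5)]
      by (intro divide_right_mono least_action_lipschitz b) simp
    also have "\<dots> = beta \<xi> y + \<bar>x - y\<bar>"
      unfolding add_divide_distrib x y beta_quotient[OF b(3,4,5)] diff_divide_distrib[symmetric]
      by (simp only: abs_divide abs_of_nat)
    finally show ?thesis .
  qed
  show ?thesis using *[of x y] *[of y x] assms by (simp add: abs_le_iff abs_minus_commute)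
qed

lemma beta_bounds:
  assumes "t \<in> \<rat>" "0 < t" "t \<le> 1"
  shows "- t \<le> beta \<xi> t" "beta \<xi> t \<le> 0"
proof -
  obtain p q where p: "0 < p" "p \<le> int q" "0 < q" "t = of_int p / real q"
    using rational_quotient assms by metis
  have pq: "0 \<le> p" using p by simp
  have b: "beta \<xi> t = least_action \<xi> p q / real q"
    unfolding p(4) using beta_quotient[OF pq p(2,3)] .
  have "- of_int p \<le> least_action \<xi> p q"
    by (rule least_action_greatest[OF pq p(2) action_ge])
  hence "- of_int p / real q \<le> least_action \<xi> p q / real q" by (intro divide_right_mono) auto
  thus "- t \<le> beta \<xi> t" unfolding b by (simp add: p(4))
  obtain x where "x \<in> all_configurations p q" using all_configurations_nonempty[OF pq p(2)] by blast
  hence "least_action \<xi> p q \<le> 0" using least_action_le action_nonpos order_trans by blast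
  thus "beta \<xi> t \<le> 0" unfolding b by (simp add: divide_nonpos_nonneg)
qed

lemma irrational_trivial_limit:
  assumes "0 < (t::real)" "t \<le> 1 / 2"
  shows "at t within \<rat> \<inter> {0<..1/2} \<noteq> bot"
proof -
  have "t islimpt \<rat> \<inter> {0<..1/2}"
    unfolding islimpt_approachable
  proof (intro allI impI)
    fix e :: real assume e: "0 < e"
    have "max 0 (t - e) < t" using assms e by simp
    then obtain r where r: "r \<in> \<rat>" "max 0 (t - e) < r" "r < t"
      using Rats_dense_in_real by blast
    thus "\<exists>x'\<in>\<rat> \<inter> {0<..1/2}. x' \<noteq> t \<and> dist x' t < e"
      by (intro bexI[of _ r]) (use assms in \<open>auto simp: dist_real_def\<close>)
  qed
  thus ?thesis by (simp add: trivial_limit_within)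
qed

text \<open>The Lipschitz bound makes the limit over the rationals exist.\<close>

lemma beta_irrational_limit:
  assumes "t \<notin> \<rat>" "0 < t" "t \<le> 1 / 2"
  shows "(beta \<xi> \<longlongrightarrow> beta \<xi> t) (at t within \<rat> \<inter> {0<..1/2})"
proof -
  let ?X = "\<rat> \<inter> {0<..1/2::real}"
  have nb: "at t within ?X \<noteq> bot" using irrational_trivial_limit assms by blast
  hence "t \<in> closure ?X"
    by (metis closure_def trivial_limit_within Un_iff mem_Collect_eq)
  moreover have "uniformly_continuous_on ?X (beta \<xi>)"
    unfolding uniformly_continuous_on_def
  proof (intro allI impI)
    fix e :: real assume e: "e > 0"
    have "dist (beta \<xi> x') (beta \<xi> x) < e" if "x \<in> ?X" "x' \<in> ?X" "dist x' x < e" for x x'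
      using beta_lipschitz[of x' x] that by (auto simp: dist_real_def)
    thus "\<exists>d>0. \<forall>x\<in>?X. \<forall>x'\<in>?X. dist x' x < d \<longrightarrow> dist (beta \<xi> x') (beta \<xi> x) < e"
      using e by blast
  qed
  ultimately obtain l where l: "(beta \<xi> \<longlongrightarrow> l) (at t within ?X)"
    using uniformly_continuous_on_extension_at_closure by blast
  have eq: "beta \<xi> x = beta_rat \<xi> (inv of_rat x)" if "x \<in> ?X" for x
    using that by (simp add: beta_def)
  have "((\<lambda>x. beta_rat \<xi> (inv of_rat x)) \<longlongrightarrow> l) (at t within ?X)"
    using l by (rule Lim_transform_eventually) (auto simp: eventually_at_filter eq)
  hence "Lim (at t within ?X) (\<lambda>x. beta_rat \<xi> (inv of_rat x)) = l"
    using nb by (intro tendsto_Lim) auto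
  thus ?thesis using l assms by (simp add: beta_def)
qed

end

section \<open>Approximately invariant curves\<close>

lemma shift_int:
  fixes f :: "real \<Rightarrow> real"
  assumes "\<And>x. f (x + 1) = f x + d"
  shows "f (x + of_int k) = f x + of_int k * d"
proof -
  have nat: "f (x + of_nat n) = f x + of_nat n * d" for x n
  proof (induction n)
    case (Suc n)
    thus ?case using assms[of "x + of_nat n"] by (simp add: algebra_simps)
  qed simp
  show ?thesis
  proof (cases "k \<ge> 0")
    case True
    thus ?thesis using nat[of x "nat k"] by simp
  next
    case False
    thus ?thesis using nat[of "x + of_int k" "nat (- k)"] by (simp add: algebra_simps)
  qed
qed

lemma norm_normalized_diff_le:
  fixes u w :: "'a::real_normed_vector"
  assumes "u \<noteq> 0" "w \<noteq> 0"
  shows "norm (u /\<^sub>R norm u - w /\<^sub>R norm w) \<le> 2 * norm (u - w) / norm u"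
proof -
  have "u /\<^sub>R norm u - w /\<^sub>R norm w = (u - w) /\<^sub>R norm u + (inverse (norm u) - inverse (norm w)) *\<^sub>R w"
    by (simp add: algebra_simps)
  also have "norm \<dots> \<le> norm (u - w) / norm u + \<bar>inverse (norm u) - inverse (norm w)\<bar> * norm w"
    by (rule norm_triangle_le) (simp add: divide_inverse)
  also have "\<bar>inverse (norm u) - inverse (norm w)\<bar> * norm w = \<bar>norm w - norm u\<bar> / norm u"
  proof -
    have "inverse (norm u) - inverse (norm w) = (norm w - norm u) / (norm u * norm w)"
      using assms by (simp add: field_simps)
    thus ?thesis using assms by (simp add: abs_mult abs_divide)
  qed
  also have "\<bar>norm w - norm u\<bar> \<le> norm (u - w)"
    using norm_triangle_ineq3[of u w] by (simp add: abs_minus_commute)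
  finally show ?thesis using assms by (simp add: divide_right_mono field_simps)
qed

context billiard
begin

lemma tangent_differentiable: "\<tau> differentiable (at s)"
  and continuous_tangent_derivative: "continuous_on UNIV (\<lambda>s. frechet_derivative \<tau> (at s) 1)"
proof -
  have "smooth_on \<xi> UNIV"
    using domain unfolding billiard_domain_def by blast
  then obtain U where "UNIV \<subseteq> U" "\<forall>k. Ck_on k \<xi> U"
    unfolding smooth_on_def by blast
  hence "Ck_on (Suc (Suc 0)) \<xi> UNIV"
    by (simp add: top.extremum_unique)
  moreover have tau: "(\<lambda>s. frechet_derivative \<xi> (at s) 1) = \<tau>"
    by (rule ext) (simp only: tangent_eq_frechet)
  ultimately show "\<tau> differentiable (at s)"
    "continuous_on UNIV (\<lambda>s. frechet_derivative \<tau> (at s) 1)"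
    by (auto simp flip: tau)
qed

lemma tangent_periodic_int [simp]: "\<tau> (s + of_int k) = \<tau> s"
proof -
  have "Re (\<tau> (s + of_int k)) = Re (\<tau> s)" "Im (\<tau> (s + of_int k)) = Im (\<tau> s)"
    using shift_int[of "\<lambda>s. Re (\<tau> s)" 0] shift_int[of "\<lambda>s. Im (\<tau> s)" 0] by simp_all
  thus ?thesis by (rule complex_eqI)
qed

lemma tangent_lipschitz:
  obtains M where "M > 0" "\<And>s t. norm (\<tau> s - \<tau> t) \<le> M * \<bar>s - t\<bar>"
proof -
  note diff = tangent_differentiable and cont = continuous_tangent_derivative
  have der: "(\<tau> has_derivative frechet_derivative \<tau> (at s)) (at s)" for s
    using diff frechet_derivative_works by blast
  have "compact ((\<lambda>s. frechet_derivative \<tau> (at s) 1) ` {-1..2})"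
    by (intro compact_continuous_image continuous_on_subset[OF cont]) auto
  hence "bounded ((\<lambda>s. frechet_derivative \<tau> (at s) 1) ` {-1..2})" by (rule compact_imp_bounded)
  then obtain B where B: "\<And>s. s \<in> {-1..2} \<Longrightarrow> norm (frechet_derivative \<tau> (at s) 1) \<le> B"
    unfolding bounded_iff by blast
  have onorm: "onorm (frechet_derivative \<tau> (at s)) \<le> max B 2" if "s \<in> {-1..2}" for s
  proof (rule onorm_le)
    fix t
    have "linear (frechet_derivative \<tau> (at s))" using linear_frechet_derivative diff by blast
    hence "frechet_derivative \<tau> (at s) t = t *\<^sub>R frechet_derivative \<tau> (at s) 1"
      using linear_scale[of "frechet_derivative \<tau> (at s)" t 1] by simp
    thus "norm (frechet_derivative \<tau> (at s) t) \<le> max B 2 * norm t"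
      using B[OF that] by (simp add: mult_left_mono mult.commute le_max_iff_disj)
  qed
  have near: "norm (\<tau> s - \<tau> t) \<le> max B 2 * \<bar>s - t\<bar>" if "s \<in> {-1..2}" "t \<in> {-1..2}" for s t
    using differentiable_bound[of "{-1..2}" \<tau> "\<lambda>s. frechet_derivative \<tau> (at s)" "max B 2" s t]
      der onorm that has_derivative_at_withinI by (force simp: real_norm_def)
  show thesis
  proof (rule that[of "max B 2"])
    fix s t
    show "norm (\<tau> s - \<tau> t) \<le> max B 2 * \<bar>s - t\<bar>"
    proof (cases "\<bar>s - t\<bar> \<le> 1")
      case True
      have "frac s \<in> {-1..2}" "t + of_int (- \<lfloor>s\<rfloor>) \<in> {-1..2}"
        using True frac_lt_1[of s] frac_ge_0[of s] by (auto simp: frac_def) linarith+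
      hence "norm (\<tau> (s + of_int (- \<lfloor>s\<rfloor>)) - \<tau> (t + of_int (- \<lfloor>s\<rfloor>))) \<le> max B 2 * \<bar>s - t\<bar>"
        using near[of "frac s" "t + of_int (- \<lfloor>s\<rfloor>)"] by (simp add: frac_def)
      thus ?thesis unfolding tangent_periodic_int .
    next
      case False
      have "norm (\<tau> s - \<tau> t) \<le> 2" using norm_triangle_ineq4[of "\<tau> s" "\<tau> t"] by simp
      also have "2 \<le> max B 2 * \<bar>s - t\<bar>"
        using mult_mono[of 2 "max B 2" 1 "\<bar>s - t\<bar>"] False by simp
      finally show ?thesis .
    qed
  qed simp
qed

lemma chord_ge:
  assumes M: "\<And>s t. norm (\<tau> s - \<tau> t) \<le> M * \<bar>s - t\<bar>" "M > 0"
    and "s \<le> a" "M * (a - s) \<le> 1 / 2"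
  shows "(a - s) / 2 \<le> norm (\<xi> a - \<xi> s)"
proof -
  have "norm ((\<xi> a - a *\<^sub>R \<tau> s) - (\<xi> s - s *\<^sub>R \<tau> s)) \<le> (1 / 2) * norm (a - s)"
  proof (rule differentiable_bound[where S = "{s..a}" and f' = "\<lambda>t w. w *\<^sub>R (\<tau> t - \<tau> s)"])
    fix t assume t: "t \<in> {s..a}"
    have "((\<lambda>t. \<xi> t - t *\<^sub>R \<tau> s) has_vector_derivative \<tau> t - \<tau> s) (at t within {s..a})"
      by (auto intro!: derivative_eq_intros curve_derivative)
    thus "((\<lambda>t. \<xi> t - t *\<^sub>R \<tau> s) has_derivative (\<lambda>w. w *\<^sub>R (\<tau> t - \<tau> s))) (at t within {s..a})"
      by (simp add: has_vector_derivative_def)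
    have "norm (\<tau> t - \<tau> s) \<le> M * (a - s)"
      using M(1)[of t s] t M(2) by (smt (verit) atLeastAtMost_iff mult_left_mono)
    hence n: "norm (\<tau> t - \<tau> s) \<le> 1 / 2" using assms(4) by linarith
    show "onorm (\<lambda>w. w *\<^sub>R (\<tau> t - \<tau> s)) \<le> 1 / 2"
    proof (rule onorm_le)
      show "norm (w *\<^sub>R (\<tau> t - \<tau> s)) \<le> 1 / 2 * norm w" for w :: real
        using mult_left_mono[OF n, of "\<bar>w\<bar>"] by simp
    qed
  qed (use assms in auto)
  moreover have "(\<xi> a - a *\<^sub>R \<tau> s) - (\<xi> s - s *\<^sub>R \<tau> s) = (\<xi> a - \<xi> s) - (a - s) *\<^sub>R \<tau> s"
    by (simp add: algebra_simps)
  moreover have "norm ((a - s) *\<^sub>R \<tau> s) = a - s" using assms by simp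
  moreover have "norm ((a - s) *\<^sub>R \<tau> s) \<le>
      norm (\<xi> a - \<xi> s) + norm ((\<xi> a - \<xi> s) - (a - s) *\<^sub>R \<tau> s)"
    by (metis norm_minus_commute norm_triangle_sub)
  ultimately show ?thesis using assms(3) by simp
qed

lemma departure_cos_alt: "dep s a = \<tau> s \<bullet> ((\<xi> a - \<xi> s) /\<^sub>R norm (\<xi> a - \<xi> s))"
  and arrival_cos_alt: "arr s a = \<tau> a \<bullet> ((\<xi> a - \<xi> s) /\<^sub>R norm (\<xi> a - \<xi> s))"
  by (simp_all add: departure_cos_def arrival_cos_def divide_inverse)

lemma abs_departure_cos_le_1: "\<bar>dep s a\<bar> \<le> 1"
  unfolding departure_cos_polar by (rule abs_Re_div_norm_le_1)

lemma departure_cos_diff_le: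
  assumes "\<xi> a \<noteq> \<xi> s" "\<xi> b \<noteq> \<xi> s"
  shows "\<bar>dep s a - dep s b\<bar> \<le> 2 * \<bar>a - b\<bar> / norm (\<xi> a - \<xi> s)"
proof -
  let ?u = "\<xi> a - \<xi> s" and ?w = "\<xi> b - \<xi> s"
  have "dep s a - dep s b = \<tau> s \<bullet> (?u /\<^sub>R norm ?u - ?w /\<^sub>R norm ?w)"
    by (simp only: departure_cos_alt inner_diff_right)
  hence "\<bar>dep s a - dep s b\<bar> \<le> norm (?u /\<^sub>R norm ?u - ?w /\<^sub>R norm ?w)"
    using Cauchy_Schwarz_ineq2[of "\<tau> s" "?u /\<^sub>R norm ?u - ?w /\<^sub>R norm ?w"] by simp
  also have "\<dots> \<le> 2 * norm (?u - ?w) / norm ?u"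
    by (rule norm_normalized_diff_le) (use assms in auto)
  also have "?u - ?w = \<xi> a - \<xi> b" by simp
  also have "2 * norm (\<xi> a - \<xi> b) / norm ?u \<le> 2 * \<bar>a - b\<bar> / norm ?u"
    using curve_lipschitz[of a b] by (intro divide_right_mono) auto
  finally show ?thesis .
qed

lemma arrival_cos_diff_le:
  assumes "\<xi> a \<noteq> \<xi> s" "\<xi> b \<noteq> \<xi> s" and M: "norm (\<tau> a - \<tau> b) \<le> M * \<bar>a - b\<bar>"
  shows "\<bar>arr s a - arr s b\<bar> \<le> 2 * \<bar>a - b\<bar> / norm (\<xi> a - \<xi> s) + M * \<bar>a - b\<bar>"
proof -
  let ?u = "\<xi> a - \<xi> s" and ?w = "\<xi> b - \<xi> s"
  have "arr s a - arr s b = \<tau> a \<bullet> (?u /\<^sub>R norm ?u - ?w /\<^sub>R norm ?w) + (\<tau> a - \<tau> b) \<bullet> (?w /\<^sub>R norm ?w)"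
    by (simp only: arrival_cos_alt inner_diff_right inner_diff_left)
  moreover have "\<bar>\<tau> a \<bullet> (?u /\<^sub>R norm ?u - ?w /\<^sub>R norm ?w)\<bar> \<le> norm (?u /\<^sub>R norm ?u - ?w /\<^sub>R norm ?w)"
    using Cauchy_Schwarz_ineq2[of "\<tau> a" "?u /\<^sub>R norm ?u - ?w /\<^sub>R norm ?w"] by simp
  moreover have "norm (?u /\<^sub>R norm ?u - ?w /\<^sub>R norm ?w) \<le> 2 * norm (?u - ?w) / norm ?u"
    by (rule norm_normalized_diff_le) (use assms in auto)
  moreover have "?u - ?w = \<xi> a - \<xi> b" by simp
  moreover have "2 * norm (\<xi> a - \<xi> b) / norm ?u \<le> 2 * \<bar>a - b\<bar> / norm ?u"
    using curve_lipschitz[of a b] by (intro divide_right_mono) auto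
  moreover have "\<bar>(\<tau> a - \<tau> b) \<bullet> (?w /\<^sub>R norm ?w)\<bar> \<le> M * \<bar>a - b\<bar>"
    using Cauchy_Schwarz_ineq2[of "\<tau> a - \<tau> b" "?w /\<^sub>R norm ?w"] M assms(2) by simp
  ultimately show ?thesis by simp
qed

end

text \<open>The curve \<open>x \<mapsto> (S x, V x)\<close> winds once around the annulus, the billiard map moves each
  point of parameter \<open>x\<close> to within \<open>e\<close> of the point of parameter \<open>x + w\<close>, and \<open>c\<close> is the
  integral of \<open>- cos v ds\<close> over the curve. The chords from a point to the point \<open>w\<close> further have
  length at least \<open>l\<close>, so that moving their end by \<open>e\<close> turns them by at most about \<open>e / l\<close>.\<close>

locale approx_invariant_curve = billiard +
  fixes S V S' :: "real \<Rightarrow> real" and m L M c w e l :: real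
  assumes S_deriv: "\<And>x. (S has_real_derivative S' x) (at x)"
    and m_pos: "0 < m" and S'_ge: "\<And>x. m \<le> S' x" and S'_le: "\<And>x. S' x \<le> L"
    and S'_cont: "continuous_on UNIV S'" and V_cont: "continuous_on UNIV V"
    and S_shift: "\<And>x. S (x + 1) = S x + 1" and V_shift: "\<And>x. V (x + 1) = V x"
    and V_pos: "\<And>x. 0 < V x" and V_lt_pi: "\<And>x. V x < pi"
    and loop: "((\<lambda>x. - cos (V x) * S' x) has_integral c) {0..1}"
    and image_fst: "\<And>x. \<bar>fst (billiard_map \<xi> (S x, V x)) - S (x + w)\<bar> \<le> e"
    and image_snd: "\<And>x. \<bar>snd (billiard_map \<xi> (S x, V x)) - V (x + w)\<bar> \<le> e"
    and w_pos: "0 < w" and w_lt_1: "w < 1"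
    and chord_lower: "\<And>x. l \<le> norm (\<xi> (S (x + w)) - \<xi> (S x))" and l_pos: "0 < l"
    and M_lipschitz: "\<And>s t. norm (\<tau> s - \<tau> t) \<le> M * \<bar>s - t\<bar>" and M_pos: "M > 0"
begin

lemma e_nonneg: "0 \<le> e" using image_fst[of 0] by linarith
lemma L_pos: "0 < L" using m_pos S'_ge[of 0] S'_le[of 0] by linarith

lemma S_increase: "x \<le> x' \<Longrightarrow> m * (x' - x) \<le> S x' - S x"
proof -
  assume "x \<le> x'"
  hence "S x - m * x \<le> S x' - m * x'"
  proof (rule DERIV_nonneg_imp_nondecreasing)
    fix t
    have "((\<lambda>x. S x - m * x) has_real_derivative S' t - m) (at t)"
      by (auto intro!: derivative_eq_intros S_deriv)
    thus "\<exists>y. ((\<lambda>x. S x - m * x) has_real_derivative y) (at t) \<and> 0 \<le> y"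
      using S'_ge[of t] by (intro exI[of _ "S' t - m"]) auto
  qed
  thus ?thesis by (simp add: algebra_simps)
qed

lemma S_strict_mono: "strict_mono S"
proof (rule strict_monoI)
  fix x x' :: real assume "x < x'"
  thus "S x < S x'" using S_increase[of x x'] m_pos by (smt (verit) mult_pos_pos)
qed

lemma S_less_iff: "S x < S x' \<longleftrightarrow> x < x'" and S_le_iff: "S x \<le> S x' \<longleftrightarrow> x \<le> x'"
  and S_eq_iff: "S x = S x' \<longleftrightarrow> x = x'"
  using S_strict_mono strict_mono_less strict_mono_less_eq strict_mono_eq by blast+

lemma S_shift_int: "S (x + of_int k) = S x + of_int k"
  using shift_int[of S 1 x k] S_shift by simp

lemma S_cont: "continuous_on A S"
  by (intro continuous_at_imp_continuous_on ballI DERIV_isCont[OF S_deriv])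

lemma S_surj: "\<exists>x. S x = s"
proof -
  define k where "k = \<lfloor>s - S 0\<rfloor>"
  have a: "S (of_int k) \<le> s" "s \<le> S (of_int k + 1)"
    using S_shift_int[of 0 k] S_shift[of "of_int k"] by (simp_all add: k_def) linarith+
  thus ?thesis using IVT'[of S "of_int k" s "of_int k + 1"] S_cont by auto
qed

lemma S'_shift: "S' (x + 1) = S' x"
proof -
  have "((\<lambda>x. S (x + 1)) has_real_derivative S' (x + 1)) (at x)"
    using S_deriv[of "x + 1"] by (simp add: DERIV_shift)
  hence "((\<lambda>x. S x + 1) has_real_derivative S' (x + 1)) (at x)" by (simp add: S_shift)
  moreover have "((\<lambda>x. S x + 1) has_real_derivative S' x) (at x)"
    by (auto intro!: derivative_eq_intros S_deriv)
  ultimately show ?thesis by (rule DERIV_unique)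
qed

text \<open>A primitive of \<open>cos v ds\<close> along the curve.\<close>

lemma primitive_exists:
  "\<exists>K. (\<forall>x. (K has_real_derivative cos (V x) * S' x) (at x)) \<and>
    (\<forall>x k. K (x + of_int k) = K x - of_int k * c)"
proof -
  have cont: "continuous_on UNIV (\<lambda>x. cos (V x) * S' x)"
    by (intro continuous_intros S'_cont V_cont)
  hence "\<exists>K. \<forall>x. - \<infinity> < ereal x \<longrightarrow> ereal x < \<infinity> \<longrightarrow>
      (K has_vector_derivative cos (V x) * S' x) (at x)"
    by (intro einterval_antiderivative) (auto simp: continuous_on_eq_continuous_at)
  then obtain K where K: "\<And>x. (K has_real_derivative cos (V x) * S' x) (at x)"
    by (auto simp: has_real_derivative_iff_has_vector_derivative)
  have "K (x + 1) - K x = K 1 - K 0" for x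
  proof -
    have "((\<lambda>x. K (x + 1) - K x) has_real_derivative 0) (at x)" for x
    proof -
      have "((\<lambda>x. K (x + 1)) has_real_derivative cos (V (x + 1)) * S' (x + 1)) (at x)"
        using K[of "x + 1"] by (simp add: DERIV_shift)
      from DERIV_diff[OF this K[of x]] show ?thesis by (simp add: V_shift S'_shift)
    qed
    hence "K (x + 1) - K x = K (0 + 1) - K 0" by (intro DERIV_isconst_all allI)
    thus ?thesis by simp
  qed
  moreover have "K 1 - K 0 = - c"
  proof -
    have "((\<lambda>x. cos (V x) * S' x) has_integral (K 1 - K 0)) {0..1}"
    proof (rule fundamental_theorem_of_calculus)
      fix x
      show "(K has_vector_derivative cos (V x) * S' x) (at x within {0..1})"
        by (rule has_vector_derivative_at_within)
           (rule K[unfolded has_real_derivative_iff_has_vector_derivative])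
    qed simp
    moreover have "((\<lambda>x. cos (V x) * S' x) has_integral (- c)) {0..1}"
      using has_integral_neg[OF loop] by simp
    ultimately show ?thesis by (rule has_integral_unique)
  qed
  ultimately have d: "K (x + 1) - K x = - c" for x by simp
  have shift: "K (x + 1) = K x + (- c)" for x using d[of x] by linarith
  have "K (x + of_int k) = K x - of_int k * c" for x k
    using shift_int[of K "- c" x k, OF shift] by simp
  thus ?thesis using K by (intro exI[of _ K]) simp
qed


lemma image_step:
  obtains a v where "S x < a" "a < S x + 1" "dep (S x) a = cos (V x)" "arr (S x) a = cos v"
    "\<bar>a - S (x + w)\<bar> \<le> e" "\<bar>v - V (x + w)\<bar> \<le> e"
proof -
  obtain a v where "billiard_map \<xi> (S x, V x) = (a, v)" "S x < a" "a < S x + 1"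
    "dep (S x) a = cos (V x)" "arr (S x) a = cos v"
    using billiard_map_interior[OF V_pos V_lt_pi] by metis
  thus thesis using image_fst[of x] image_snd[of x] that by simp
qed

text \<open>The chord from \<open>S x\<close> to its image leaves at the angle \<open>V x\<close> and the image is within \<open>e\<close> of
  \<open>S (x + w)\<close>. A shorter chord leaves at a smaller angle and a longer one at a larger angle, which
  decides the sign of the derivative of the modified generating function \<open>F\<close> introduced below,
  outside a window of width \<open>2 * e / m\<close>; the chord to \<open>S (x + w)\<close> has almost the angles of the
  curve.\<close>

lemma slopes_compare:
  assumes "x < x'" "x' < x + 1"
  shows "x' \<le> x + w - e / m \<Longrightarrow> cos (V x) \<le> dep (S x) (S x')"
    "x + w + e / m \<le> x' \<Longrightarrow> dep (S x) (S x') \<le> cos (V x)"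
    "\<bar>dep (S x) (S (x + w)) - cos (V x)\<bar> \<le> 2 * e / l"
    "\<bar>arr (S x) (S (x + w)) - cos (V (x + w))\<bar> \<le> 2 * e / l + M * e + e"
proof -
  obtain a v where a: "S x < a" "a < S x + 1" "dep (S x) a = cos (V x)" "arr (S x) a = cos v"
    "\<bar>a - S (x + w)\<bar> \<le> e" "\<bar>v - V (x + w)\<bar> \<le> e" by (rule image_step)
  have S: "S x < S x'" "S x' < S x + 1"
    using S_less_iff[of x x'] S_less_iff[of x' "x + 1"] S_shift[of x] assms by auto
  show "cos (V x) \<le> dep (S x) (S x')" if "x' \<le> x + w - e / m"
  proof -
    have "0 \<le> e / m" using e_nonneg m_pos by simp
    hence "m * (e / m) \<le> m * (x + w - x')" using that m_pos by (intro mult_left_mono) auto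
    also have "\<dots> \<le> S (x + w) - S x'" using \<open>0 \<le> e / m\<close> that by (intro S_increase) auto
    finally have "S x' \<le> a" using a(5) m_pos by simp
    thus ?thesis using departure_cos_antimono[of "S x" "S x'" a] S a by simp
  qed
  show "dep (S x) (S x') \<le> cos (V x)" if "x + w + e / m \<le> x'"
  proof -
    have "0 \<le> e / m" using e_nonneg m_pos by simp
    hence "m * (e / m) \<le> m * (x' - (x + w))" using that m_pos by (intro mult_left_mono) auto
    also have "\<dots> \<le> S x' - S (x + w)" using \<open>0 \<le> e / m\<close> that by (intro S_increase) auto
    finally have "a \<le> S x'" using a(5) m_pos by simp
    thus ?thesis using departure_cos_antimono[of "S x" a "S x'"] S a by simp
  qed
  let ?b = "S (x + w)"
  have ne: "\<xi> ?b \<noteq> \<xi> (S x)" "\<xi> a \<noteq> \<xi> (S x)"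
    using chord_lower[of x] l_pos curve_distinct[of "S x" a] a by auto
  have chord: "2 * \<bar>?b - a\<bar> / norm (\<xi> ?b - \<xi> (S x)) \<le> 2 * e / l"
    using a(5) chord_lower[of x] l_pos e_nonneg by (intro frac_le) auto
  show "\<bar>dep (S x) ?b - cos (V x)\<bar> \<le> 2 * e / l"
    using departure_cos_diff_le[OF ne] chord a(3) by simp
  have "M * \<bar>?b - a\<bar> \<le> M * e" using a(5) M_pos by (intro mult_left_mono) auto
  moreover have "\<bar>cos v - cos (V (x + w))\<bar> \<le> \<bar>v - V (x + w)\<bar>"
    using field_differentiable_bound[of UNIV cos "\<lambda>x. - sin x" 1 v "V (x + w)"]
    by (auto intro!: derivative_eq_intros simp: real_norm_def)
  ultimately show "\<bar>arr (S x) ?b - cos (V (x + w))\<bar> \<le> 2 * e / l + M * e + e"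
    using arrival_cos_diff_le[OF ne M_lipschitz] chord a(4,6) by linarith
qed

text \<open>The first summand bounds how far \<open>F\<close> can drop inside that window, the second one how much
  \<open>F\<close> varies along the curve.\<close>

definition "defect = 2 * L * (e / m) + L * (4 * e / l + M * e + e)"

text \<open>In the parameter of the curve the action becomes
  \<open>F x x' = h (S x) (S x') + K x' - K x\<close>, up to \<open>c\<close> times the winding number. For given \<open>x'\<close> it
  is smallest, up to a small error, at \<open>x = x' - w\<close>, by the twist property, and there it hardly
  depends on \<open>x'\<close>. So no configuration has a much smaller mean action than the points of the
  curve, and for winding number \<open>w\<close> these points form a configuration.\<close>

lemma least_action_support:
  assumes pq: "w = of_int p / real q" "0 \<le> p" "p \<le> int q" "0 < q"
    and pq': "0 \<le> p'" "p' \<le> int q'" "0 < q'"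
  shows "least_action \<xi> p q / real q + c * (of_int p' / real q' - w) - 3 * defect
    \<le> least_action \<xi> p' q' / real q'"
proof -
  obtain K where K: "\<And>x. (K has_real_derivative cos (V x) * S' x) (at x)"
    and K_shift: "\<And>x k. K (x + of_int k) = K x - of_int k * c"
    using primitive_exists by (elim exE conjE) blast
  have K_cont: "continuous_on A K" for A
    by (intro continuous_at_imp_continuous_on ballI DERIV_isCont[OF K])
  define F where "F x x' = h (S x) (S x') + K x' - K x" for x x'
  define G where "G x' = F (x' - w) x'" for x'
  have lower: "G x' - 2 * L * (e / m) \<le> F x x'" if "x \<le> x'" "x' \<le> x + 1" for x x'
  proof -
    define a where "a = x' - w"
    define r where "r = e / m"
    have r: "0 \<le> r" using e_nonneg m_pos by (simp add: r_def)
    have der: "((\<lambda>t. F t x') has_real_derivative S' t * (dep (S t) (S x') - cos (V t))) (at t)"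
      if "x' - 1 < t" "t < x'" for t
    proof -
      have "S t < S x'" "S x' < S t + 1"
        using S_less_iff[of t x'] S_less_iff[of x' "t + 1"] S_shift[of t] that by auto
      hence "\<xi> (S t) \<noteq> \<xi> (S x')" using curve_distinct by metis
      moreover have "(S has_derivative (\<lambda>z. S' t * z)) (at t)"
        using S_deriv[of t] by (simp add: has_field_derivative_def)
      ultimately have "((\<lambda>t. h (S t) (S x')) has_derivative
          (\<lambda>z. dep (S t) (S x') * (S' t * z) - arr (S t) (S x') * 0)) (at t)"
        by (intro gen_fun_has_derivative) auto
      hence "((\<lambda>t. h (S t) (S x')) has_real_derivative dep (S t) (S x') * S' t) (at t)"
        unfolding has_field_derivative_def by (rule has_derivative_eq_rhs) (auto simp: mult.assoc)
      hence "((\<lambda>t. h (S t) (S x') + K x' - K t) has_real_derivative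
          dep (S t) (S x') * S' t + 0 - cos (V t) * S' t) (at t)"
        by (intro DERIV_diff DERIV_add DERIV_const K)
      thus ?thesis unfolding F_def by (simp add: algebra_simps)
    qed
    have cont: "continuous_on A (\<lambda>t. F t x')" for A
      unfolding F_def by (intro continuous_intros S_cont K_cont)
    have slope: "\<bar>S' t * (dep (S t) (S x') - cos (V t))\<bar> \<le> 2 * L" for t
    proof -
      have "\<bar>dep (S t) (S x') - cos (V t)\<bar> \<le> 2"
        using abs_departure_cos_le_1[of "S t" "S x'"] abs_cos_le_one[of "V t"] by linarith
      moreover have "\<bar>S' t\<bar> \<le> L" using S'_ge[of t] S'_le[of t] m_pos by simp
      ultimately have "\<bar>S' t\<bar> * \<bar>dep (S t) (S x') - cos (V t)\<bar> \<le> L * 2"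
        using L_pos by (intro mult_mono) auto
      thus ?thesis by (simp add: abs_mult)
    qed
    have G: "G x' = F a x'" by (simp add: G_def a_def)
    show ?thesis
    proof (cases "a \<le> x")
      case True
      define b where "b = min x (a + r)"
      have b: "a \<le> b" "b \<le> a + r" "b \<le> x" using True r by (auto simp: b_def)
      have "F a x' + 2 * L * a \<le> F b x' + 2 * L * b"
      proof (rule DERIV_nonneg_imp_increasing_open[OF b(1)])
        fix t assume t: "a < t" "t < b"
        hence t': "x' - 1 < t" "t < x'" using b that w_lt_1 by (auto simp: a_def)
        have "((\<lambda>t. F t x' + 2 * L * t) has_real_derivative
            S' t * (dep (S t) (S x') - cos (V t)) + 2 * L) (at t)"
          by (auto intro!: derivative_eq_intros der[OF t'])
        thus "\<exists>y. ((\<lambda>t. F t x' + 2 * L * t) has_real_derivative y) (at t) \<and> 0 \<le> y"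
          using slope[of t] by (intro exI conjI) auto
      qed (intro continuous_intros cont)
      moreover have "2 * L * (b - a) \<le> 2 * L * r"
        using b L_pos by (intro mult_left_mono) auto
      moreover have "F b x' \<le> F x x'"
      proof (rule DERIV_nonneg_imp_increasing_open[OF b(3)])
        fix t assume t: "b < t" "t < x"
        hence t': "x' - 1 < t" "t < x'" using b that w_lt_1 by (auto simp: a_def)
        have "x' \<le> t + w - e / m" using t by (auto simp: b_def a_def r_def min_def split: if_splits)
        hence "cos (V t) \<le> dep (S t) (S x')"
          using slopes_compare(1)[of t x'] t' by auto
        moreover have "0 \<le> S' t" using S'_ge[of t] m_pos by simp
        ultimately show "\<exists>y. ((\<lambda>t. F t x') has_real_derivative y) (at t) \<and> 0 \<le> y"
          by (intro exI[of _ "S' t * (dep (S t) (S x') - cos (V t))"] conjI der[OF t']) auto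
      qed (rule cont)
      ultimately show ?thesis unfolding G r_def by (simp add: algebra_simps)
    next
      case False
      define b where "b = max x (a - r)"
      have b: "b \<le> a" "a - r \<le> b" "x \<le> b" using False r by (auto simp: b_def)
      have "F b x' - 2 * L * b \<ge> F a x' - 2 * L * a"
      proof (rule DERIV_nonpos_imp_decreasing_open[OF b(1)])
        fix t assume t: "b < t" "t < a"
        hence t': "x' - 1 < t" "t < x'" using b that w_pos by (auto simp: a_def)
        have "((\<lambda>t. F t x' - 2 * L * t) has_real_derivative
            S' t * (dep (S t) (S x') - cos (V t)) - 2 * L) (at t)"
          by (auto intro!: derivative_eq_intros der[OF t'])
        thus "\<exists>y. ((\<lambda>t. F t x' - 2 * L * t) has_real_derivative y) (at t) \<and> y \<le> 0"
          using slope[of t] by (intro exI conjI) auto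
      qed (intro continuous_intros cont)
      moreover have "2 * L * (a - b) \<le> 2 * L * r"
        using b L_pos by (intro mult_left_mono) auto
      moreover have "F x x' \<ge> F b x'"
      proof (rule DERIV_nonpos_imp_decreasing_open[OF b(3)])
        fix t assume t: "x < t" "t < b"
        hence t': "x' - 1 < t" "t < x'" using b that w_pos by (auto simp: a_def)
        have "t + w + e / m \<le> x'" using t by (auto simp: b_def a_def r_def max_def split: if_splits)
        hence "dep (S t) (S x') \<le> cos (V t)"
          using slopes_compare(2)[of t x'] t' by auto
        moreover have "0 \<le> S' t" using S'_ge[of t] m_pos by simp
        ultimately show "\<exists>y. ((\<lambda>t. F t x') has_real_derivative y) (at t) \<and> y \<le> 0"
          by (intro exI[of _ "S' t * (dep (S t) (S x') - cos (V t))"] conjI der[OF t'])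
             (auto simp: mult_nonneg_nonpos)
      qed (rule cont)
      ultimately show ?thesis unfolding G r_def by (simp add: algebra_simps)
    qed
  qed
  have osc: "\<bar>G x - G 0\<bar> \<le> L * (4 * e / l + M * e + e)" for x
  proof -
    define B where "B = L * (4 * e / l + M * e + e)"
    have der: "(G has_real_derivative S' (t - w) * (dep (S (t - w)) (S t) - cos (V (t - w)))
        + S' t * (cos (V t) - arr (S (t - w)) (S t))) (at t)" for t
    proof -
      have ne: "\<xi> (S (t - w)) \<noteq> \<xi> (S t)" using chord_lower[of "t - w"] l_pos by auto
      have sub: "((\<lambda>t. t - w) has_real_derivative 1) (at t)"
        by (auto intro!: derivative_eq_intros)
      have "((\<lambda>t. S (t - w)) has_real_derivative S' (t - w)) (at t)"
        using DERIV_chain2[OF S_deriv sub] by simp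
      hence "((\<lambda>t. h (S (t - w)) (S t)) has_derivative
          (\<lambda>z. dep (S (t - w)) (S t) * (S' (t - w) * z) - arr (S (t - w)) (S t) * (S' t * z))) (at t)"
        using S_deriv[of t] ne unfolding has_field_derivative_def by (intro gen_fun_has_derivative)
      hence "((\<lambda>t. h (S (t - w)) (S t)) has_real_derivative
          dep (S (t - w)) (S t) * S' (t - w) - arr (S (t - w)) (S t) * S' t) (at t)"
        unfolding has_field_derivative_def by (rule has_derivative_eq_rhs) (auto simp: algebra_simps)
      moreover have "((\<lambda>t. K (t - w)) has_real_derivative cos (V (t - w)) * S' (t - w)) (at t)"
        using DERIV_chain2[OF K sub] by simp
      ultimately have "((\<lambda>t. h (S (t - w)) (S t) + K t - K (t - w)) has_real_derivative
          dep (S (t - w)) (S t) * S' (t - w) - arr (S (t - w)) (S t) * S' t + cos (V t) * S' t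
          - cos (V (t - w)) * S' (t - w)) (at t)"
        by (intro DERIV_diff DERIV_add K)
      thus ?thesis unfolding G_def F_def by (simp add: algebra_simps)
    qed
    have bound: "\<bar>S' (t - w) * (dep (S (t - w)) (S t) - cos (V (t - w)))
        + S' t * (cos (V t) - arr (S (t - w)) (S t))\<bar> \<le> B" for t
    proof -
      have 1: "\<bar>dep (S (t - w)) (S t) - cos (V (t - w))\<bar> \<le> 2 * e / l"
        and 2: "\<bar>cos (V t) - arr (S (t - w)) (S t)\<bar> \<le> 2 * e / l + M * e + e"
        using slopes_compare(3,4)[of "t - w" t] w_pos w_lt_1 by (auto simp: abs_minus_commute)
      have S': "\<bar>S' t\<bar> \<le> L" for t using S'_ge[of t] S'_le[of t] m_pos by simp
      have "\<bar>S' (t - w)\<bar> * \<bar>dep (S (t - w)) (S t) - cos (V (t - w))\<bar> \<le> L * (2 * e / l)"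
        by (rule mult_mono[OF S' 1]) (use L_pos in auto)
      moreover have
        "\<bar>S' t\<bar> * \<bar>cos (V t) - arr (S (t - w)) (S t)\<bar> \<le> L * (2 * e / l + M * e + e)"
        by (rule mult_mono[OF S' 2]) (use L_pos in auto)
      moreover have "L * (2 * e / l) + L * (2 * e / l + M * e + e) = B"
        by (simp add: B_def algebra_simps)
      ultimately show ?thesis unfolding abs_mult[symmetric] by linarith
    qed
    have "G (x + 1) = G x" for x
    proof -
      have "K (x + 1) = K x - c" "K (x - w + 1) = K (x - w) - c"
        using K_shift[of x 1] K_shift[of "x - w" 1] by simp_all
      moreover have "S (x - w + 1) = S (x - w) + 1" "S (x + 1) = S x + 1" by (rule S_shift)+
      moreover have "h (s + 1) (a + 1) = h s a" for s a using gen_fun_shift[of s 1 a] by simp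
      moreover have "x + 1 - w = x - w + 1" by simp
      ultimately show ?thesis unfolding G_def F_def by (simp only:)
    qed
    hence "G x = G (frac x)"
      using shift_int[of G 0 "frac x" "\<lfloor>x\<rfloor>"] by (simp add: frac_def)
    moreover have "\<bar>G (frac x) - G 0\<bar> \<le> B * \<bar>frac x - 0\<bar>"
      using field_differentiable_bound[of UNIV G
          "\<lambda>t. S' (t - w) * (dep (S (t - w)) (S t) - cos (V (t - w)))
            + S' t * (cos (V t) - arr (S (t - w)) (S t))" B "frac x" 0] der bound
      by (auto simp: real_norm_def)
    moreover have "0 \<le> B"
      unfolding B_def using L_pos e_nonneg l_pos M_pos by simp
    hence "B * \<bar>frac x - 0\<bar> \<le> B * 1"
      using frac_ge_0[of x] frac_lt_1[of x] by (intro mult_left_mono) auto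
    ultimately show ?thesis by (simp add: B_def)
  qed
  define E1 E2 where "E1 = 2 * L * (e / m)" and "E2 = L * (4 * e / l + M * e + e)"
  have defect: "defect = E1 + E2" "0 \<le> E1" "0 \<le> E2"
    unfolding defect_def E1_def E2_def using L_pos e_nonneg m_pos l_pos M_pos by simp_all
  note lower = lower[folded E1_def] and osc = osc[folded E2_def]
  have "q' * (G 0 - 2 * defect) + c * of_int p' \<le> least_action \<xi> p' q'"
  proof (rule least_action_greatest[OF pq'(1,2)])
    fix s assume s: "s \<in> all_configurations p' q'"
    define x where "x i = (SOME x. S x = s i)" for i
    have Sx: "S (x i) = s i" for i
      unfolding x_def using S_surj by (rule someI_ex)
    have step: "x i \<le> x (Suc i)" "x (Suc i) \<le> x i + 1" if "i < q'" for i
    proof -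
      have "S (x i) \<le> S (x (Suc i))" "S (x (Suc i)) \<le> S (x i + 1)"
        using all_configurations_D(2,3)[OF s that] by (simp_all add: Sx S_shift)
      thus "x i \<le> x (Suc i)" "x (Suc i) \<le> x i + 1" by (simp_all only: S_le_iff)
    qed
    have "S (x q') = S (x 0 + of_int p')"
      unfolding S_shift_int Sx by (rule all_configurations_D(1)[OF s])
    hence xq: "x q' = x 0 + of_int p'" by (simp only: S_eq_iff)
    have "q' * (G 0 - 2 * defect) = (\<Sum>i<q'. G 0 - 2 * defect)" by simp
    also have "\<dots> \<le> (\<Sum>i<q'. F (x i) (x (Suc i)))"
    proof (rule sum_mono)
      fix i assume "i \<in> {..<q'}"
      hence "G (x (Suc i)) - E1 \<le> F (x i) (x (Suc i))" using step lower by simp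
      thus "G 0 - 2 * defect \<le> F (x i) (x (Suc i))"
        using osc[of "x (Suc i)"] defect by linarith
    qed
    also have "\<dots> = action \<xi> q' s + (K (x q') - K (x 0))"
      unfolding F_def action_def Sx
      by (simp only: add_diff_eq[symmetric] sum.distrib sum_lessThan_telescope[of "\<lambda>i. K (x i)"])
    also have "\<dots> = action \<xi> q' s - c * of_int p'"
      unfolding xq K_shift by (simp add: mult.commute)
    finally show "q' * (G 0 - 2 * defect) + c * of_int p' \<le> action \<xi> q' s" by simp
  qed
  hence "(q' * (G 0 - 2 * defect) + c * of_int p') / real q' \<le> least_action \<xi> p' q' / real q'"
    by (intro divide_right_mono) auto
  hence A: "G 0 - 2 * defect + c * (of_int p' / real q') \<le> least_action \<xi> p' q' / real q'"
    using pq' by (simp add: add_divide_distrib)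
  have "least_action \<xi> p q \<le> q * (G 0 + defect) + c * of_int p"
  proof -
    define s where "s i = S (real i * w)" for i
    have s: "s \<in> all_configurations p q"
    proof -
      have "s q = s 0 + of_int p"
        using S_shift_int[of 0 p] pq by (simp add: s_def)
      moreover have "s i \<le> s (Suc i)" "s (Suc i) \<le> s i + 1" for i
        using S_le_iff[of "i * w" "Suc i * w"] S_le_iff[of "Suc i * w" "i * w + 1"] w_pos w_lt_1
        unfolding s_def S_shift by (simp_all add: algebra_simps)
      ultimately show ?thesis by (simp add: all_configurations_def)
    qed
    have "action \<xi> q s = (\<Sum>i<q. F (real i * w) (real (Suc i) * w)) - (K (real q * w) - K (real 0 * w))"
      unfolding F_def action_def s_def
      by (simp only: add_diff_eq[symmetric] sum.distrib sum_lessThan_telescope[of "\<lambda>i. K (real i * w)"]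
          add_diff_cancel_right')
    also have "K (real q * w) - K (real 0 * w) = - (c * of_int p)"
      using K_shift[of 0 p] pq by simp
    also have "(\<Sum>i<q. F (real i * w) (real (Suc i) * w)) \<le> (\<Sum>i<q. G 0 + defect)"
    proof (rule sum_mono)
      fix i
      have "F (real i * w) (real (Suc i) * w) = G (real (Suc i) * w)"
        by (simp add: G_def algebra_simps)
      thus "F (real i * w) (real (Suc i) * w) \<le> G 0 + defect"
        using osc[of "real (Suc i) * w"] defect by linarith
    qed
    finally have "action \<xi> q s \<le> q * (G 0 + defect) + c * of_int p" by simp
    thus ?thesis using least_action_le[OF s] by simp
  qed
  hence "least_action \<xi> p q / real q \<le> (q * (G 0 + defect) + c * of_int p) / real q"
    by (intro divide_right_mono) auto
  hence B: "least_action \<xi> p q / real q \<le> G 0 + defect + c * w"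
    using pq by (simp add: add_divide_distrib)
  show ?thesis using A B by (simp add: algebra_simps)
qed

end

section \<open>Charts at the boundary of the annulus\<close>

lemma norm_fst_bound: "norm (fst z) \<le> norm z"
  and norm_snd_bound: "norm (snd z) \<le> norm z"
  by (metis norm_fst_le prod.collapse, metis norm_snd_le prod.collapse)

text \<open>Continuously differentiable charts at the boundary circle \<open>v = 0\<close>, with derivative \<open>D\<close>. By the
  chain rule a change of coordinates takes such a chart to another one. Exactness of the chart
  enters through the value of the loop integral of \<open>- cos v ds\<close> over the curves \<open>y = const\<close>.\<close>

locale boundary_chart = billiard +
  fixes \<Phi> :: "real \<times> real \<Rightarrow> real \<times> real"
    and D :: "real \<times> real \<Rightarrow> real \<times> real \<Rightarrow> real \<times> real" and \<epsilon> \<kappa> \<mu> :: real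
  assumes \<epsilon>_pos: "0 < \<epsilon>"
    and chart_deriv: "\<And>x y. 0 \<le> y \<Longrightarrow> y < \<epsilon> \<Longrightarrow> (\<Phi> has_derivative D (x, y)) (at (x, y))"
    and chart_deriv_cont: "\<And>w. continuous_on (UNIV \<times> {0..<\<epsilon>}) (\<lambda>z. D z w)"
    and chart_bij: "\<And>x. bij (D (x, 0))"
    and chart_inj: "inj_on \<Phi> (UNIV \<times> {0..<\<epsilon>})"
    and chart_range: "\<And>x y. 0 \<le> y \<Longrightarrow> y < \<epsilon> \<Longrightarrow> 0 \<le> snd (\<Phi> (x, y))"
    and chart_bottom: "\<And>x. snd (\<Phi> (x, 0)) = 0"
    and chart_shift: "\<And>x y. 0 \<le> y \<Longrightarrow> y < \<epsilon> \<Longrightarrow> \<Phi> (x + 1, y) = \<Phi> (x, y) + (1, 0)"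
    and chart_loop: "\<And>y. 0 \<le> y \<Longrightarrow> y < \<epsilon> \<Longrightarrow>
      ((\<lambda>x. - cos (snd (\<Phi> (x, y))) * fst (D (x, y) (1, 0))) has_integral (\<kappa> + \<mu> * y\<^sup>2 / 2)) {0..1}"
begin

lemma chart_shift_int:
  assumes "0 \<le> y" "y < \<epsilon>"
  shows "\<Phi> (x + of_int k, y) = \<Phi> (x, y) + (of_int k, 0)"
proof -
  have "fst (\<Phi> (x + of_int k, y)) = fst (\<Phi> (x, y)) + of_int k"
    using shift_int[of "\<lambda>x. fst (\<Phi> (x, y))" 1 x k] chart_shift[OF assms] by simp
  moreover have "snd (\<Phi> (x + of_int k, y)) = snd (\<Phi> (x, y))"
    using shift_int[of "\<lambda>x. snd (\<Phi> (x, y))" 0 x k] chart_shift[OF assms] by simp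
  ultimately show ?thesis by (simp add: prod_eq_iff)
qed

lemma chart_deriv_linear: "0 \<le> y \<Longrightarrow> y < \<epsilon> \<Longrightarrow> linear (D (x, y))"
  using chart_deriv has_derivative_linear by blast

lemma chart_deriv_basis:
  assumes "0 \<le> y" "y < \<epsilon>"
  shows "D (x, y) w = fst w *\<^sub>R D (x, y) (1, 0) + snd w *\<^sub>R D (x, y) (0, 1)"
proof -
  have "w = fst w *\<^sub>R (1, 0) + snd w *\<^sub>R (0, 1)" by (cases w) simp
  hence "D (x, y) w = D (x, y) (fst w *\<^sub>R (1, 0) + snd w *\<^sub>R (0, 1))" by (rule arg_cong)
  also have "\<dots> = fst w *\<^sub>R D (x, y) (1, 0) + snd w *\<^sub>R D (x, y) (0, 1)"
    by (simp only: linear_add[OF chart_deriv_linear[OF assms]] linear_scale[OF chart_deriv_linear[OF assms]])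
  finally show ?thesis .
qed

lemma chart_line_deriv:
  assumes "0 \<le> y" "y < \<epsilon>"
  shows "((\<lambda>x. fst (\<Phi> (x, y))) has_real_derivative fst (D (x, y) (1, 0))) (at x)"
    "((\<lambda>x. snd (\<Phi> (x, y))) has_real_derivative snd (D (x, y) (1, 0))) (at x)"
proof -
  have "((\<lambda>x. (x, y)) has_derivative (\<lambda>t. (t, 0))) (at x)"
    by (auto intro!: derivative_eq_intros)
  hence der: "((\<lambda>x. \<Phi> (x, y)) has_derivative (\<lambda>t. D (x, y) (t, 0))) (at x)"
    by (rule has_derivative_compose[where g = \<Phi> and g' = "D (x, y)"]) (rule chart_deriv[OF assms])
  have eq: "D (x, y) (t, 0) = t *\<^sub>R D (x, y) (1, 0)" for t
    using linear_scale[OF chart_deriv_linear[OF assms, of x], of t "(1, 0)"] by simp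
  have lin: "(\<lambda>t. fst (D (x, y) (t, 0))) = (*) (fst (D (x, y) (1, 0)))"
    by (rule ext, subst eq) simp
  have lin': "(\<lambda>t. snd (D (x, y) (t, 0))) = (*) (snd (D (x, y) (1, 0)))"
    by (rule ext, subst eq) simp
  have "((\<lambda>x. fst (\<Phi> (x, y))) has_derivative (\<lambda>t. fst (D (x, y) (t, 0)))) (at x)"
    using der by (rule has_derivative_fst)
  thus "((\<lambda>x. fst (\<Phi> (x, y))) has_real_derivative fst (D (x, y) (1, 0))) (at x)"
    unfolding has_field_derivative_def lin .
  have "((\<lambda>x. snd (\<Phi> (x, y))) has_derivative (\<lambda>t. snd (D (x, y) (t, 0)))) (at x)"
    using der by (rule has_derivative_snd)
  thus "((\<lambda>x. snd (\<Phi> (x, y))) has_real_derivative snd (D (x, y) (1, 0))) (at x)"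
    unfolding has_field_derivative_def lin' .
qed

lemma chart_line_deriv_shift:
  assumes "0 \<le> y" "y < \<epsilon>"
  shows "fst (D (x + of_int k, y) (1, 0)) = fst (D (x, y) (1, 0))"
proof -
  have "((\<lambda>x. fst (\<Phi> (x + of_int k, y))) has_real_derivative fst (D (x + of_int k, y) (1, 0))) (at x)"
    using chart_line_deriv(1)[OF assms, of "x + of_int k"] by (simp add: DERIV_shift)
  hence "((\<lambda>x. fst (\<Phi> (x, y)) + of_int k) has_real_derivative fst (D (x + of_int k, y) (1, 0))) (at x)"
    by (simp add: chart_shift_int[OF assms])
  moreover have "((\<lambda>x. fst (\<Phi> (x, y)) + of_int k) has_real_derivative fst (D (x, y) (1, 0))) (at x)"
    by (auto intro!: derivative_eq_intros chart_line_deriv assms)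
  ultimately show ?thesis by (rule DERIV_unique)
qed

lemma chart_cont: "continuous_on (UNIV \<times> {0..<\<epsilon>}) \<Phi>"
  by (rule has_derivative_continuous_on[where f' = D])
     (use chart_deriv in \<open>auto intro: has_derivative_at_withinI\<close>)

text \<open>On the boundary circle the derivative along the circle cannot vanish, as the chart is an
  immersion that preserves the circle; its mean value is 1.\<close>

lemma bottom_deriv_pos: "0 < fst (D (x, 0) (1, 0))"
proof (rule ccontr)
  define f where "f x = fst (D (x, 0) (1, 0))" for x
  have nz: "f x \<noteq> 0" for x
  proof
    assume "f x = 0"
    have "((\<lambda>x. snd (\<Phi> (x, 0))) has_real_derivative 0) (at x)"
      by (simp add: chart_bottom)
    hence "snd (D (x, 0) (1, 0)) = 0"
      using chart_line_deriv(2)[of 0 x] \<epsilon>_pos DERIV_unique by fastforce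
    hence "D (x, 0) (1, 0) = 0" using \<open>f x = 0\<close> by (simp add: prod_eq_iff f_def)
    moreover have "D (x, 0) 0 = 0" using chart_deriv_linear[of 0 x] \<epsilon>_pos linear_0 by auto
    moreover have "inj (D (x, 0))" using chart_bij bij_is_inj by blast
    ultimately have "(1::real, 0::real) = 0" by (metis injD)
    thus False by (simp add: zero_prod_def)
  qed
  have cont: "continuous_on UNIV f"
    unfolding f_def
    by (intro continuous_on_fst continuous_on_compose2[OF chart_deriv_cont])
       (use \<epsilon>_pos in \<open>auto intro!: continuous_intros\<close>)
  obtain t where t: "fst (\<Phi> (1, 0)) - fst (\<Phi> (0, 0)) = (1 - 0) * f t"
    using MVT2[of 0 1 "\<lambda>x. fst (\<Phi> (x, 0))" f] chart_line_deriv(1)[of 0] \<epsilon>_pos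
    unfolding f_def by auto
  have "f t = 1" using t chart_shift[of 0 0] \<epsilon>_pos by simp
  assume "\<not> 0 < fst (D (x, 0) (1, 0))"
  hence "f x \<le> 0" by (simp add: f_def)
  have "\<exists>r. f r = 0"
  proof (cases "x \<le> t")
    case True
    thus ?thesis
      using IVT'[of f x 0 t] \<open>f x \<le> 0\<close> \<open>f t = 1\<close> continuous_on_subset[OF cont, of "{x..t}"] by auto
  next
    case False
    thus ?thesis
      using IVT2'[of f x 0 t] \<open>f x \<le> 0\<close> \<open>f t = 1\<close> continuous_on_subset[OF cont, of "{t..x}"] by auto
  qed
  thus False using nz by blast
qed

text \<open>The chart maps the boundary circle onto the boundary circle, so that by injectivity no
  other point is mapped to it.\<close>

lemma chart_interior:
  assumes "0 < y" "y < \<epsilon>"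
  shows "0 < snd (\<Phi> (x, y))"
proof (rule ccontr)
  assume "\<not> ?thesis"
  hence v: "snd (\<Phi> (x, y)) = 0" using chart_range[of y x] assms by auto
  define s where "s = fst (\<Phi> (x, y))"
  define f where "f t = fst (\<Phi> (t, 0))" for t
  define k where "k = \<lfloor>s - f 0\<rfloor>"
  have shift: "f (t + of_int j) = f t + of_int j" for t j
    unfolding f_def using chart_shift_int[of 0 t j] \<epsilon>_pos by simp
  have "f (of_int k) \<le> s" "s \<le> f (of_int k + 1)"
    using shift[of 0 k] shift[of 0 "k + 1"] by (simp_all add: k_def) linarith+
  moreover have "continuous_on A f" for A
    unfolding f_def by (intro continuous_at_imp_continuous_on ballI
        DERIV_isCont[OF chart_line_deriv(1)]) (use \<epsilon>_pos in auto)
  ultimately obtain t where "f t = s" using IVT'[of f "of_int k" s "of_int k + 1"] by auto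
  hence "\<Phi> (t, 0) = \<Phi> (x, y)" using v chart_bottom by (simp add: prod_eq_iff s_def f_def)
  hence "(t, 0) = (x, y)"
  proof (rule inj_onD[OF chart_inj])
    show "(t, 0) \<in> UNIV \<times> {0..<\<epsilon>}" "(x, y) \<in> UNIV \<times> {0..<\<epsilon>}" using assms by simp_all
  qed
  thus False using assms by simp
qed

text \<open>Periodicity reduces uniform bounds near the boundary to compactness of a rectangle; the
  rectangle is wider than one period so that it contains, up to a translation, any two points at
  horizontal distance at most 1.\<close>

lemma chart_bounds:
  obtains \<delta> m L where "0 < \<delta>" "\<delta> < \<epsilon>" "0 < m" "m \<le> L"
    "\<And>x y. 0 \<le> y \<Longrightarrow> y \<le> \<delta> \<Longrightarrow> m \<le> fst (D (x, y) (1, 0))"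
    "\<And>x y. 0 \<le> y \<Longrightarrow> y \<le> \<delta> \<Longrightarrow> fst (D (x, y) (1, 0)) \<le> L"
    "\<And>x y. 0 \<le> y \<Longrightarrow> y \<le> \<delta> \<Longrightarrow> snd (\<Phi> (x, y)) < pi"
    "\<And>x y x' y'. 0 \<le> y \<Longrightarrow> y \<le> \<delta> \<Longrightarrow> 0 \<le> y' \<Longrightarrow> y' \<le> \<delta> \<Longrightarrow> \<bar>x - x'\<bar> \<le> 1 \<Longrightarrow>
      norm (\<Phi> (x, y) - \<Phi> (x', y')) \<le> L * norm ((x, y) - (x', y'))"
proof -
  define K where "K = {-1..2::real} \<times> {0..\<epsilon> / 2}"
  have K: "compact K" "convex K" "K \<subseteq> UNIV \<times> {0..<\<epsilon>}"
  proof -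
    show "compact K" unfolding K_def by (intro compact_Times compact_Icc)
    show "convex K" unfolding K_def by (intro convex_Times convex_real_interval)
    show "K \<subseteq> UNIV \<times> {0..<\<epsilon>}" using \<epsilon>_pos unfolding K_def by auto
  qed
  have frac_in: "(frac x, y) \<in> K" if "0 \<le> y" "y \<le> \<epsilon> / 2" for x y
  proof -
    have "-1 \<le> frac x" "frac x \<le> 2" using frac_ge_0[of x] frac_lt_1[of x] by linarith+
    thus ?thesis using that by (simp add: K_def)
  qed
  have bnd: "\<exists>B. \<forall>z\<in>K. norm (D z w) \<le> B" for w
  proof -
    have "compact ((\<lambda>z. D z w) ` K)"
      by (intro compact_continuous_image continuous_on_subset[OF chart_deriv_cont] K)
    hence "bounded ((\<lambda>z. D z w) ` K)" by (rule compact_imp_bounded)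
    thus ?thesis unfolding bounded_iff by blast
  qed
  obtain B1 B2 where B: "\<And>z. z \<in> K \<Longrightarrow> norm (D z (1, 0)) \<le> B1" "\<And>z. z \<in> K \<Longrightarrow> norm (D z (0, 1)) \<le> B2"
    using bnd[of "(1, 0)"] bnd[of "(0, 1)"] by blast
  define L where "L = max 1 (B1 + B2)"
  have B0: "0 \<le> B1" "0 \<le> B2"
    using order_trans[OF norm_ge_zero B(1)[OF frac_in[of 0 0]]]
      order_trans[OF norm_ge_zero B(2)[OF frac_in[of 0 0]]] \<epsilon>_pos by simp_all
  have onorm: "onorm (D z) \<le> L" if z: "z \<in> K" for z
  proof (rule onorm_le)
    fix w
    have zz: "z = (fst z, snd z)" "0 \<le> snd z" "snd z < \<epsilon>" using z \<epsilon>_pos by (auto simp: K_def)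
    have "norm (D z w) \<le> \<bar>fst w\<bar> * norm (D z (1, 0)) + \<bar>snd w\<bar> * norm (D z (0, 1))"
      using norm_triangle_ineq[of "fst w *\<^sub>R D z (1, 0)" "snd w *\<^sub>R D z (0, 1)"]
        chart_deriv_basis[OF zz(2,3), of "fst z" w] by simp
    also have "\<dots> \<le> norm w * B1 + norm w * B2"
      using B[OF z] B0 norm_fst_bound[of w] norm_snd_bound[of w]
      by (intro add_mono mult_mono) (simp_all only: real_norm_def abs_ge_zero norm_ge_zero)
    also have "\<dots> \<le> L * norm w"
    proof -
      have "B1 + B2 \<le> L" unfolding L_def by simp
      hence "(B1 + B2) * norm w \<le> L * norm w" by (rule mult_right_mono) simp
      thus ?thesis by (simp add: algebra_simps)
    qed
    finally show "norm (D z w) \<le> L * norm w" .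
  qed
  have lip: "norm (\<Phi> z - \<Phi> z') \<le> L * norm (z - z')" if "z \<in> K" "z' \<in> K" for z z'
  proof (rule differentiable_bound[OF K(2) _ onorm that])
    fix z assume "z \<in> K"
    hence "0 \<le> snd z" "snd z < \<epsilon>" using \<epsilon>_pos by (auto simp: K_def)
    hence "(\<Phi> has_derivative D z) (at z)" using chart_deriv[of "snd z" "fst z"] by simp
    thus "(\<Phi> has_derivative D z) (at z within K)" by (rule has_derivative_at_withinI)
  qed
  define f where "f z = fst (D z (1, 0))" for z
  have fcont: "continuous_on K f"
    unfolding f_def by (intro continuous_on_fst continuous_on_subset[OF chart_deriv_cont] K)
  obtain x0 where x0: "\<And>x. x \<in> {0..1} \<Longrightarrow> f (x0, 0) \<le> f (x, 0)"
  proof -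
    have "continuous_on {0..1} (\<lambda>x. f (x, 0))"
      by (rule continuous_on_compose2[OF fcont])
         (use \<epsilon>_pos in \<open>auto simp: K_def intro!: continuous_intros\<close>)
    then obtain x where "\<forall>t\<in>{0..1}. f (x, 0) \<le> f (t, 0)"
      using continuous_attains_inf[of "{0..1::real}" "\<lambda>x. f (x, 0)"] by auto
    thus ?thesis using that[of x] by blast
  qed
  define m where "m = f (x0, 0) / 2"
  have m: "0 < m" using bottom_deriv_pos[of x0] by (simp add: m_def f_def)
  have "uniformly_continuous_on K f" by (rule compact_uniformly_continuous[OF fcont K(1)])
  then obtain d1 where d1: "d1 > 0" "\<And>z z'. z \<in> K \<Longrightarrow> z' \<in> K \<Longrightarrow> dist z' z < d1 \<Longrightarrow> dist (f z') (f z) < m"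
    unfolding uniformly_continuous_on_def using m by blast
  define \<delta> where "\<delta> = min (\<epsilon> / 2) (min (d1 / 2) (1 / L))"
  have L: "L \<ge> 1" by (simp add: L_def)
  have \<delta>: "0 < \<delta>" "\<delta> \<le> \<epsilon> / 2" "\<delta> < d1" "\<delta> \<le> 1 / L"
  proof -
    show "0 < \<delta>" unfolding \<delta>_def using \<epsilon>_pos d1(1) L by simp
    have "\<delta> \<le> d1 / 2" unfolding \<delta>_def by (simp add: min_le_iff_disj)
    thus "\<delta> < d1" using d1(1) by simp
    show "\<delta> \<le> \<epsilon> / 2" "\<delta> \<le> 1 / L" unfolding \<delta>_def by (simp_all add: min_le_iff_disj)
  qed
  have f_frac: "f (x, y) = f (frac x, y)" if "0 \<le> y" "y \<le> \<delta>" for x y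
  proof -
    have "x + of_int (- \<lfloor>x\<rfloor>) = frac x" by (simp add: frac_def)
    thus ?thesis
      using chart_line_deriv_shift[of y x "- \<lfloor>x\<rfloor>"] that \<delta>(2) \<epsilon>_pos unfolding f_def by simp
  qed
  have lower: "m \<le> f (x, y)" if y: "0 \<le> y" "y \<le> \<delta>" for x y
  proof -
    have "dist (f (frac x, y)) (f (frac x, 0)) < m"
      using y \<delta> \<epsilon>_pos by (intro d1(2) frac_in) (auto simp: dist_Pair_Pair)
    moreover have "f (x0, 0) \<le> f (frac x, 0)"
      using x0[of "frac x"] frac_ge_0[of x] frac_lt_1[of x] by simp
    ultimately have "m \<le> f (frac x, y)"
      unfolding dist_real_def m_def by linarith
    thus ?thesis using f_frac[OF y] by simp
  qed
  have upper: "f (x, y) \<le> L" if y: "0 \<le> y" "y \<le> \<delta>" for x y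
  proof -
    have "(frac x, y) \<in> K" using frac_in y \<delta> by simp
    hence "norm (f (frac x, y)) \<le> B1"
      unfolding f_def by (intro order_trans[OF norm_fst_bound] B(1))
    thus ?thesis using f_frac[OF y] B0 by (simp add: L_def)
  qed
  have frac_shift: "\<Phi> (x, y) = \<Phi> (x - of_int k, y) + (of_int k, 0)" if "0 \<le> y" "y \<le> \<delta>" for x y k
    using chart_shift_int[of y "x - of_int k" k] that \<delta> \<epsilon>_pos by simp
  show thesis
  proof (rule that[of \<delta> m L])
    show "m \<le> L" using lower[of 0 0] upper[of 0 0] \<delta> by simp
    show "\<delta> < \<epsilon>" using \<delta> \<epsilon>_pos by simp
    show "snd (\<Phi> (x, y)) < pi" if y: "0 \<le> y" "y \<le> \<delta>" for x y
    proof -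
      have "norm (\<Phi> (frac x, y) - \<Phi> (frac x, 0)) \<le> L * norm ((frac x, y) - (frac x, 0))"
        using y \<delta> \<epsilon>_pos by (intro lip frac_in) auto
      also have "\<dots> \<le> L * (1 / L)" using y \<delta> L by (intro mult_left_mono) (auto simp: norm_Pair)
      finally have "norm (snd (\<Phi> (frac x, y)) - 0) \<le> 1"
        using norm_snd_bound[of "\<Phi> (frac x, y) - \<Phi> (frac x, 0)"] L chart_bottom[of "frac x"] by simp
      moreover have "\<Phi> (x, y) = \<Phi> (frac x, y) + (of_int \<lfloor>x\<rfloor>, 0)"
        using frac_shift[OF y, of x "\<lfloor>x\<rfloor>"] by (simp add: frac_def)
      ultimately show ?thesis using pi_gt3 by simp
    qed
    show "norm (\<Phi> (x, y) - \<Phi> (x', y')) \<le> L * norm ((x, y) - (x', y'))"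
      if y: "0 \<le> y" "y \<le> \<delta>" "0 \<le> y'" "y' \<le> \<delta>" and x: "\<bar>x - x'\<bar> \<le> 1" for x y x' y'
    proof -
      define k where "k = \<lfloor>x\<rfloor>"
      have "0 \<le> x - of_int k" "x - of_int k \<le> 1" unfolding k_def by linarith+
      hence "(x - of_int k, y) \<in> K" "(x' - of_int k, y') \<in> K"
        using y x \<delta> unfolding K_def by auto
      from lip[OF this] show ?thesis
        unfolding frac_shift[OF y(1,2), of x k] frac_shift[OF y(3,4), of x' k] by simp
    qed
    show "m \<le> fst (D (x, y) (1, 0))" "fst (D (x, y) (1, 0)) \<le> L" if "0 \<le> y" "y \<le> \<delta>" for x y
      using lower[OF that] upper[OF that] unfolding f_def .
  qed (rule \<delta>(1) m)+
qed

text \<open>With \<open>y = W w\<close> an approximate solution of \<open>\<zeta> y = w\<close>, the curve \<open>\<Phi> (\<cdot>, y)\<close> is invariant with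
  rotation number \<open>w\<close> up to \<open>O(w\<^bsup>N + 1\<^esup>)\<close>. Its chords have length of order \<open>w\<close>, which costs one power
  in the support inequality.\<close>

lemma beta_support:
  fixes \<zeta> :: "real fps" and W :: "real \<Rightarrow> real"
  assumes normal_form: "0 < \<rho>" "\<And>x y. 0 \<le> y \<Longrightarrow> y < \<rho> \<Longrightarrow> \<exists>z'\<in>UNIV \<times> {0..<\<epsilon>}.
      \<Phi> z' = billiard_map \<xi> (\<Phi> (x, y)) \<and>
      norm (z' - (x + (\<Sum>k\<le>N. fps_nth \<zeta> k * y ^ k), y)) \<le> A * y ^ Suc N"
    and W: "0 < \<sigma>" "\<And>w. 0 < w \<Longrightarrow> w < \<sigma> \<Longrightarrow> 0 < W w \<and> W w \<le> 2 * w \<and>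
      \<bar>(\<Sum>k\<le>N. fps_nth \<zeta> k * W w ^ k) - w\<bar> \<le> B * w ^ Suc N"
  obtains C \<delta> where "0 < \<delta>" "\<delta> \<le> 1" "0 \<le> C"
    "\<And>w x. w \<in> \<rat> \<Longrightarrow> x \<in> \<rat> \<Longrightarrow> 0 < w \<Longrightarrow> w < \<delta> \<Longrightarrow> 0 < x \<Longrightarrow> x \<le> 1 \<Longrightarrow>
      beta \<xi> w + (\<kappa> + \<mu> * (W w)\<^sup>2 / 2) * (x - w) - C * w ^ N \<le> beta \<xi> x"
proof -
  obtain \<delta>0 m L where \<delta>0: "0 < \<delta>0" "\<delta>0 < \<epsilon>" and m: "0 < m" "m \<le> L"
    and S'_ge: "\<And>x y. 0 \<le> y \<Longrightarrow> y \<le> \<delta>0 \<Longrightarrow> m \<le> fst (D (x, y) (1, 0))"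
    and S'_le: "\<And>x y. 0 \<le> y \<Longrightarrow> y \<le> \<delta>0 \<Longrightarrow> fst (D (x, y) (1, 0)) \<le> L"
    and V_lt: "\<And>x y. 0 \<le> y \<Longrightarrow> y \<le> \<delta>0 \<Longrightarrow> snd (\<Phi> (x, y)) < pi"
    and lip: "\<And>x y x' y'. 0 \<le> y \<Longrightarrow> y \<le> \<delta>0 \<Longrightarrow> 0 \<le> y' \<Longrightarrow> y' \<le> \<delta>0 \<Longrightarrow> \<bar>x - x'\<bar> \<le> 1 \<Longrightarrow>
      norm (\<Phi> (x, y) - \<Phi> (x', y')) \<le> L * norm ((x, y) - (x', y'))"
    by (rule chart_bounds, rule that)
  obtain M where M: "M > 0" "\<And>s t. norm (\<tau> s - \<tau> t) \<le> M * \<bar>s - t\<bar>"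
    by (rule tangent_lipschitz, rule that)
  have L: "0 < L" using m by simp
  define C3 where "C3 = \<bar>A\<bar> * 2 ^ Suc N + \<bar>B\<bar> + 1"
  have C3: "0 < C3" unfolding C3_def by (simp add: add_nonneg_pos)
  define C where "C = 3 * (2 * L * (L * C3 / m) + L * (8 * L * C3 / m + M * (L * C3) + L * C3))"
  define \<delta> where "\<delta> = Min {1, \<delta>0 / 4, \<rho> / 2, \<sigma>, \<delta>0 / (2 * C3), 1 / C3, 1 / (2 * M * L)}"
  have \<delta>: "0 < \<delta>" unfolding \<delta>_def using \<delta>0 normal_form(1) W(1) C3 M L by simp
  have \<delta>_le: "\<delta> \<le> 1" "\<delta> \<le> \<delta>0 / 4" "\<delta> \<le> \<rho> / 2" "\<delta> \<le> \<sigma>" "\<delta> \<le> \<delta>0 / (2 * C3)" "\<delta> \<le> 1 / C3"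
    "\<delta> \<le> 1 / (2 * M * L)"
    unfolding \<delta>_def by (rule Min_le; simp)+
  show thesis
  proof (rule that[OF \<delta> \<delta>_le(1), of C])
    show "0 \<le> C" unfolding C_def using L C3 m M by simp
    fix w x :: real
    assume rat: "w \<in> \<rat>" "x \<in> \<rat>" and w: "0 < w" "w < \<delta>" and x: "0 < x" "x \<le> 1"
    define y where "y = W w"
    have w1: "w < 1" "w < \<delta>0 / 4" "w < \<rho> / 2" "w < \<sigma>" "C3 * w < \<delta>0 / 2" "C3 * w < 1"
      "M * (L * w) < 1 / 2"
  proof -
      show "w < 1" "w < \<delta>0 / 4" "w < \<rho> / 2" "w < \<sigma>" using w \<delta>_le by linarith+
      have "w < \<delta>0 / (2 * C3)" "w < 1 / C3" "w < 1 / (2 * M * L)" using w \<delta>_le by linarith+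
      thus "C3 * w < \<delta>0 / 2" "C3 * w < 1" "M * (L * w) < 1 / 2"
        using C3 M(1) L by (simp_all add: pos_less_divide_eq mult_ac)
    qed
    have y: "0 < y" "y \<le> 2 * w" "\<bar>(\<Sum>k\<le>N. fps_nth \<zeta> k * y ^ k) - w\<bar> \<le> B * w ^ Suc N"
      using W(2)[of w] w w1 unfolding y_def by auto
    have y\<delta>: "0 \<le> y" "y \<le> \<delta>0" "y \<le> \<delta>0 / 2" "y < \<rho>" "y < \<epsilon>" using y w1 \<delta>0 by auto
    define e' where "e' = C3 * w ^ Suc N"
    have wN: "w ^ Suc N \<le> w" "0 \<le> w ^ Suc N" "w ^ Suc N \<le> w ^ N" "0 \<le> w ^ N"
      using w w1 power_decreasing[of 1 "Suc N" w] power_decreasing[of N "Suc N" w] by auto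
    have "e' \<le> C3 * w" unfolding e'_def using wN C3 by (intro mult_left_mono) auto
    moreover have "0 \<le> e'" using wN C3 by (simp add: e'_def)
    ultimately have e': "0 \<le> e'" "e' \<le> \<delta>0 / 2" "e' \<le> 1"
      using w1 by linarith+
    have image: "norm (billiard_map \<xi> (\<Phi> (t, y)) - \<Phi> (t + w, y)) \<le> L * e'" for t
    proof -
      obtain a b where z: "0 \<le> b" "b < \<epsilon>" "\<Phi> (a, b) = billiard_map \<xi> (\<Phi> (t, y))"
        "norm ((a, b) - (t + (\<Sum>k\<le>N. fps_nth \<zeta> k * y ^ k), y)) \<le> A * y ^ Suc N"
        using normal_form(2)[of y t] y\<delta> by auto
      let ?s = "\<Sum>k\<le>N. fps_nth \<zeta> k * y ^ k"
      have "(a, b) - (t + w, y) = ((a, b) - (t + ?s, y)) + (?s - w, 0)" by simp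
      hence "norm ((a, b) - (t + w, y)) \<le> norm ((a, b) - (t + ?s, y)) + norm (?s - w, 0::real)"
        using norm_triangle_ineq by metis
      also have "norm (?s - w, 0::real) \<le> \<bar>B\<bar> * w ^ Suc N"
        using y(3) mult_right_mono[OF abs_ge_self[of B] wN(2)] by (simp add: norm_Pair)
      also have "norm ((a, b) - (t + ?s, y)) \<le> \<bar>A\<bar> * (2 ^ Suc N * w ^ Suc N)"
      proof -
        have "y ^ Suc N \<le> (2 * w) ^ Suc N" using y by (intro power_mono) auto
        hence "\<bar>A\<bar> * y ^ Suc N \<le> \<bar>A\<bar> * (2 ^ Suc N * w ^ Suc N)"
          unfolding power_mult_distrib by (intro mult_left_mono) auto
        moreover have "A * y ^ Suc N \<le> \<bar>A\<bar> * y ^ Suc N"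
          using y by (intro mult_right_mono) auto
        ultimately show ?thesis using z(4) by linarith
      qed
      also have "\<bar>A\<bar> * (2 ^ Suc N * w ^ Suc N) + \<bar>B\<bar> * w ^ Suc N \<le> e'"
        using wN(2) unfolding e'_def C3_def by (simp add: algebra_simps)
      finally have close: "norm ((a, b) - (t + w, y)) \<le> e'" by simp
      have "\<bar>b - y\<bar> \<le> e'" "\<bar>a - (t + w)\<bar> \<le> e'"
        using close norm_fst_bound[of "(a, b) - (t + w, y)"] norm_snd_bound[of "(a, b) - (t + w, y)"]
        by simp_all
      hence "norm (\<Phi> (a, b) - \<Phi> (t + w, y)) \<le> L * norm ((a, b) - (t + w, y))"
        using z y\<delta> e' by (intro lip) auto
      also have "\<dots> \<le> L * e'" using close L by (intro mult_left_mono) auto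
      finally show ?thesis using z by simp
    qed
    define S where "S t = fst (\<Phi> (t, y))" for t
    define V where "V t = snd (\<Phi> (t, y))" for t
    define S' where "S' t = fst (D (t, y) (1, 0))" for t
    define e where "e = L * e'"
    define l where "l = m * w / 2"
    have S_deriv: "(S has_real_derivative S' t) (at t)" for t
      unfolding S_def S'_def by (rule chart_line_deriv(1)) (use y\<delta> in auto)
    have S'b: "m \<le> S' t" "S' t \<le> L" for t
      unfolding S'_def using S'_ge S'_le y\<delta> by auto
    have SV: "(S t, V t) = \<Phi> (t, y)" for t by (simp add: S_def V_def)
    have chord: "l \<le> norm (\<xi> (S (t + w)) - \<xi> (S t))" for t
    proof -
      obtain r where "S (t + w) - S t = (t + w - t) * S' r"
        using MVT2[of t "t + w" S S'] S_deriv w by auto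
      hence r: "S (t + w) - S t = w * S' r" by simp
      have "m * w \<le> w * S' r" "w * S' r \<le> L * w"
        using S'b[of r] w mult_left_mono[of m "S' r" w] mult_left_mono[of "S' r" L w]
        by (auto simp: mult.commute)
      hence b: "m * w \<le> S (t + w) - S t" "S (t + w) - S t \<le> L * w" using r by simp_all
      have "0 < m * w" using m w by simp
      moreover have "M * (S (t + w) - S t) \<le> M * (L * w)" using b M by (intro mult_left_mono) auto
      ultimately have "(S (t + w) - S t) / 2 \<le> norm (\<xi> (S (t + w)) - \<xi> (S t))"
        using b w1 by (intro chord_ge[OF M(2,1)]) linarith+
      moreover have "m * w / 2 \<le> (S (t + w) - S t) / 2" using b(1) by simp
      ultimately show ?thesis unfolding l_def by (rule order_trans[rotated])
    qed
    have curve: "approx_invariant_curve \<Omega> \<xi> S V S' m L M (\<kappa> + \<mu> * y\<^sup>2 / 2) w e l"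
    proof (unfold_locales)
      show "continuous_on UNIV S'"
        unfolding S'_def
        by (intro continuous_on_fst continuous_on_compose2[OF chart_deriv_cont])
           (use y\<delta> in \<open>auto intro!: continuous_intros\<close>)
      show "continuous_on UNIV V"
        unfolding V_def
        by (intro continuous_on_snd continuous_on_compose2[OF chart_cont])
           (use y\<delta> in \<open>auto intro!: continuous_intros\<close>)
      show "((\<lambda>t. - cos (V t) * S' t) has_integral \<kappa> + \<mu> * y\<^sup>2 / 2) {0..1}"
        unfolding V_def S'_def by (rule chart_loop) (use y\<delta> in auto)
      fix t
      show "\<bar>fst (billiard_map \<xi> (S t, V t)) - S (t + w)\<bar> \<le> e"
        "\<bar>snd (billiard_map \<xi> (S t, V t)) - V (t + w)\<bar> \<le> e"
        unfolding SV e_def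
        using image[of t] norm_fst_bound[of "billiard_map \<xi> (\<Phi> (t, y)) - \<Phi> (t + w, y)"]
          norm_snd_bound[of "billiard_map \<xi> (\<Phi> (t, y)) - \<Phi> (t + w, y)"]
        unfolding S_def V_def by simp_all
      show "0 < V t" unfolding V_def using chart_interior y y\<delta> by simp
      show "V t < pi" unfolding V_def using V_lt y\<delta> by simp
      show "S (t + 1) = S t + 1" "V (t + 1) = V t"
        unfolding S_def V_def using chart_shift[of y t] y\<delta> by simp_all
      show "(S has_real_derivative S' t) (at t)" by (rule S_deriv)
      show "m \<le> S' t" "S' t \<le> L" by (rule S'b)+
      show "l \<le> norm (\<xi> (S (t + w)) - \<xi> (S t))" by (rule chord)
      show "0 < l" unfolding l_def using m w by simp
    qed (rule m(1) w(1) w1(1) M)+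
    interpret C: approx_invariant_curve \<Omega> \<xi> S V S' m L M "\<kappa> + \<mu> * y\<^sup>2 / 2" w e l by (rule curve)
    have "3 * C.defect \<le> C * w ^ N"
    proof -
      have e: "e = L * C3 * w ^ Suc N" by (simp add: e_def e'_def)
      have el: "4 * e / l = 8 * L * C3 / m * w ^ N"
        unfolding e l_def using w m by (simp add: field_simps)
      have eN: "e \<le> L * C3 * w ^ N" unfolding e using wN L C3 by (intro mult_left_mono) auto
      define T1 T2 where "T1 = 2 * L * (e / m)" and "T2 = L * (4 * e / l + M * e + e)"
      have "e / m \<le> L * C3 * w ^ N / m" using eN m by (intro divide_right_mono) auto
      hence "2 * L * (e / m) \<le> 2 * L * (L * C3 * w ^ N / m)" using L by (intro mult_left_mono) auto
      also have "\<dots> = 2 * L * (L * C3 / m) * w ^ N" by simp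
      finally have 1: "T1 \<le> 2 * L * (L * C3 / m) * w ^ N" unfolding T1_def .
      have "L * (4 * e / l + M * e + e) \<le>
          L * (8 * L * C3 / m * w ^ N + M * (L * C3 * w ^ N) + L * C3 * w ^ N)"
      proof (rule mult_left_mono)
        have "M * e \<le> M * (L * C3 * w ^ N)" using eN M by (intro mult_left_mono) auto
        thus "4 * e / l + M * e + e \<le>
            8 * L * C3 / m * w ^ N + M * (L * C3 * w ^ N) + L * C3 * w ^ N"
          unfolding el using eN by linarith
      qed (use L in simp)
      also have "\<dots> = L * (8 * L * C3 / m + M * (L * C3) + L * C3) * w ^ N"
        by (simp only: distrib_right distrib_left mult.assoc)
      finally have 2: "T2 \<le> L * (8 * L * C3 / m + M * (L * C3) + L * C3) * w ^ N" unfolding T2_def .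
      have "C.defect = T1 + T2" by (simp add: C.defect_def T1_def T2_def)
      hence "3 * C.defect \<le> 3 * (2 * L * (L * C3 / m) * w ^ N
          + L * (8 * L * C3 / m + M * (L * C3) + L * C3) * w ^ N)"
        using add_mono[OF 1 2] by simp
      also have "\<dots> = C * w ^ N"
        unfolding C_def distrib_right[symmetric] by (rule mult.assoc[symmetric])
      finally show ?thesis .
    qed
    obtain p q where p: "0 < p" "p \<le> int q" "0 < q" "w = of_int p / real q"
      by (rule rational_quotient[OF rat(1) w(1) less_imp_le[OF w1(1)]], rule that)
    obtain p' q' where p': "0 < p'" "p' \<le> int q'" "0 < q'" "x = of_int p' / real q'"
      by (rule rational_quotient[OF rat(2) x], rule that)
    define R where "R = (\<kappa> + \<mu> * (W w)\<^sup>2 / 2) * (x - w)"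
    have "beta \<xi> w = least_action \<xi> p q / real q"
      using beta_quotient[OF less_imp_le[OF p(1)] p(2,3)] p(4) by metis
    moreover have "beta \<xi> x = least_action \<xi> p' q' / real q'"
      using beta_quotient[OF less_imp_le[OF p'(1)] p'(2,3)] p'(4) by metis
    moreover have "least_action \<xi> p q / real q + (\<kappa> + \<mu> * y\<^sup>2 / 2) * (of_int p' / real q' - w)
        - 3 * C.defect \<le> least_action \<xi> p' q' / real q'"
      by (rule C.least_action_support[OF p(4) less_imp_le[OF p(1)] p(2,3)
            less_imp_le[OF p'(1)] p'(2,3)])
    moreover have "(\<kappa> + \<mu> * y\<^sup>2 / 2) * (of_int p' / real q' - w) = R"
      unfolding R_def y_def using p'(4) by metis
    ultimately have "beta \<xi> w + R - 3 * C.defect \<le> beta \<xi> x" by metis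
    thus "beta \<xi> w + (\<kappa> + \<mu> * (W w)\<^sup>2 / 2) * (x - w) - C * w ^ N \<le> beta \<xi> x"
      using \<open>3 * C.defect \<le> C * w ^ N\<close> unfolding R_def[symmetric] by linarith
  qed
qed

end

section \<open>The formal series\<close>

lemma formal_inverse:
  fixes \<zeta> :: "real fps"
  assumes "fps_nth \<zeta> 0 = 0" "fps_nth \<zeta> 1 = 1"
  shows "fps_nth (fps_inv \<zeta>) 0 = 0" "fps_nth (fps_inv \<zeta>) 1 = 1" "\<zeta> oo fps_inv \<zeta> = fps_X"
proof -
  show W0: "fps_nth (fps_inv \<zeta>) 0 = 0" by (simp add: fps_inv_def)
  show W: "\<zeta> oo fps_inv \<zeta> = fps_X" by (rule fps_inv_right) (use assms in auto)
  have "fps_nth (\<zeta> oo fps_inv \<zeta>) 1 = fps_nth (fps_inv \<zeta>) 1"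
    using assms by (simp add: fps_compose_nth)
  thus "fps_nth (fps_inv \<zeta>) 1 = 1" using W by simp
qed

text \<open>For \<open>W = fps_inv \<zeta>\<close> the square roots of \<open>W\<^sup>2 / 2\<close> are \<open>\<plusminus> W / sqrt 2\<close>, and the leading
  coefficient 1 of \<open>W\<close> selects the sign.\<close>

lemma formal_sqrt_formal_c:
  fixes \<zeta> :: "real fps"
  assumes "fps_nth \<zeta> 0 = 0" "fps_nth \<zeta> 1 = 1"
  shows "formal_sqrt (formal_c \<zeta>) = fps_const (1 / sqrt 2) * fps_inv \<zeta>"
proof -
  let ?R = "fps_const (1 / sqrt 2) * fps_inv \<zeta>"
  note W = formal_inverse[OF assms]
  have R1: "fps_nth ?R 0 = 0" "fps_nth ?R 1 = 1 / sqrt 2" using W by simp_all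
  have sub: "subdegree ?R = 1" by (rule subdegreeI) (use R1 in auto)
  have sq: "?R\<^sup>2 = formal_c \<zeta>"
    unfolding formal_c_def power_mult_distrib fps_const_power by (simp add: power_divide)
  show ?thesis
    unfolding formal_sqrt_def
  proof (rule the_equality)
    show "?R\<^sup>2 = formal_c \<zeta> \<and> 0 < fps_nth ?R (subdegree ?R)"
      using sq unfolding sub R1 by simp
    fix r assume r: "r\<^sup>2 = formal_c \<zeta> \<and> 0 < fps_nth r (subdegree r)"
    hence "r = ?R \<or> r = - ?R" using sq power2_eq_iff by metis
    moreover have "r \<noteq> - ?R"
    proof
      assume e: "r = - ?R"
      have "subdegree r = 1" unfolding e using sub by (simp only: subdegree_uminus)
      hence "fps_nth r (subdegree r) = - (1 / sqrt 2)" unfolding e using R1 by simp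
      thus False using r by simp
    qed
    ultimately show "r = ?R" by blast
  qed
qed

text \<open>\<open>y\<^sup>2 / 2 d\<zeta>\<close> has the primitive \<open>\<Sum>k. k / (k + 2) * \<zeta>\<^sub>k * y\<^bsup>k + 2\<^esup> / 2\<close>.\<close>

definition action_series :: "real fps \<Rightarrow> real fps" where
  "action_series \<zeta> = Abs_fps (\<lambda>n. if n < 2 then 0 else real (n - 2) / real n * fps_nth \<zeta> (n - 2) / 2)"

lemma fps_deriv_action_series: "fps_deriv (action_series \<zeta>) = fps_const (1 / 2) * (fps_X\<^sup>2 * fps_deriv \<zeta>)"
proof (rule fps_ext)
  fix n
  show "fps_nth (fps_deriv (action_series \<zeta>)) n = fps_nth (fps_const (1 / 2) * (fps_X\<^sup>2 * fps_deriv \<zeta>)) n"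
  proof (cases "n < 2")
    case True
    hence "n = 0 \<or> n = 1" by auto
    thus ?thesis by (auto simp: action_series_def fps_X_power_mult_nth)
  next
    case False
    then obtain k where "n = k + 2" by (metis add.commute le_add_diff_inverse not_less)
    thus ?thesis
      unfolding fps_mult_left_const_nth fps_X_power_mult_nth
      by (simp add: action_series_def field_simps)
  qed
qed

lemma sum_odd_terms:
  fixes f :: "nat \<Rightarrow> real"
  assumes "\<And>k. even k \<Longrightarrow> f k = 0" "f 1 = 0"
  shows "f 3 + (\<Sum>j<m. f (2 * j + 5)) = (\<Sum>i<2 * m + 5. f i)"
proof (induction m)
  case 0
  have "f 0 = 0" "f 2 = 0" "f 4 = 0" using assms(1) by auto
  thus ?case using assms(2) by (simp add: lessThan_nat_numeral eval_nat_numeral)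
next
  case (Suc m)
  have "{..<2 * Suc m + 5} = insert (2 * m + 6) (insert (2 * m + 5) {..<2 * m + 5})" by auto
  moreover have "f (2 * m + 6) = 0" using assms(1) by simp
  ultimately show ?case using Suc by simp
qed

text \<open>The powers of \<open>sqrt 2\<close> cancel against those in \<open>W / sqrt 2\<close> for \<open>W = fps_inv \<zeta>\<close>, which leaves
  the primitive above, evaluated at \<open>y = W\<close>.\<close>

lemma formal_sum_eq_compose:
  fixes \<zeta> :: "real fps"
  assumes "fps_nth \<zeta> 1 = 1" "\<forall>k. even k \<longrightarrow> fps_nth \<zeta> k = 0"
  shows "formal_sum \<zeta> = action_series \<zeta> oo fps_inv \<zeta>"
proof -
  have \<zeta>0: "fps_nth \<zeta> 0 = 0" using assms(2) by simp
  let ?W = "fps_inv \<zeta>" and ?H = "action_series \<zeta>"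
  note W = formal_inverse[OF \<zeta>0 assms(1)]
  have root: "formal_sqrt (formal_c \<zeta>) = fps_const (1 / sqrt 2) * ?W"
    by (rule formal_sqrt_formal_c[OF \<zeta>0 assms(1)])
  have H3: "fps_nth ?H 3 = 1 / 6" using assms(1) by (simp add: action_series_def)
  have sqrt3: "sqrt 2 ^ 3 = 2 * sqrt 2" by (simp add: power3_eq_cube)
  have first: "fps_const (sqrt 2 / 3) * (fps_const (1 / sqrt 2) * ?W) ^ 3 = fps_const (fps_nth ?H 3) * ?W ^ 3"
    unfolding power_mult_distrib fps_const_power mult.assoc[symmetric] fps_const_mult H3
    by (simp add: power_divide sqrt3)
  have summand: "fps_const (real (2 * i + 1) / real (2 * i + 3) * fps_nth \<zeta> (2 * i + 1) * sqrt (2 ^ (2 * i + 1)))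
      * (fps_const (1 / sqrt 2) * ?W) ^ (2 * i + 3) = fps_const (fps_nth ?H (2 * i + 3)) * ?W ^ (2 * i + 3)" for i
  proof -
    have e: "2 * i + 3 = (2 * i + 1) + 2" by simp
    have "sqrt 2 ^ (2 * i + 3) = sqrt (2 ^ (2 * i + 1)) * 2"
      unfolding e power_add[of _ "2 * i + 1" 2] real_sqrt_power[of 2 "2 * i + 1"] by simp
    hence "sqrt (2 ^ (2 * i + 1)) * (1 / sqrt 2) ^ (2 * i + 3) = 1 / 2"
      by (simp add: power_divide)
    moreover have "fps_nth ?H (2 * i + 3) = real (2 * i + 1) / real (2 * i + 3) * fps_nth \<zeta> (2 * i + 1) * (1 / 2)"
      by (simp add: action_series_def)
    ultimately show ?thesis
      unfolding power_mult_distrib fps_const_power mult.assoc[symmetric] fps_const_mult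
      by (metis mult.assoc)
  qed
  define T where "T j = fps_const (fps_nth ?H (2 * j + 5)) * ?W ^ (2 * j + 5)" for j
  have "T sums ((?H oo ?W) - fps_const (fps_nth ?H 3) * ?W ^ 3)"
    unfolding sums_def
  proof (rule tendsto_fpsI)
    fix n
    define f where "f i = fps_nth ?H i * fps_nth (?W ^ i) n" for i
    have f0: "f i = 0" if "even i" for i
      using assms(2) that by (auto simp: f_def action_series_def)
    have f1: "f 1 = 0" by (simp add: f_def action_series_def)
    have big: "f i = 0" if "n < i" for i
      using W(1) that by (simp add: f_def fps_power_zeroth_eq_one startsby_zero_power_prefix)
    have "fps_nth (\<Sum>j<m. T j) n = fps_nth ((?H oo ?W) - fps_const (fps_nth ?H 3) * ?W ^ 3) n"
      if "n \<le> m" for m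
    proof -
      have "fps_nth (\<Sum>j<m. T j) n = (\<Sum>j<m. f (2 * j + 5))"
        by (simp add: fps_sum_nth T_def f_def)
      also have "\<dots> = (\<Sum>i<2 * m + 5. f i) - f 3"
        using sum_odd_terms[of f m] f0 f1 by simp
      also have "(\<Sum>i<2 * m + 5. f i) = (\<Sum>i=0..n. f i)"
        by (rule sum.mono_neutral_right) (use that big in auto)
      also have "\<dots> = fps_nth (?H oo ?W) n" by (simp add: fps_compose_nth f_def)
      finally show ?thesis unfolding fps_sub_nth fps_mult_left_const_nth f_def .
    qed
    thus "eventually (\<lambda>m. fps_nth (\<Sum>j<m. T j) n = fps_nth ((?H oo ?W) - fps_const (fps_nth ?H 3) * ?W ^ 3) n)
        sequentially"
      using eventually_sequentially by blast
  qed
  hence "(\<Sum>j. T j) = (?H oo ?W) - fps_const (fps_nth ?H 3) * ?W ^ 3" by (rule sums_unique[symmetric])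
  moreover have "T = (\<lambda>j. let i = Suc j in
      fps_const (real (2 * i + 1) / real (2 * i + 3) * fps_nth \<zeta> (2 * i + 1) * sqrt (2 ^ (2 * i + 1)))
        * (fps_const (1 / sqrt 2) * ?W) ^ (2 * i + 3))"
    unfolding Let_def summand by (rule ext) (simp add: T_def add.commute)
  ultimately show ?thesis unfolding formal_sum_def root first by simp
qed

text \<open>The slope of the formal expression at \<open>h = \<zeta> y\<close> is \<open>\<kappa> + \<mu> y\<^sup>2 / 2\<close>: in the chain rule
  for \<open>y = \<zeta>\<^sup>-\<^sup>1 h\<close> the factor \<open>\<zeta>'\<close> from the primitive cancels.\<close>

lemma fps_deriv_formal_beta:
  fixes \<zeta> :: "real fps"
  assumes "fps_nth \<zeta> 1 = 1" "\<forall>k. even k \<longrightarrow> fps_nth \<zeta> k = 0"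
  shows "fps_deriv (formal_beta \<kappa> \<mu> \<zeta>) = fps_const \<kappa> + fps_const (\<mu> / 2) * (fps_inv \<zeta>)\<^sup>2"
    "fps_nth (formal_beta \<kappa> \<mu> \<zeta>) 0 = 0"
proof -
  have \<zeta>0: "fps_nth \<zeta> 0 = 0" using assms(2) by simp
  let ?W = "fps_inv \<zeta>"
  note W = formal_inverse[OF \<zeta>0 assms(1)]
  have "(fps_deriv \<zeta> oo ?W) * fps_deriv ?W = fps_deriv (\<zeta> oo ?W)"
    by (rule fps_compose_deriv[symmetric]) (rule W(1))
  hence one: "(fps_deriv \<zeta> oo ?W) * fps_deriv ?W = 1" using W(3) by simp
  have "fps_deriv (formal_sum \<zeta>) = (fps_deriv (action_series \<zeta>) oo ?W) * fps_deriv ?W"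
    unfolding formal_sum_eq_compose[OF assms] by (rule fps_compose_deriv) (rule W(1))
  also have "\<dots> = fps_const (1 / 2) * (?W\<^sup>2 * ((fps_deriv \<zeta> oo ?W) * fps_deriv ?W))"
    unfolding fps_deriv_action_series
    using W(1) by (simp add: fps_compose_mult_distrib power2_eq_square mult.assoc)
  finally have "fps_deriv (formal_sum \<zeta>) = fps_const (1 / 2) * ?W\<^sup>2" unfolding one by simp
  thus "fps_deriv (formal_beta \<kappa> \<mu> \<zeta>) = fps_const \<kappa> + fps_const (\<mu> / 2) * ?W\<^sup>2"
    unfolding formal_beta_def by (simp add: mult.assoc[symmetric])
  have "fps_nth (formal_sum \<zeta>) 0 = 0"
    unfolding formal_sum_eq_compose[OF assms] by (simp add: action_series_def)
  thus "fps_nth (formal_beta \<kappa> \<mu> \<zeta>) 0 = 0"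
    unfolding formal_beta_def by simp
qed

subsection \<open>Truncation\<close>

definition truncate :: "nat \<Rightarrow> real fps \<Rightarrow> real poly" where
  "truncate N A = (\<Sum>k\<le>N. monom (fps_nth A k) k)"

lemma poly_truncate: "poly (truncate N A) x = (\<Sum>k\<le>N. fps_nth A k * x ^ k)"
  by (simp add: truncate_def poly_sum poly_monom)

lemma coeff_truncate: "coeff (truncate N A) n = (if n \<le> N then fps_nth A n else 0)"
  by (simp add: truncate_def coeff_sum)

text \<open>Identities of formal power series are turned into estimates by this lemma: two polynomials
  that agree up to order \<open>N\<close> differ by \<open>O(x\<^bsup>N + 1\<^esup>)\<close>.\<close>

lemma poly_flat:
  fixes p :: "real poly"
  assumes "\<forall>k\<le>N. coeff p k = 0"
  shows "\<exists>C\<ge>0. \<forall>x. 0 \<le> x \<and> x \<le> 1 \<longrightarrow> \<bar>poly p x\<bar> \<le> C * x ^ Suc N"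
proof (intro exI conjI allI impI)
  show "0 \<le> (\<Sum>i\<le>degree p. \<bar>coeff p i\<bar>)" by (simp add: sum_nonneg)
  fix x :: real assume x: "0 \<le> x \<and> x \<le> 1"
  have "\<bar>poly p x\<bar> \<le> (\<Sum>i\<le>degree p. \<bar>coeff p i * x ^ i\<bar>)"
    unfolding poly_altdef by (rule sum_abs)
  also have "\<dots> \<le> (\<Sum>i\<le>degree p. \<bar>coeff p i\<bar> * x ^ Suc N)"
  proof (rule sum_mono)
    fix i
    show "\<bar>coeff p i * x ^ i\<bar> \<le> \<bar>coeff p i\<bar> * x ^ Suc N"
    proof (cases "i \<le> N")
      case False
      hence "x ^ i \<le> x ^ Suc N" using x by (intro power_decreasing) auto
      thus ?thesis using x by (simp add: abs_mult mult_left_mono del: power_Suc)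
    qed (use assms in simp)
  qed
  finally show "\<bar>poly p x\<bar> \<le> (\<Sum>i\<le>degree p. \<bar>coeff p i\<bar>) * x ^ Suc N"
    by (simp add: sum_distrib_right del: power_Suc)
qed

lemma fps_power_nth_cong:
  fixes a b :: "'a::comm_semiring_1 fps"
  assumes "\<And>k. k \<le> N \<Longrightarrow> fps_nth a k = fps_nth b k" "n \<le> N"
  shows "fps_nth (a ^ i) n = fps_nth (b ^ i) n"
  using assms(2)
proof (induction i arbitrary: n)
  case (Suc i)
  thus ?case using assms(1) by (auto simp: fps_mult_nth intro!: sum.cong)
qed simp

lemma fps_of_poly_truncate: "k \<le> N \<Longrightarrow> fps_nth (fps_of_poly (truncate N A)) k = fps_nth A k"
  by (simp add: coeff_truncate)

lemma truncate_inverse_flat: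
  fixes \<zeta> :: "real fps"
  assumes \<zeta>: "fps_nth \<zeta> 0 = 0" "fps_nth \<zeta> 1 = 1" and "k \<le> N"
  shows "coeff (pcompose (truncate N \<zeta>) (truncate N (fps_inv \<zeta>)) - [:0, 1:]) k = 0"
proof -
  let ?W = "fps_inv \<zeta>"
  note W = formal_inverse[OF \<zeta>]
  have "coeff (pcompose (truncate N \<zeta>) (truncate N ?W)) k =
      fps_nth (fps_of_poly (truncate N \<zeta>) oo fps_of_poly (truncate N ?W)) k"
    using W(1) by (simp add: fps_of_poly_pcompose[symmetric] coeff_truncate)
  also have "\<dots> = fps_nth (\<zeta> oo ?W) k"
    unfolding fps_compose_nth
  proof (intro sum.cong refl arg_cong2[of _ _ _ _ "(*)"])
    fix i assume "i \<in> {0..k}"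
    thus "fps_nth (fps_of_poly (truncate N \<zeta>)) i = fps_nth \<zeta> i"
      using assms(3) by (intro fps_of_poly_truncate) auto
    show "fps_nth (fps_of_poly (truncate N ?W) ^ i) k = fps_nth (?W ^ i) k"
      by (rule fps_power_nth_cong[OF fps_of_poly_truncate assms(3)])
  qed
  also have "\<dots> = coeff [:0, 1:] k"
    unfolding W(3) by (cases k) (auto simp: fps_X_def coeff_pCons split: nat.splits)
  finally show ?thesis by simp
qed

lemma truncate_deriv_flat:
  fixes \<zeta> :: "real fps"
  assumes "fps_nth \<zeta> 1 = 1" "\<forall>k. even k \<longrightarrow> fps_nth \<zeta> k = 0" "k \<le> N"
  shows "coeff ([:\<kappa>:] + smult (\<mu> / 2) ((truncate N (fps_inv \<zeta>))\<^sup>2)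
    - pderiv (truncate (Suc N) (formal_beta \<kappa> \<mu> \<zeta>))) k = 0"
proof -
  let ?W = "fps_inv \<zeta>"
  have "coeff (pderiv (truncate (Suc N) (formal_beta \<kappa> \<mu> \<zeta>))) k =
      fps_nth (fps_deriv (formal_beta \<kappa> \<mu> \<zeta>)) k"
    using assms(3) by (simp add: coeff_pderiv coeff_truncate)
  also have "\<dots> = fps_nth (fps_const \<kappa> + fps_const (\<mu> / 2) * ?W\<^sup>2) k"
    unfolding fps_deriv_formal_beta[OF assms(1,2)] ..
  also have "\<dots> = coeff ([:\<kappa>:]) k + \<mu> / 2 * fps_nth (?W\<^sup>2) k"
    by (cases k) auto
  also have "fps_nth (?W\<^sup>2) k = fps_nth (fps_of_poly (truncate N ?W) ^ 2) k"
    by (rule fps_power_nth_cong[OF fps_of_poly_truncate[symmetric] assms(3)])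
  also have "\<dots> = coeff ((truncate N ?W)\<^sup>2) k"
    unfolding fps_of_poly_power[symmetric] by simp
  finally show ?thesis by simp
qed

lemma asymptotic_seriesI:
  assumes "\<And>N. \<exists>C \<delta>. 0 < \<delta> \<and> (\<forall>x. 0 < x \<and> x < \<delta> \<longrightarrow> \<bar>F x - poly (truncate N A) x\<bar> \<le> C * x ^ Suc N)"
  shows "asymptotic_series F A"
  unfolding asymptotic_series_def
proof
  fix N :: nat
  obtain C \<delta> where C: "0 < \<delta>"
    "\<And>x. 0 < x \<Longrightarrow> x < \<delta> \<Longrightarrow> \<bar>F x - poly (truncate N A) x\<bar> \<le> C * x ^ Suc N"
    using assms[of N] by blast
  have "eventually (\<lambda>x. 0 < x \<and> x < \<delta>) (at_right 0)"
    using C(1) by (auto simp: eventually_at_right_field intro!: exI[of _ \<delta>])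
  hence "eventually (\<lambda>x. norm (F x - (\<Sum>k\<le>N. fps_nth A k * x ^ k)) \<le> C * norm (x ^ Suc N)) (at_right 0)"
  proof (rule eventually_mono)
    fix x assume "0 < x \<and> x < \<delta>"
    thus "norm (F x - (\<Sum>k\<le>N. fps_nth A k * x ^ k)) \<le> C * norm (x ^ Suc N)"
      using C(2)[of x] by (simp add: poly_truncate)
  qed
  thus "(\<lambda>x. F x - (\<Sum>k\<le>N. fps_nth A k * x ^ k)) \<in> O[at_right 0](\<lambda>x. x ^ Suc N)"
    by (rule bigoI)
qed

lemma asymptotic_series_unique:
  assumes "asymptotic_series F A" "asymptotic_series F B"
  shows "A = B"
proof (rule ccontr)
  assume "A \<noteq> B"
  hence "A - B \<noteq> 0" by simp
  define n where "n = subdegree (A - B)"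
  define d where "d = fps_nth (A - B) n"
  have d: "d \<noteq> 0" using \<open>A - B \<noteq> 0\<close> nth_subdegree_nonzero[of "A - B"] by (simp add: d_def n_def)
  have low: "fps_nth A k = fps_nth B k" if "k < n" for k
    using nth_less_subdegree_zero[of k "A - B"] that by (simp add: n_def)
  have "(\<lambda>x. F x - (\<Sum>k\<le>n. fps_nth A k * x ^ k)) \<in> O[at_right 0](\<lambda>x. x ^ Suc n)"
    "(\<lambda>x. F x - (\<Sum>k\<le>n. fps_nth B k * x ^ k)) \<in> O[at_right 0](\<lambda>x. x ^ Suc n)"
    using assms unfolding asymptotic_series_def by blast+
  from sum_in_bigo(2)[OF this(2,1)]
  have "(\<lambda>x. (F x - (\<Sum>k\<le>n. fps_nth B k * x ^ k)) - (F x - (\<Sum>k\<le>n. fps_nth A k * x ^ k)))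
      \<in> O[at_right 0](\<lambda>x. x ^ Suc n)" .
  moreover have "(F x - (\<Sum>k\<le>n. fps_nth B k * x ^ k)) - (F x - (\<Sum>k\<le>n. fps_nth A k * x ^ k)) = d * x ^ n" for x
  proof -
    have "(\<Sum>k\<le>n. fps_nth A k * x ^ k) - (\<Sum>k\<le>n. fps_nth B k * x ^ k) =
        (\<Sum>k\<le>n. (fps_nth A k - fps_nth B k) * x ^ k)"
      by (simp add: sum_subtractf left_diff_distrib)
    also have "\<dots> = (\<Sum>k\<in>{n}. (fps_nth A k - fps_nth B k) * x ^ k)"
      by (rule sum.mono_neutral_right) (use low in \<open>auto simp: le_less\<close>)
    finally show ?thesis by (simp add: d_def)
  qed
  ultimately have "(\<lambda>x. d * x ^ n) \<in> O[at_right 0](\<lambda>x. x ^ Suc n)" by simp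
  then obtain c where c: "c > 0" "eventually (\<lambda>x. norm (d * x ^ n) \<le> c * norm (x ^ Suc n)) (at_right 0)"
    by (elim landau_o.bigE)
  then obtain b :: real where b: "0 < b" "\<And>x. 0 < x \<Longrightarrow> x < b \<Longrightarrow> norm (d * x ^ n) \<le> c * norm (x ^ Suc n)"
    by (auto simp: eventually_at_right_field)
  define x where "x = min (b / 2) (\<bar>d\<bar> / (2 * c))"
  have x: "0 < x" "x < b" "x \<le> \<bar>d\<bar> / (2 * c)" using b c d by (auto simp: x_def min_def)
  have "\<bar>d\<bar> * x ^ n \<le> c * x * x ^ n" using b(2)[OF x(1,2)] x(1) by (simp add: abs_mult)
  hence "\<bar>d\<bar> \<le> c * x" using x(1) by simp
  also have "\<dots> \<le> c * (\<bar>d\<bar> / (2 * c))" using x c by (intro mult_left_mono) auto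
  also have "\<dots> = \<bar>d\<bar> / 2" using c by simp
  finally show False using d by simp
qed

section \<open>The expansion of the beta function\<close>

text \<open>An approximate supporting slope at every point determines the function: summing along
  \<open>n\<close> equal steps from \<open>h / n\<close> to \<open>h\<close>, the quadratic errors add up to \<open>O(1 / n)\<close> and the errors
  of the slopes to \<open>n * O(h ^ N)\<close>. About \<open>h\<^bsup>-M\<^esup>\<close> steps balance the two.\<close>

lemma expansion_from_slopes:
  fixes b :: "real \<Rightarrow> real" and P :: "real poly" and g :: "real \<Rightarrow> real"
  assumes \<delta>: "0 < \<delta>" "\<delta> \<le> 1"
    and support: "\<And>w x. w \<in> \<rat> \<Longrightarrow> x \<in> \<rat> \<Longrightarrow> 0 < w \<Longrightarrow> w < \<delta> \<Longrightarrow> 0 < x \<Longrightarrow> x \<le> 1 \<Longrightarrow>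
      b w + g w * (x - w) - C1 * w ^ (2 * M + 1) \<le> b x"
    and C: "0 \<le> C1" "0 \<le> C2"
    and slope: "\<And>w. 0 < w \<Longrightarrow> w < \<delta> \<Longrightarrow> \<bar>g w - poly (pderiv P) w\<bar> \<le> C2 * w ^ (2 * M + 1)"
    and P0: "poly P 0 = 0"
    and small: "\<And>x. x \<in> \<rat> \<Longrightarrow> 0 < x \<Longrightarrow> x \<le> 1 \<Longrightarrow> \<bar>b x\<bar> \<le> x"
  shows "\<exists>C. \<forall>x. x \<in> \<rat> \<and> 0 < x \<and> x < \<delta> \<longrightarrow> \<bar>b x - poly P x\<bar> \<le> C * x ^ Suc M"
proof -
  have bnd: "\<exists>B\<ge>0. \<forall>x\<in>{0..1}. \<bar>poly p x\<bar> \<le> B" for p :: "real poly"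
  proof -
    have "compact (poly p ` {0..1})"
      by (intro compact_continuous_image continuous_intros) auto
    hence "bounded (poly p ` {0..1})" by (rule compact_imp_bounded)
    then obtain B where "\<forall>x\<in>{0..1}. \<bar>poly p x\<bar> \<le> B" unfolding bounded_iff by auto
    thus ?thesis by (intro exI[of _ "max B 0"]) auto
  qed
  obtain L where L: "0 \<le> L" "\<And>x. x \<in> {0..1} \<Longrightarrow> \<bar>poly (pderiv P) x\<bar> \<le> L" using bnd[of "pderiv P"] by blast
  obtain Q where Q: "0 \<le> Q" "\<And>x. x \<in> {0..1} \<Longrightarrow> \<bar>poly (pderiv (pderiv P)) x\<bar> \<le> Q"
    using bnd[of "pderiv (pderiv P)"] by blast
  have lip: "\<bar>poly p x - poly p w\<bar> \<le> B * \<bar>x - w\<bar>"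
    if "\<And>x. x \<in> {0..1} \<Longrightarrow> \<bar>poly (pderiv p) x\<bar> \<le> B" "x \<in> {0..1}" "w \<in> {0..1}"
    for p :: "real poly" and B x w
    using field_differentiable_bound[of "{0..1}" "poly p" "poly (pderiv p)" B x w] that
    by (auto simp: real_norm_def intro: DERIV_subset[OF poly_DERIV])
  have taylor: "\<bar>poly P x - poly P w - poly (pderiv P) w * (x - w)\<bar> \<le> Q * \<bar>x - w\<bar> * \<bar>x - w\<bar>"
    if x: "x \<in> {0..1}" and w: "w \<in> {0..1}" for x w
  proof -
    define I where "I = {min x w..max x w}"
    have I: "I \<subseteq> {0..1}" "x \<in> I" "w \<in> I" "\<And>t. t \<in> I \<Longrightarrow> \<bar>t - w\<bar> \<le> \<bar>x - w\<bar>"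
      using x w by (auto simp: I_def)
    have "norm ((poly P x - poly (pderiv P) w * x) - (poly P w - poly (pderiv P) w * w))
        \<le> (Q * \<bar>x - w\<bar>) * norm (x - w)"
    proof (rule field_differentiable_bound[where S = I and f' = "\<lambda>t. poly (pderiv P) t - poly (pderiv P) w"])
      fix t assume t: "t \<in> I"
      have "((\<lambda>t. poly P t - poly (pderiv P) w * t) has_real_derivative
          poly (pderiv P) t - poly (pderiv P) w) (at t)"
        by (auto intro!: derivative_eq_intros)
      thus "((\<lambda>t. poly P t - poly (pderiv P) w * t) has_real_derivative
          poly (pderiv P) t - poly (pderiv P) w) (at t within I)"
        by (rule has_field_derivative_at_within)
      have "\<bar>poly (pderiv P) t - poly (pderiv P) w\<bar> \<le> Q * \<bar>t - w\<bar>"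
        using lip[of "pderiv P" Q t w] Q t I w by blast
      also have "\<dots> \<le> Q * \<bar>x - w\<bar>" using I(4)[OF t] Q by (intro mult_left_mono) auto
      finally show "norm (poly (pderiv P) t - poly (pderiv P) w) \<le> Q * \<bar>x - w\<bar>" by simp
    qed (use I in \<open>auto simp: I_def\<close>)
    thus ?thesis by (simp add: algebra_simps)
  qed
  define E where "E x = b x - poly P x" for x
  define K where "K = C1 + C2"
  \<comment> \<open>The bound is stated for points below a common \<open>r\<close>, so that \<open>w\<close> and \<open>x\<close> can be exchanged in it.\<close>
  have onesided: "E w - E x \<le> K * r ^ (2 * M + 1) + Q * \<bar>x - w\<bar> * \<bar>x - w\<bar>"
    if "w \<in> \<rat>" "x \<in> \<rat>" "0 < w" "w \<le> r" "0 < x" "x \<le> r" "r < \<delta>" for w x r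
  proof -
    have wx: "w < \<delta>" "x \<le> 1" "w \<in> {0..1}" "x \<in> {0..1}" "\<bar>x - w\<bar> \<le> 1" using that \<delta> by auto
    have pw: "w ^ (2 * M + 1) \<le> r ^ (2 * M + 1)" using that by (intro power_mono) auto
    have pw0: "0 \<le> w ^ (2 * M + 1)" using that by (intro zero_le_power) auto
    have "b w + g w * (x - w) - C1 * w ^ (2 * M + 1) \<le> b x"
      using support that wx by simp
    moreover have "\<bar>(g w - poly (pderiv P) w) * (x - w)\<bar> \<le> C2 * w ^ (2 * M + 1)"
    proof -
      have "\<bar>g w - poly (pderiv P) w\<bar> * \<bar>x - w\<bar> \<le> C2 * w ^ (2 * M + 1) * 1"
        using slope[OF that(3) wx(1)] wx(5) C pw0 by (intro mult_mono) auto
      thus ?thesis by (simp add: abs_mult)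
    qed
    moreover have "g w * (x - w) = (g w - poly (pderiv P) w) * (x - w) + poly (pderiv P) w * (x - w)"
      by (simp add: algebra_simps)
    moreover note taylor[OF wx(4,3)]
    moreover have "K * w ^ (2 * M + 1) \<le> K * r ^ (2 * M + 1)"
      using pw C unfolding K_def by (intro mult_left_mono) auto
    moreover have "K * w ^ (2 * M + 1) = C1 * w ^ (2 * M + 1) + C2 * w ^ (2 * M + 1)"
      by (simp only: K_def distrib_right)
    ultimately show ?thesis unfolding E_def by linarith
  qed
  define C where "C = 1 + L + 2 * K + Q"
  have "\<bar>E x\<bar> \<le> C * x ^ Suc M" if x: "x \<in> \<rat>" "0 < x" "x < \<delta>" for x
  proof -
    define n where "n = nat \<lceil>1 / x ^ M\<rceil>"
    have xM: "0 < x ^ M" "x ^ M \<le> 1" using x \<delta> by (auto intro!: power_le_one)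
    have "1 \<le> 1 / x ^ M" using xM by simp
    hence n: "1 / x ^ M \<le> real n" "real n \<le> 1 / x ^ M + 1" "1 \<le> n"
      unfolding n_def by linarith+
    hence n2: "real n \<le> 2 / x ^ M" using \<open>1 \<le> 1 / x ^ M\<close> by simp
    have ninv: "1 / real n \<le> x ^ M"
      using n xM by (simp add: field_simps)
    define t where "t k = real k * x / real n" for k
    have t: "t k \<in> \<rat>" "0 < k \<Longrightarrow> 0 < t k" "k \<le> n \<Longrightarrow> t k \<le> x" "t (Suc k) - t k = x / real n" for k
      using x n by (auto simp: t_def field_simps)
    have step: "\<bar>E (t (Suc k)) - E (t k)\<bar> \<le> K * x ^ (2 * M + 1) + Q * (x / real n) * (x / real n)"
      if k: "1 \<le> k" "k < n" for k
    proof -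
      have "0 \<le> x / real n" using x by simp
      hence "\<bar>t (Suc k) - t k\<bar> = x / real n" "\<bar>t k - t (Suc k)\<bar> = x / real n"
        using t(4)[of k] by linarith+
      thus ?thesis
        using onesided[of "t k" "t (Suc k)" x] onesided[of "t (Suc k)" "t k" x] t k x by force
    qed
    define c where "c = K * x ^ (2 * M + 1) + Q * (x / real n) * (x / real n)"
    have "\<bar>E (t (Suc k)) - E (t 1)\<bar> \<le> real k * c" if "k < n" for k
      using that
    proof (induction k)
      case (Suc k)
      have "real (Suc k) * c = real k * c + c" by (simp add: algebra_simps)
      thus ?case using Suc step[of "Suc k", folded c_def] by simp
    qed simp
    from this[of "n - 1"] have "\<bar>E x - E (x / real n)\<bar> \<le>
        real (n - 1) * (K * x ^ (2 * M + 1) + Q * (x / real n) * (x / real n))"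
      using n by (simp add: t_def c_def)
    also have "\<dots> \<le> real n * (K * x ^ (2 * M + 1) + Q * (x / real n) * (x / real n))"
      using C Q x unfolding K_def by (intro mult_right_mono add_nonneg_nonneg mult_nonneg_nonneg) auto
    also have "\<dots> = real n * (K * x ^ (2 * M + 1)) + Q * x * x * (1 / real n)"
      using n by (simp add: field_simps)
    also have "\<dots> \<le> 2 / x ^ M * (K * x ^ (2 * M + 1)) + Q * x * x * x ^ M"
      using n2 ninv C Q x unfolding K_def by (intro add_mono mult_right_mono mult_left_mono) auto
    also have "2 / x ^ M * (K * x ^ (2 * M + 1)) = 2 * K * x ^ Suc M"
    proof -
      have "x ^ (2 * M + 1) = x ^ M * x ^ Suc M" by (simp add: mult_2 power_add)
      hence "2 / x ^ M * (K * x ^ (2 * M + 1)) = 2 * K * x ^ Suc M * (x ^ M / x ^ M)"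
        by (simp only:) simp
      thus ?thesis using xM by simp
    qed
    also have "Q * x * x * x ^ M \<le> Q * x ^ Suc M"
      using mult_left_le_one_le[of "Q * x ^ Suc M" x] Q x \<delta> by (simp add: mult_ac)
    finally have A: "\<bar>E x - E (x / real n)\<bar> \<le> 2 * K * x ^ Suc M + Q * x ^ Suc M" by simp
    define u where "u = x / real n"
    have "u \<le> x" using x n by (simp add: u_def divide_le_eq)
    hence u: "u \<in> \<rat>" "0 < u" "u \<le> 1" using x n \<delta> by (auto simp: u_def)
    have "\<bar>poly P u - poly P 0\<bar> \<le> L * \<bar>u - 0\<bar>"
      using lip[of P L u 0] L u by auto
    hence "\<bar>poly P u\<bar> \<le> L * u" using P0 u by simp
    hence "\<bar>E u\<bar> \<le> u + L * u" using small[OF u] unfolding E_def by linarith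
    also have "\<dots> = (1 + L) * u" by (simp add: algebra_simps)
    also have "\<dots> \<le> (1 + L) * x ^ Suc M"
      using mult_left_mono[OF ninv, of x] x L by (intro mult_left_mono) (auto simp: u_def)
    finally have "\<bar>E u\<bar> \<le> (1 + L) * x ^ Suc M" .
    moreover have "\<bar>E x - E u\<bar> \<le> (2 * K + Q) * x ^ Suc M"
      using A unfolding u_def distrib_right .
    moreover have "C * x ^ Suc M = (1 + L) * x ^ Suc M + (2 * K + Q) * x ^ Suc M"
      by (simp add: C_def algebra_simps)
    ultimately show ?thesis by linarith
  qed
  thus ?thesis unfolding E_def by blast
qed

text \<open>For the expansion to order \<open>M\<close> the normal form is used to order \<open>N = 2 * M + 1\<close>, since the
  summation along about \<open>h\<^bsup>-M\<^esup>\<close> steps loses \<open>M\<close> orders.\<close>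

lemma (in boundary_chart) beta_asymptotic_series:
  assumes \<zeta>: "fps_nth \<zeta> 1 = 1" "\<forall>k. even k \<longrightarrow> fps_nth \<zeta> k = 0"
    and normal_form: "\<And>N. \<exists>C. \<exists>\<delta>>0. \<forall>x. \<forall>y\<in>{0..<\<delta>}. \<exists>z'\<in>UNIV \<times> {0..<\<epsilon>}.
      \<Phi> z' = billiard_map \<xi> (\<Phi> (x, y)) \<and>
      norm (z' - (x + (\<Sum>k\<le>N. fps_nth \<zeta> k * y ^ k), y)) \<le> C * y ^ Suc N"
  shows "asymptotic_series (beta \<xi>) (formal_beta \<kappa> \<mu> \<zeta>)"
proof (rule asymptotic_seriesI)
  fix M :: nat
  define N where "N = 2 * M + 1"
  define B where "B = formal_beta \<kappa> \<mu> \<zeta>"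
  define w where "w = truncate N (fps_inv \<zeta>)"
  define P where "P = truncate (Suc N) B"
  have \<zeta>0: "fps_nth \<zeta> 0 = 0" using \<zeta>(2) by simp
  note W = formal_inverse[OF \<zeta>0 \<zeta>(1)]
  obtain C1 \<delta>1 where nf: "0 < \<delta>1" "\<forall>x. \<forall>y\<in>{0..<\<delta>1}. \<exists>z'\<in>UNIV \<times> {0..<\<epsilon>}.
      \<Phi> z' = billiard_map \<xi> (\<Phi> (x, y)) \<and>
      norm (z' - (x + (\<Sum>k\<le>N. fps_nth \<zeta> k * y ^ k), y)) \<le> C1 * y ^ Suc N"
    using normal_form[of N] by blast
  have "\<forall>k\<le>N. coeff (pcompose (truncate N \<zeta>) w - [:0, 1:]) k = 0"
    unfolding w_def using truncate_inverse_flat[OF \<zeta>0 \<zeta>(1)] by blast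
  from poly_flat[OF this] obtain C2 where C2: "0 \<le> C2" "\<And>x. 0 \<le> x \<Longrightarrow> x \<le> 1 \<Longrightarrow>
      \<bar>poly (pcompose (truncate N \<zeta>) w - [:0, 1:]) x\<bar> \<le> C2 * x ^ Suc N"
    by blast
  have "\<forall>k\<le>1. coeff (w - [:0, 1:]) k = 0"
  proof (intro allI impI)
    fix k :: nat assume "k \<le> 1"
    hence "k = 0 \<or> k = 1" by auto
    thus "coeff (w - [:0, 1:]) k = 0" using W by (auto simp: w_def coeff_truncate N_def)
  qed
  from poly_flat[OF this] obtain C3 where
    C3: "0 \<le> C3" "\<And>x. 0 \<le> x \<Longrightarrow> x \<le> 1 \<Longrightarrow> \<bar>poly (w - [:0, 1:]) x\<bar> \<le> C3 * x ^ Suc 1"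
    by blast
  define \<delta>2 where "\<delta>2 = min 1 (1 / (2 * (C3 + 1)))"
  have \<delta>2: "0 < \<delta>2" unfolding \<delta>2_def using C3(1) by simp
  have \<delta>2_le: "\<delta>2 \<le> 1" "\<delta>2 \<le> 1 / (2 * (C3 + 1))" by (simp_all add: \<delta>2_def)
  have w_bounds: "0 < poly w x \<and> poly w x \<le> 2 * x \<and>
      \<bar>(\<Sum>k\<le>N. fps_nth \<zeta> k * poly w x ^ k) - x\<bar> \<le> C2 * x ^ Suc N" if x: "0 < x" "x < \<delta>2" for x
  proof -
    have "C3 * x \<le> (C3 + 1) * x" using x by simp
    also have "\<dots> < (C3 + 1) * (1 / (2 * (C3 + 1)))"
    proof (rule mult_strict_left_mono)
      show "x < 1 / (2 * (C3 + 1))" using x(2) \<delta>2_le(2) by linarith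
    qed (use C3(1) in linarith)
    also have "\<dots> = 1 / 2" using C3(1) by simp
    finally have "C3 * x * x < 1 / 2 * x" using x(1) by (rule mult_strict_right_mono)
    moreover have "\<bar>poly w x - x\<bar> \<le> C3 * x * x"
    proof -
      have "x \<le> 1" using x(2) \<delta>2_le(1) by linarith
      thus ?thesis using C3(2)[of x] x(1) by (simp add: mult_ac)
    qed
    ultimately have "0 < poly w x \<and> poly w x \<le> 2 * x" using x by linarith
    moreover have "\<bar>(\<Sum>k\<le>N. fps_nth \<zeta> k * poly w x ^ k) - x\<bar> \<le> C2 * x ^ Suc N"
    proof -
      have "x \<le> 1" using x(2) \<delta>2_le(1) by linarith
      thus ?thesis using C2(2)[of x] x(1) by (simp add: poly_pcompose poly_truncate del: power_Suc)
    qed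
    ultimately show ?thesis by blast
  qed
  obtain C \<delta> where \<delta>: "0 < \<delta>" "\<delta> \<le> 1" "0 \<le> C"
    and support: "\<And>t x. t \<in> \<rat> \<Longrightarrow> x \<in> \<rat> \<Longrightarrow> 0 < t \<Longrightarrow> t < \<delta> \<Longrightarrow> 0 < x \<Longrightarrow> x \<le> 1 \<Longrightarrow>
      beta \<xi> t + (\<kappa> + \<mu> * (poly w t)\<^sup>2 / 2) * (x - t) - C * t ^ N \<le> beta \<xi> x"
  proof (rule beta_support[where \<rho> = \<delta>1 and N = N and \<zeta> = \<zeta> and A = C1 and \<sigma> = \<delta>2 and W = "poly w" and B = C2])
    show "\<exists>z'\<in>UNIV \<times> {0..<\<epsilon>}. \<Phi> z' = billiard_map \<xi> (\<Phi> (x, y)) \<and>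
      norm (z' - (x + (\<Sum>k\<le>N. fps_nth \<zeta> k * y ^ k), y)) \<le> C1 * y ^ Suc N" if "0 \<le> y" "y < \<delta>1" for x y
      using nf(2) that by simp
  qed (use nf(1) \<delta>2(1) w_bounds in blast)+
  have "\<forall>k\<le>N. coeff ([:\<kappa>:] + smult (\<mu> / 2) (w\<^sup>2) - pderiv P) k = 0"
    unfolding w_def P_def B_def using truncate_deriv_flat[OF \<zeta>] by blast
  from poly_flat[OF this] obtain C4 where C4: "0 \<le> C4" "\<And>x. 0 \<le> x \<Longrightarrow> x \<le> 1 \<Longrightarrow>
      \<bar>poly ([:\<kappa>:] + smult (\<mu> / 2) (w\<^sup>2) - pderiv P) x\<bar> \<le> C4 * x ^ Suc N"
    by blast
  have "\<exists>C. \<forall>x. x \<in> \<rat> \<and> 0 < x \<and> x < \<delta> \<longrightarrow> \<bar>beta \<xi> x - poly P x\<bar> \<le> C * x ^ Suc M"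
  proof (rule expansion_from_slopes[of \<delta> "beta \<xi>" "\<lambda>t. \<kappa> + \<mu> * (poly w t)\<^sup>2 / 2" C M C4 P, OF \<delta>(1,2)])
    show "beta \<xi> t + (\<kappa> + \<mu> * (poly w t)\<^sup>2 / 2) * (x - t) - C * t ^ (2 * M + 1) \<le> beta \<xi> x"
      if "t \<in> \<rat>" "x \<in> \<rat>" "0 < t" "t < \<delta>" "0 < x" "x \<le> 1" for t x
      using support[OF that] by (simp only: N_def)
    show "\<bar>\<kappa> + \<mu> * (poly w t)\<^sup>2 / 2 - poly (pderiv P) t\<bar> \<le> C4 * t ^ (2 * M + 1)" if t: "0 < t" "t < \<delta>" for t
    proof -
      have "\<bar>\<kappa> + \<mu> * (poly w t)\<^sup>2 / 2 - poly (pderiv P) t\<bar> \<le> C4 * t ^ Suc N"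
        using C4(2)[of t] t \<delta> by simp
      also have "\<dots> \<le> C4 * t ^ (2 * M + 1)"
        using t \<delta> C4(1) by (intro mult_left_mono power_decreasing) (auto simp: N_def)
      finally show ?thesis .
    qed
    show "poly P 0 = 0"
      using fps_deriv_formal_beta(2)[OF \<zeta>] by (simp add: P_def B_def poly_0_coeff_0 coeff_truncate)
    show "\<bar>beta \<xi> x\<bar> \<le> x" if "x \<in> \<rat>" "0 < x" "x \<le> 1" for x
      using beta_bounds[OF that] by simp
  qed (use \<delta>(3) C4(1) in auto)
  then obtain C5 where C5: "\<And>x. x \<in> \<rat> \<Longrightarrow> 0 < x \<Longrightarrow> x < \<delta> \<Longrightarrow> \<bar>beta \<xi> x - poly P x\<bar> \<le> C5 * x ^ Suc M"
    by blast
  have "\<forall>k\<le>M. coeff (P - truncate M B) k = 0"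
    by (simp add: P_def coeff_truncate N_def)
  from poly_flat[OF this] obtain C6
    where C6: "\<And>x. 0 \<le> x \<Longrightarrow> x \<le> 1 \<Longrightarrow> \<bar>poly (P - truncate M B) x\<bar> \<le> C6 * x ^ Suc M"
    by blast
  let ?T = "truncate M B"
  have rational: "\<bar>beta \<xi> x - poly ?T x\<bar> \<le> (C5 + C6) * x ^ Suc M" if x: "x \<in> \<rat>" "0 < x" "x < \<delta>" for x
    using C5[OF x] C6[of x] x \<delta> unfolding distrib_right by simp
  have "\<bar>beta \<xi> x - poly ?T x\<bar> \<le> (C5 + C6) * x ^ Suc M" if x: "0 < x" "x < min \<delta> (1 / 2)" for x
  proof (cases "x \<in> \<rat>")
    case True
    thus ?thesis using rational x by simp
  next
    case False
    let ?F = "at x within \<rat> \<inter> {0<..1/2}"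
    have lim: "(beta \<xi> \<longlongrightarrow> beta \<xi> x) ?F" using beta_irrational_limit[OF False] x by simp
    have id: "((\<lambda>t. t) \<longlongrightarrow> x) ?F" by (rule tendsto_ident_at)
    have "((\<lambda>t. \<bar>beta \<xi> t - poly ?T t\<bar>) \<longlongrightarrow> \<bar>beta \<xi> x - poly ?T x\<bar>) ?F"
      by (intro tendsto_rabs tendsto_diff lim tendsto_poly id)
    moreover have "((\<lambda>t. (C5 + C6) * t ^ Suc M) \<longlongrightarrow> (C5 + C6) * x ^ Suc M) ?F"
      by (intro tendsto_mult tendsto_const tendsto_power id)
    moreover have "eventually (\<lambda>t. \<bar>beta \<xi> t - poly ?T t\<bar> \<le> (C5 + C6) * t ^ Suc M) ?F"
    proof -
      have "eventually (\<lambda>t. t < \<delta>) ?F" using order_tendstoD(2)[OF id] x by simp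
      moreover have "eventually (\<lambda>t. t \<in> \<rat> \<and> 0 < t) ?F" by (simp add: eventually_at_filter)
      ultimately show ?thesis by eventually_elim (use rational in blast)
    qed
    ultimately show ?thesis
      using irrational_trivial_limit[of x] x by (intro tendsto_le) auto
  qed
  thus "\<exists>C \<delta>. 0 < \<delta> \<and> (\<forall>x. 0 < x \<and> x < \<delta> \<longrightarrow>
      \<bar>beta \<xi> x - poly (truncate M (formal_beta \<kappa> \<mu> \<zeta>)) x\<bar> \<le> C * x ^ Suc M)"
    using \<delta>(1) unfolding B_def by (intro exI[of _ "C5 + C6"] exI[of _ "min \<delta> (1 / 2)"]) auto
qed

section \<open>Exact symplectic changes of coordinates\<close>

lemma smooth_on_has_derivative:
  assumes "smooth_on f S" "z \<in> S"
  shows "(f has_derivative frechet_derivative f (at z)) (at z)"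
proof -
  obtain U where "S \<subseteq> U" "Ck_on (Suc 0) f U" using assms(1) unfolding smooth_on_def by blast
  hence "f differentiable (at z)" using assms(2) by auto
  thus ?thesis using frechet_derivative_works by blast
qed

lemma smooth_on_continuous_derivative:
  assumes "smooth_on f S"
  shows "continuous_on S (\<lambda>z. frechet_derivative f (at z) w)"
proof -
  obtain U where "S \<subseteq> U" "Ck_on (Suc 0) f U" using assms unfolding smooth_on_def by blast
  hence "continuous_on U (\<lambda>z. frechet_derivative f (at z) w)" by simp
  thus ?thesis using \<open>S \<subseteq> U\<close> continuous_on_subset by blast
qed

lemma smooth_on_imp_continuous_on: "smooth_on f S \<Longrightarrow> continuous_on S f"
  by (intro continuous_at_imp_continuous_on ballI has_derivative_continuous[OF smooth_on_has_derivative])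

lemma annulus_chart_D:
  assumes "annulus_chart S \<Psi>"
  shows "smooth_on \<Psi> S" "inj_on \<Psi> S" "\<Psi> ` S \<subseteq> annulus"
    "z \<in> S \<Longrightarrow> bij (frechet_derivative \<Psi> (at z))"
    "z \<in> S \<Longrightarrow> \<Psi> (z + (1, 0)) = \<Psi> z + (1, 0)" "snd (\<Psi> (x, 0)) = 0"
  using assms unfolding annulus_chart_def by blast+

text \<open>The two one-forms differ by the differential of a function on the annulus, so they have the
  same integral over a loop.\<close>

lemma exact_symplectic_loop:
  assumes ex: "exact_symplectic S \<Psi> \<theta> \<theta>'"
    and \<gamma>: "\<And>x. (\<gamma> has_derivative (\<lambda>t. t *\<^sub>R \<gamma>' x)) (at x)" "\<And>x::real. \<gamma> x \<in> S" "\<gamma> 1 = \<gamma> 0 + (1, 0)"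
    and I: "((\<lambda>x. \<theta>' (\<gamma> x) (\<gamma>' x)) has_integral I) {0..1}"
  shows "((\<lambda>x. \<theta> (\<Psi> (\<gamma> x)) (frechet_derivative \<Psi> (at (\<gamma> x)) (\<gamma>' x))) has_integral I) {0..1}"
proof -
  obtain g :: "real \<times> real \<Rightarrow> real" where g: "smooth_on g S" "\<And>z. z \<in> S \<Longrightarrow> g (z + (1, 0)) = g z"
    "\<And>z w. z \<in> S \<Longrightarrow> frechet_derivative g (at z) w =
      \<theta>' z w - \<theta> (\<Psi> z) (frechet_derivative \<Psi> (at z) w)"
    using ex unfolding exact_symplectic_def by blast
  have "((\<lambda>x. \<theta>' (\<gamma> x) (\<gamma>' x) - \<theta> (\<Psi> (\<gamma> x)) (frechet_derivative \<Psi> (at (\<gamma> x)) (\<gamma>' x)))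
      has_integral (g (\<gamma> 1) - g (\<gamma> 0))) {0..1}"
  proof (rule fundamental_theorem_of_calculus)
    fix x :: real
    let ?d = "frechet_derivative g (at (\<gamma> x))"
    have dg: "(g has_derivative ?d) (at (\<gamma> x))" by (rule smooth_on_has_derivative[OF g(1) \<gamma>(2)])
    have "((\<lambda>x. g (\<gamma> x)) has_derivative (\<lambda>t. ?d (t *\<^sub>R \<gamma>' x))) (at x)"
      by (rule has_derivative_compose[OF \<gamma>(1) dg])
    moreover have "?d (t *\<^sub>R \<gamma>' x) = t *\<^sub>R ?d (\<gamma>' x)" for t
      by (rule linear_scale[OF has_derivative_linear[OF dg]])
    ultimately have "((\<lambda>x. g (\<gamma> x)) has_vector_derivative ?d (\<gamma>' x)) (at x)"
      by (simp add: has_vector_derivative_def)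
    thus "((\<lambda>x. g (\<gamma> x)) has_vector_derivative
        \<theta>' (\<gamma> x) (\<gamma>' x) - \<theta> (\<Psi> (\<gamma> x)) (frechet_derivative \<Psi> (at (\<gamma> x)) (\<gamma>' x))) (at x within {0..1})"
      unfolding g(3)[OF \<gamma>(2)] by (rule has_vector_derivative_at_within)
  qed simp
  moreover have "g (\<gamma> 1) = g (\<gamma> 0)" unfolding \<gamma>(3) by (rule g(2)[OF \<gamma>(2)])
  ultimately have "((\<lambda>x. \<theta>' (\<gamma> x) (\<gamma>' x) - \<theta> (\<Psi> (\<gamma> x)) (frechet_derivative \<Psi> (at (\<gamma> x)) (\<gamma>' x)))
      has_integral 0) {0..1}" by simp
  from has_integral_diff[OF I this] show ?thesis by simp
qed

lemma normal_form_chart_line: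
  assumes ex: "exact_symplectic (UNIV \<times> {0..<\<epsilon>}) \<Phi> \<theta> (normal_form_one_form \<kappa> \<mu>)"
    and y: "0 \<le> y" "y < \<epsilon>"
  shows "((\<lambda>x. \<theta> (\<Phi> (x, y)) (frechet_derivative \<Phi> (at (x, y)) (1, 0))) has_integral
    (\<kappa> + \<mu> * y\<^sup>2 / 2)) {0..1}"
proof (rule exact_symplectic_loop[OF ex, where \<gamma> = "\<lambda>x. (x, y)" and \<gamma>' = "\<lambda>_. (1, 0)"])
  show "((\<lambda>x. (x, y)) has_derivative (\<lambda>t. t *\<^sub>R (1, 0))) (at x)" for x
    by (auto intro!: derivative_eq_intros)
  have "((\<lambda>x::real. \<kappa> + \<mu> * y\<^sup>2 / 2) has_integral (\<kappa> + \<mu> * y\<^sup>2 / 2)) {0..1}"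
    using has_integral_const_real[of "\<kappa> + \<mu> * y\<^sup>2 / 2" 0 1] by simp
  thus "((\<lambda>x. normal_form_one_form \<kappa> \<mu> (x, y) (1, 0)) has_integral (\<kappa> + \<mu> * y\<^sup>2 / 2)) {0..1}"
    by (simp add: normal_form_one_form_def)
qed (use y in auto)

lemma (in billiard) boundary_chart_normal_form:
  assumes ex: "exact_symplectic (UNIV \<times> {0..<\<epsilon>}) \<Phi> billiard_form (normal_form_one_form \<kappa> \<mu>)"
    and \<epsilon>: "0 < \<epsilon>"
  shows "boundary_chart \<Omega> \<xi> \<Phi> (\<lambda>z. frechet_derivative \<Phi> (at z)) \<epsilon> \<kappa> \<mu>"
proof -
  let ?S = "UNIV \<times> {0..<\<epsilon>} :: (real \<times> real) set"
  have "annulus_chart ?S \<Phi>" using ex unfolding exact_symplectic_def by blast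
  note c = annulus_chart_D[OF this]
  have S: "(x, y) \<in> ?S" if "0 \<le> y" "y < \<epsilon>" for x y using that by simp
  show ?thesis
  proof unfold_locales
    show "continuous_on ?S (\<lambda>z. frechet_derivative \<Phi> (at z) w)" for w
      by (rule smooth_on_continuous_derivative[OF c(1)])
    show "bij (frechet_derivative \<Phi> (at (x, 0)))" for x by (rule c(4)) (use \<epsilon> in simp)
    fix x y :: real assume y: "0 \<le> y" "y < \<epsilon>"
    show "(\<Phi> has_derivative frechet_derivative \<Phi> (at (x, y))) (at (x, y))"
      by (rule smooth_on_has_derivative[OF c(1) S[OF y]])
    have "\<Phi> (x, y) \<in> annulus" using c(3) S[OF y] by blast
    thus "0 \<le> snd (\<Phi> (x, y))" by (auto simp: annulus_def)
    show "\<Phi> (x + 1, y) = \<Phi> (x, y) + (1, 0)" using c(5)[OF S[OF y]] by simp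
  next
    fix y assume y: "0 \<le> y" "y < \<epsilon>"
    have "billiard_form (\<Phi> (x, y)) w = - cos (snd (\<Phi> (x, y))) * fst w" for x w
      by (simp add: billiard_form_def split_beta)
    thus "((\<lambda>x. - cos (snd (\<Phi> (x, y))) * fst (frechet_derivative \<Phi> (at (x, y)) (1, 0))) has_integral
        \<kappa> + \<mu> * y\<^sup>2 / 2) {0..1}"
      using normal_form_chart_line[OF ex y] by simp
  qed (use \<epsilon> c(2,6) in auto)
qed

text \<open>A normal form of a transformed map becomes a chart for the billiard map itself by composition
  with the change of coordinates. The loop integrals agree because both maps are exact.\<close>

lemma (in billiard) boundary_chart_compose:
  assumes ex: "exact_symplectic annulus \<Psi> billiard_form \<theta>'"
    and ex': "exact_symplectic (UNIV \<times> {0..<\<epsilon>}) \<Phi> \<theta>' (normal_form_one_form \<kappa> \<mu>)"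
    and \<epsilon>: "0 < \<epsilon>"
  shows "boundary_chart \<Omega> \<xi> (\<lambda>z. \<Psi> (\<Phi> z))
    (\<lambda>z w. frechet_derivative \<Psi> (at (\<Phi> z)) (frechet_derivative \<Phi> (at z) w)) \<epsilon> \<kappa> \<mu>"
proof -
  let ?S = "UNIV \<times> {0..<\<epsilon>} :: (real \<times> real) set"
  let ?d = "\<lambda>z. frechet_derivative \<Phi> (at z)" and ?e = "\<lambda>z. frechet_derivative \<Psi> (at z)"
  have "annulus_chart annulus \<Psi>" "annulus_chart ?S \<Phi>"
    using ex ex' unfolding exact_symplectic_def by blast+
  note c = annulus_chart_D[OF this(1)] and c' = annulus_chart_D[OF this(2)]
  have S: "(x, y) \<in> ?S" if "0 \<le> y" "y < \<epsilon>" for x y using that by simp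
  have A: "\<Phi> z \<in> annulus" if "z \<in> ?S" for z using c'(3) that by blast
  have dPhi: "(\<Phi> has_derivative ?d z) (at z)" if "z \<in> ?S" for z
    by (rule smooth_on_has_derivative[OF c'(1) that])
  have dPsi: "(\<Psi> has_derivative ?e z) (at z)" if "z \<in> annulus" for z
    by (rule smooth_on_has_derivative[OF c(1) that])
  show ?thesis
  proof unfold_locales
    show "inj_on (\<lambda>z. \<Psi> (\<Phi> z)) ?S"
      using comp_inj_on[OF c'(2) inj_on_subset[OF c(2) c'(3)]] by (simp add: o_def)
    show "continuous_on ?S (\<lambda>z. ?e (\<Phi> z) (?d z w))" for w
    proof -
      have e: "?e (\<Phi> z) v = fst v *\<^sub>R ?e (\<Phi> z) (1, 0) + snd v *\<^sub>R ?e (\<Phi> z) (0, 1)" if "z \<in> ?S" for z v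
      proof -
        have lin: "linear (?e (\<Phi> z))" by (rule has_derivative_linear[OF dPsi[OF A[OF that]]])
        have "v = fst v *\<^sub>R (1, 0) + snd v *\<^sub>R (0, 1)" by (cases v) simp
        hence "?e (\<Phi> z) v = ?e (\<Phi> z) (fst v *\<^sub>R (1, 0) + snd v *\<^sub>R (0, 1))" by (rule arg_cong)
        thus ?thesis by (simp only: linear_add[OF lin] linear_scale[OF lin])
      qed
      have comp0: "continuous_on ?S (\<lambda>z. ?e (\<Phi> z) v)" for v
        by (rule continuous_on_compose2[OF smooth_on_continuous_derivative[OF c(1)]
              smooth_on_imp_continuous_on[OF c'(1)] c'(3)])
      have "continuous_on ?S (\<lambda>z. fst (?d z w) *\<^sub>R ?e (\<Phi> z) (1, 0) + snd (?d z w) *\<^sub>R ?e (\<Phi> z) (0, 1))"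
        by (intro continuous_on_add continuous_on_scaleR continuous_on_fst continuous_on_snd comp0
            smooth_on_continuous_derivative[OF c'(1)])
      thus ?thesis by (subst continuous_on_cong[OF refl e]) assumption+
    qed
    show "bij (\<lambda>w. ?e (\<Phi> (x, 0)) (?d (x, 0) w))" for x
    proof -
      have "(x, 0) \<in> ?S" using \<epsilon> by simp
      thus ?thesis using bij_comp[OF c'(4) c(4)[OF A]] by (simp add: o_def)
    qed
    show "snd (\<Psi> (\<Phi> (x, 0))) = 0" for x
      using c(6)[of "fst (\<Phi> (x, 0))"] c'(6)[of x] by (metis prod.collapse)
    fix x y :: real assume y: "0 \<le> y" "y < \<epsilon>"
    show "((\<lambda>z. \<Psi> (\<Phi> z)) has_derivative (\<lambda>w. ?e (\<Phi> (x, y)) (?d (x, y) w))) (at (x, y))"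
      by (rule has_derivative_compose[OF dPhi[OF S[OF y]] dPsi[OF A[OF S[OF y]]]])
    have "\<Psi> (\<Phi> (x, y)) \<in> annulus" using c(3) A[OF S[OF y]] by blast
    thus "0 \<le> snd (\<Psi> (\<Phi> (x, y)))" by (auto simp: annulus_def)
    show "\<Psi> (\<Phi> (x + 1, y)) = \<Psi> (\<Phi> (x, y)) + (1, 0)"
      using c'(5)[OF S[OF y]] c(5)[OF A[OF S[OF y]]] by simp
  next
    fix y assume y: "0 \<le> y" "y < \<epsilon>"
    have "((\<lambda>x. billiard_form (\<Psi> (\<Phi> (x, y))) (?e (\<Phi> (x, y)) (?d (x, y) (1, 0)))) has_integral
        \<kappa> + \<mu> * y\<^sup>2 / 2) {0..1}"
    proof (rule exact_symplectic_loop[OF ex, where \<gamma> = "\<lambda>x. \<Phi> (x, y)" and \<gamma>' = "\<lambda>x. ?d (x, y) (1, 0)"])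
      fix x :: real
      have "((\<lambda>x. (x, y)) has_derivative (\<lambda>t. (t, 0))) (at x)"
        by (auto intro!: derivative_eq_intros)
      hence "((\<lambda>x. \<Phi> (x, y)) has_derivative (\<lambda>t. ?d (x, y) (t, 0))) (at x)"
        by (rule has_derivative_compose[where g = \<Phi> and g' = "?d (x, y)"]) (rule dPhi[OF S[OF y]])
      moreover have "(\<lambda>t. ?d (x, y) (t, 0)) = (\<lambda>t. t *\<^sub>R ?d (x, y) (1, 0))"
      proof (rule ext)
        fix t
        show "?d (x, y) (t, 0) = t *\<^sub>R ?d (x, y) (1, 0)"
          using linear_scale[OF has_derivative_linear[OF dPhi[OF S[OF y, of x]]], of t "(1, 0)"] by simp
      qed
      ultimately show "((\<lambda>x. \<Phi> (x, y)) has_derivative (\<lambda>t. t *\<^sub>R ?d (x, y) (1, 0))) (at x)" by simp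
      show "\<Phi> (x, y) \<in> annulus" by (rule A[OF S[OF y]])
    next
      show "\<Phi> (1, y) = \<Phi> (0, y) + (1, 0)" using c'(5)[OF S[OF y], of 0] by simp
    qed (rule normal_form_chart_line[OF ex' y])
    moreover have "billiard_form z w = - cos (snd z) * fst w" for z w
      by (simp add: billiard_form_def split_beta)
    ultimately show "((\<lambda>x. - cos (snd (\<Psi> (\<Phi> (x, y)))) * fst (?e (\<Phi> (x, y)) (?d (x, y) (1, 0)))) has_integral
        \<kappa> + \<mu> * y\<^sup>2 / 2) {0..1}"
      by simp
  qed (rule \<epsilon>)
qed

lemma (in billiard) beta_asymptotic:
  assumes "birkhoff_normal_form (billiard_map \<xi>) billiard_form \<Phi> \<zeta> \<kappa> \<mu>"
  shows "asymptotic_series (beta \<xi>) (formal_beta \<kappa> \<mu> \<zeta>)"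
proof -
  obtain \<epsilon> where \<epsilon>: "\<epsilon> > 0" and ex: "exact_symplectic (UNIV \<times> {0..<\<epsilon>}) \<Phi> billiard_form (normal_form_one_form \<kappa> \<mu>)"
    and nf: "\<forall>N. \<exists>C. \<exists>\<delta>>0. \<forall>x. \<forall>y\<in>{0..<\<delta>}. \<exists>z'\<in>UNIV \<times> {0..<\<epsilon>}. \<Phi> z' = billiard_map \<xi> (\<Phi> (x, y)) \<and>
      norm (z' - (x + (\<Sum>k\<le>N. fps_nth \<zeta> k * y ^ k), y)) \<le> C * y ^ Suc N"
    and \<zeta>: "fps_nth \<zeta> 1 = 1" "\<forall>k. even k \<longrightarrow> fps_nth \<zeta> k = 0"
    using assms unfolding birkhoff_normal_form_def Let_def by blast
  interpret boundary_chart \<Omega> \<xi> \<Phi> "\<lambda>z. frechet_derivative \<Phi> (at z)" \<epsilon> \<kappa> \<mu>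
    by (rule boundary_chart_normal_form[OF ex \<epsilon>])
  show ?thesis by (rule beta_asymptotic_series[OF \<zeta>]) (use nf in blast)
qed

lemma (in billiard) beta_asymptotic_transform:
  assumes tr: "exact_symplectic_transform (billiard_map \<xi>) billiard_form f' \<theta>'"
    and normal_form: "birkhoff_normal_form f' \<theta>' \<Phi> \<zeta> \<kappa> \<mu>"
  shows "asymptotic_series (beta \<xi>) (formal_beta \<kappa> \<mu> \<zeta>)"
proof -
  obtain \<Psi> where ex: "exact_symplectic annulus \<Psi> billiard_form \<theta>'"
    and conj: "\<And>z. z \<in> annulus \<Longrightarrow> \<Psi> (f' z) = billiard_map \<xi> (\<Psi> z)"
    using tr unfolding exact_symplectic_transform_def by blast
  obtain \<epsilon> where \<epsilon>: "\<epsilon> > 0" and ex': "exact_symplectic (UNIV \<times> {0..<\<epsilon>}) \<Phi> \<theta>' (normal_form_one_form \<kappa> \<mu>)"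
    and nf: "\<And>N. \<exists>C. \<exists>\<delta>>0. \<forall>x. \<forall>y\<in>{0..<\<delta>}. \<exists>z'\<in>UNIV \<times> {0..<\<epsilon>}. \<Phi> z' = f' (\<Phi> (x, y)) \<and>
      norm (z' - (x + (\<Sum>k\<le>N. fps_nth \<zeta> k * y ^ k), y)) \<le> C * y ^ Suc N"
    and \<zeta>: "fps_nth \<zeta> 1 = 1" "\<forall>k. even k \<longrightarrow> fps_nth \<zeta> k = 0"
    using normal_form unfolding birkhoff_normal_form_def Let_def by blast
  interpret boundary_chart \<Omega> \<xi> "\<lambda>z. \<Psi> (\<Phi> z)"
    "\<lambda>z w. frechet_derivative \<Psi> (at (\<Phi> z)) (frechet_derivative \<Phi> (at z) w)" \<epsilon> \<kappa> \<mu>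
    by (rule boundary_chart_compose[OF ex ex' \<epsilon>])
  have range: "\<Phi> z \<in> annulus" if "z \<in> UNIV \<times> {0..<\<epsilon>}" for z
    using ex' annulus_chart_D(3) that unfolding exact_symplectic_def by blast
  show ?thesis
  proof (rule beta_asymptotic_series[OF \<zeta>])
    fix N :: nat
    obtain C \<delta> where \<delta>: "\<delta> > 0" and N: "\<forall>x. \<forall>y\<in>{0..<\<delta>}. \<exists>z'\<in>UNIV \<times> {0..<\<epsilon>}. \<Phi> z' = f' (\<Phi> (x, y)) \<and>
      norm (z' - (x + (\<Sum>k\<le>N. fps_nth \<zeta> k * y ^ k), y)) \<le> C * y ^ Suc N"
      using nf[of N] by blast
    show "\<exists>C. \<exists>\<delta>>0. \<forall>x. \<forall>y\<in>{0..<\<delta>}. \<exists>z'\<in>UNIV \<times> {0..<\<epsilon>}. \<Psi> (\<Phi> z') = billiard_map \<xi> (\<Psi> (\<Phi> (x, y))) \<and>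
      norm (z' - (x + (\<Sum>k\<le>N. fps_nth \<zeta> k * y ^ k), y)) \<le> C * y ^ Suc N"
    proof (rule exI[of _ C], rule exI[of _ "min \<delta> \<epsilon>"], intro conjI allI ballI)
      show "min \<delta> \<epsilon> > 0" using \<delta> \<epsilon> by simp
      fix x y :: real assume y: "y \<in> {0..<min \<delta> \<epsilon>}"
      then obtain z' where z': "z' \<in> UNIV \<times> {0..<\<epsilon>}" "\<Phi> z' = f' (\<Phi> (x, y))"
        "norm (z' - (x + (\<Sum>k\<le>N. fps_nth \<zeta> k * y ^ k), y)) \<le> C * y ^ Suc N"
        using N by (metis atLeastLessThan_iff min_less_iff_conj)
      have "\<Phi> (x, y) \<in> annulus" using y by (intro range) auto
      hence "\<Psi> (\<Phi> z') = billiard_map \<xi> (\<Psi> (\<Phi> (x, y)))" using conj z'(2) by simp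
      thus "\<exists>z'\<in>UNIV \<times> {0..<\<epsilon>}. \<Psi> (\<Phi> z') = billiard_map \<xi> (\<Psi> (\<Phi> (x, y))) \<and>
        norm (z' - (x + (\<Sum>k\<le>N. fps_nth \<zeta> k * y ^ k), y)) \<le> C * y ^ Suc N"
        using z' by blast
    qed
  qed
qed

section \<open>Action minimizing orbits\<close>

context billiard
begin

text \<open>Configurations are normalized to start in \<open>[0, 1)\<close> and to vanish after time \<open>q\<close>, which puts
  them into a compact product of intervals.\<close>

lemma minimizer_exists:
  assumes "0 \<le> p" "p \<le> int q"
  shows "\<exists>x\<in>all_configurations p q. action \<xi> q x = least_action \<xi> p q"
proof -
  define B where "B = PiE UNIV (\<lambda>_::nat. {0..real q + 1})"
  define K where "K = B \<inter> all_configurations p q"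
  have coord: "continuous_on A (\<lambda>x. x i)" for A :: "(nat \<Rightarrow> real) set" and i
    by (rule continuous_on_subset[OF continuous_on_product_coordinates]) simp
  have "compactin (product_topology (\<lambda>_. euclidean) UNIV) B"
    unfolding B_def compactin_PiE by simp
  hence "compact B" by (simp add: euclidean_product_topology)
  moreover have "closed (all_configurations p q)"
  proof -
    have "all_configurations p q = {x. x q = x 0 + of_int p} \<inter>
        (\<Inter>i\<in>{..<q}. {x. x i \<le> x (Suc i)} \<inter> {x. x (Suc i) \<le> x i + 1})"
      by (auto simp: all_configurations_def)
    also have "closed \<dots>"
      by (intro closed_Int closed_INT ballI closed_Collect_eq closed_Collect_le
          continuous_on_add coord continuous_on_const)
    finally show ?thesis .
  qed
  ultimately have "compact K" unfolding K_def by (rule compact_Int_closed)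
  have normal: "\<exists>y\<in>K. action \<xi> q y = action \<xi> q x" if x: "x \<in> all_configurations p q" for x
  proof -
    define y where "y i = (if i \<le> q then x i - of_int \<lfloor>x 0\<rfloor> else 0)" for i
    note xD = all_configurations_D[OF x]
    have "0 \<le> y i \<and> y i \<le> real i + 1" if "i \<le> q" for i
      using that
    proof (induction i)
      case 0
      show ?case unfolding y_def by simp linarith
    next
      case (Suc i)
      thus ?case using xD(2,3)[of i] by (simp add: y_def)
    qed
    hence "y \<in> B" unfolding B_def
      by (auto simp: PiE_def y_def) (smt (verit) of_nat_le_iff)+
    moreover have "y \<in> all_configurations p q"
      using xD by (auto simp: all_configurations_def y_def)
    moreover have "action \<xi> q y = action \<xi> q x"
      unfolding action_def
    proof (intro sum.cong refl)
      fix i assume "i \<in> {..<q}"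
      hence "h (y i) (y (Suc i)) = h (x i + of_int (- \<lfloor>x 0\<rfloor>)) (x (Suc i) + of_int (- \<lfloor>x 0\<rfloor>))"
        by (simp add: y_def)
      thus "h (y i) (y (Suc i)) = h (x i) (x (Suc i))" by (simp only: gen_fun_shift)
    qed
    ultimately show ?thesis unfolding K_def by blast
  qed
  have "K \<noteq> {}" using all_configurations_nonempty[OF assms] normal by blast
  moreover have "continuous_on K (action \<xi> q)"
    unfolding action_def by (intro continuous_on_sum continuous_gen_fun coord)
  ultimately obtain x where x: "x \<in> K" "\<And>y. y \<in> K \<Longrightarrow> action \<xi> q x \<le> action \<xi> q y"
    using continuous_attains_inf[OF \<open>compact K\<close>] by blast
  have "action \<xi> q x \<le> least_action \<xi> p q"
    by (rule least_action_greatest[OF assms]) (use normal x(2) in fastforce)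
  moreover have xc: "x \<in> all_configurations p q" using x(1) by (simp add: K_def)
  ultimately have "action \<xi> q x = least_action \<xi> p q" using least_action_le[OF xc] by simp
  thus ?thesis using xc by blast
qed

text \<open>A minimizer extends to a sequence with the same period, of which all shifts minimize; so
  the end points of a configuration need no separate treatment.\<close>

lemma minimizing_sequence:
  assumes "0 \<le> p" "p \<le> int q" "0 < q"
  obtains y where "\<And>n. y (n + q) = y n + of_int p"
    "\<And>n. y n \<le> y (Suc n)" "\<And>n. y (Suc n) \<le> y n + 1"
    "\<And>n. action \<xi> q (\<lambda>i. y (n + i)) = least_action \<xi> p q"
proof -
  obtain x where x: "x \<in> all_configurations p q" and min: "action \<xi> q x = least_action \<xi> p q"
    using minimizer_exists[OF assms(1,2)] by blast
  obtain y where y: "\<And>i. i \<le> q \<Longrightarrow> y i = x i" and shift: "\<And>n. y (n + q) = y n + of_int p"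
    and step: "\<And>n. y n \<le> y (Suc n)" "\<And>n. y (Suc n) \<le> y n + 1"
    by (rule periodic_extension[OF x assms(3)], rule that)
  define c where "c n = h (y n) (y (Suc n))" for n
  have c: "c (n + q) = c n" for n
    using shift[of n] shift[of "Suc n"] by (simp add: c_def)
  have act: "action \<xi> q (\<lambda>i. y (n + i)) = (\<Sum>i<q. c (n + i))" for n
    by (simp add: action_def c_def)
  have "(\<Sum>i<q. c (n + i)) = (\<Sum>i<q. c i)" for n
  proof (induction n)
    case (Suc n)
    have "c n + (\<Sum>i<q. c (Suc n + i)) = (\<Sum>i<Suc q. c (n + i))"
      by (simp only: sum.lessThan_Suc_shift) simp
    also have "\<dots> = (\<Sum>i<q. c (n + i)) + c n" using c by simp
    finally show ?case using Suc by simp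
  qed simp
  moreover have "(\<Sum>i<q. c i) = action \<xi> q x"
    unfolding action_def
  proof (intro sum.cong refl)
    fix i assume "i \<in> {..<q}"
    hence "y i = x i" "y (Suc i) = x (Suc i)" using y by simp_all
    thus "c i = h (x i) (x (Suc i))" by (simp add: c_def)
  qed
  ultimately have "action \<xi> q (\<lambda>i. y (n + i)) = least_action \<xi> p q" for n
    using min act by simp
  with shift step show thesis by (rule that)
qed

lemma gen_fun_strict_triangle:
  assumes "\<xi> t \<noteq> \<xi> a" "\<xi> t \<noteq> \<xi> b" "\<xi> a \<noteq> \<xi> b"
  shows "h a t + h t b < h a b"
proof (rule ccontr)
  assume "\<not> ?thesis"
  hence "dist (\<xi> a) (\<xi> b) = dist (\<xi> a) (\<xi> t) + dist (\<xi> t) (\<xi> b)"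
    using dist_triangle[of "\<xi> a" "\<xi> b" "\<xi> t"] by (simp add: gen_fun_def dist_norm)
  hence "\<xi> t \<in> open_segment (\<xi> a) (\<xi> b)"
    using assms by (simp add: between[symmetric] between_mem_segment open_segment_def)
  thus False using strictly_convex[OF curve_in_closure curve_in_closure assms(3)] curve_notin_table by blast
qed

text \<open>In a minimizer no step is 0 or a full turn: next to such a step, at a vertex where the two
  sides differ, the strict triangle inequality would allow a smaller action. A stationary vertex
  obeys the law of reflection.\<close>

lemma minimizing_orbit:
  assumes pq: "0 < p" "p < int q"
  obtains z where "\<And>n. 0 < snd (z n)" "\<And>n. snd (z n) < pi"
    "\<And>n. billiard_map \<xi> (z n) = z (Suc n)" "z q = z 0 + (of_int p, 0)"
    "action \<xi> q (\<lambda>n. fst (z n)) = least_action \<xi> p q"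
proof -
  have q: "1 < q" using pq by linarith
  obtain y where shift: "\<And>n. y (n + q) = y n + of_int p"
    and step: "\<And>n. y n \<le> y (Suc n)" "\<And>n. y (Suc n) \<le> y n + 1"
    and min: "\<And>n. action \<xi> q (\<lambda>i. y (n + i)) = least_action \<xi> p q"
    by (rule minimizing_sequence[of p q]) (use pq in auto)
  have local_min: "h (y n) (y (Suc n)) + h (y (Suc n)) (y (Suc (Suc n))) \<le> h (y n) t + h t (y (Suc (Suc n)))"
    if t: "y n \<le> t" "t \<le> y n + 1" "t \<le> y (Suc (Suc n))" "y (Suc (Suc n)) \<le> t + 1" for n t
  proof -
    define z where "z i = (if i = 1 then t else y (n + i))" for i
    have "z \<in> all_configurations p q"
      unfolding all_configurations_def
    proof (intro CollectI conjI allI impI)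
      show "z q = z 0 + of_int p" using q shift[of n] by (simp add: z_def)
      fix i assume "i < q"
      show "z i \<le> z (Suc i)" "z (Suc i) \<le> z i + 1"
        using step[of "n + i"] t by (auto simp: z_def)
    qed
    hence "action \<xi> q (\<lambda>i. y (n + i)) \<le> action \<xi> q z"
      unfolding min by (rule least_action_le)
    moreover obtain r where r: "q = Suc (Suc r)" using q by (metis less_natE add_Suc_right plus_1_eq_Suc)
    moreover have "action \<xi> q x = h (x 0) (x 1) + (h (x 1) (x 2) + (\<Sum>i<r. h (x (i + 2)) (x (i + 3))))" for x
      unfolding action_def r sum.lessThan_Suc_shift by (simp add: eval_nat_numeral)
    ultimately show ?thesis by (simp add: z_def eval_nat_numeral)
  qed
  have interior: "y n < y (Suc n)" "y (Suc n) < y n + 1" for n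
  proof -
    \<comment> \<open>A bad step is followed by a bad step, so by periodicity one bad step makes all steps bad, and
      the action is 0. Equal steps do better.\<close>
    define bad where "bad n \<longleftrightarrow> \<not> (y n < y (Suc n) \<and> y (Suc n) < y n + 1)" for n
    have bad_per: "bad (n + q) = bad n" for n
      using shift[of n] shift[of "Suc n"] by (simp add: bad_def)
    have spread: "bad (Suc n)" if bad: "bad n" for n
    proof (rule ccontr)
      assume good: "\<not> bad (Suc n)"
      let ?a = "y n" and ?b = "y (Suc (Suc n))" and ?m = "y (Suc n)"
      have gb: "?m < ?b" "?b < ?m + 1" using good by (auto simp: bad_def)
      have m: "?m = ?a \<or> ?m = ?a + 1" using bad step[of n] by (auto simp: bad_def)
      define t where "t = (?a + ?b) / 2"
      have t: "?a < t" "t < ?a + 1" "t < ?b" "?b < t + 1" using m gb by (auto simp: t_def field_simps)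
      have ma: "\<xi> ?m = \<xi> ?a" using m by auto
      have "h ?a ?m + h ?m ?b = h ?a ?b" using ma by (simp add: gen_fun_def)
      moreover have "h ?a t + h t ?b < h ?a ?b"
      proof (rule gen_fun_strict_triangle)
        show "\<xi> t \<noteq> \<xi> ?a" using curve_distinct[of ?a t] t by simp
        show "\<xi> t \<noteq> \<xi> ?b" using curve_distinct[of t ?b] t by metis
        show "\<xi> ?a \<noteq> \<xi> ?b" using curve_distinct[of ?m ?b] gb ma by simp
      qed
      ultimately show False using local_min[of n t] t by simp
    qed
    have "\<not> bad n" for n
    proof
      assume "bad n"
      have all: "bad (n + k)" for k
        by (induction k) (use \<open>bad n\<close> spread in auto)
      have "action \<xi> q (\<lambda>i. y (n + i)) = 0"
        unfolding action_def
      proof (intro sum.neutral ballI)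
        fix i
        have "y (Suc (n + i)) = y (n + i) \<or> y (Suc (n + i)) = y (n + i) + 1"
          using all[of i] step[of "n + i"] by (auto simp: bad_def)
        thus "h (y (n + i)) (y (n + Suc i)) = 0" by (auto simp: gen_fun_def)
      qed
      hence zero: "least_action \<xi> p q = 0" using min by simp
      define w where "w = of_int p / real q"
      have rpq: "real_of_int p < real q" using pq(2) by linarith
      have w: "0 < w" "w < 1" "real q * w = of_int p" using pq q rpq by (auto simp: w_def)
      have conf: "(\<lambda>i. real i * w) \<in> all_configurations p q"
        using w by (auto simp: all_configurations_def algebra_simps)
      have "h (real i * w) (real (Suc i) * w) < 0" for i
        using curve_distinct[of "real i * w" "real (Suc i) * w"] w
        by (simp add: gen_fun_def algebra_simps)
      hence "action \<xi> q (\<lambda>i. real i * w) < (\<Sum>i<q. 0)"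
        unfolding action_def using q by (intro sum_strict_mono) auto
      thus False using least_action_le[OF conf] zero by simp
    qed
    thus "y n < y (Suc n)" "y (Suc n) < y n + 1" by (auto simp: bad_def)
  qed
  have reflect: "arr (y n) (y (Suc n)) = dep (y (Suc n)) (y (Suc (Suc n)))" for n
  proof -
    let ?a = "y n" and ?b = "y (Suc (Suc n))" and ?m = "y (Suc n)"
    define d where "d = min (min (?m - ?a) (?a + 1 - ?m)) (min (?b - ?m) (?m + 1 - ?b))"
    have d: "0 < d" "d \<le> ?m - ?a" "d \<le> ?a + 1 - ?m" "d \<le> ?b - ?m" "d \<le> ?m + 1 - ?b"
      using interior[of n] interior[of "Suc n"] by (auto simp: d_def)
    have ne: "\<xi> ?a \<noteq> \<xi> ?m" "\<xi> ?m \<noteq> \<xi> ?b"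
      using curve_distinct[of ?a ?m] curve_distinct[of ?m ?b] interior[of n] interior[of "Suc n"] by metis+
    have "((\<lambda>t. h ?a t + h t ?b) has_derivative
        (\<lambda>w. (dep ?a ?m * 0 - arr ?a ?m * w) + (dep ?m ?b * w - arr ?m ?b * 0))) (at ?m)"
      by (intro has_derivative_add gen_fun_has_derivative has_derivative_const has_derivative_ident ne)
    hence "((\<lambda>t. h ?a t + h t ?b) has_real_derivative (dep ?m ?b - arr ?a ?m)) (at ?m)"
      unfolding has_field_derivative_def by (rule has_derivative_eq_rhs) (auto simp: algebra_simps)
    moreover have "\<forall>t. \<bar>?m - t\<bar> < d \<longrightarrow> h ?a ?m + h ?m ?b \<le> h ?a t + h t ?b"
      using d by (intro allI impI local_min) auto
    ultimately have "dep ?m ?b - arr ?a ?m = 0" using d(1) by (intro DERIV_local_min)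
    thus ?thesis by simp
  qed
  define z where "z n = (y n, arccos (dep (y n) (y (Suc n))))" for n
  show thesis
  proof (rule that[of z])
    fix n
    show "0 < snd (z n)" "snd (z n) < pi"
      using billiard_map_chord(2,3)[OF interior] by (simp_all add: z_def)
    show "billiard_map \<xi> (z n) = z (Suc n)"
      using billiard_map_chord(1)[OF interior, of n] reflect[of n] by (simp add: z_def)
  next
    show "z q = z 0 + (of_int p, 0)"
      using shift[of 0] shift[of 1] by (simp add: z_def departure_cos_def)
    show "action \<xi> q (\<lambda>n. fst (z n)) = least_action \<xi> p q"
      using min[of 0] by (simp add: z_def)
  qed
qed

lemma orbit_configuration:
  assumes "\<And>n. 0 < snd (z n)" "\<And>n. snd (z n) < pi" "\<And>n. billiard_map \<xi> (z n) = z (Suc n)"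
    and "z q = z 0 + (of_int p, 0)"
  shows "(\<lambda>n. fst (z n)) \<in> all_configurations p q"
proof -
  have "fst (z n) < fst (z (Suc n)) \<and> fst (z (Suc n)) < fst (z n) + 1" for n
  proof -
    obtain a v' where "billiard_map \<xi> (fst (z n), snd (z n)) = (a, v')" "fst (z n) < a" "a < fst (z n) + 1"
      using billiard_map_interior[OF assms(1)[of n] assms(2)[of n], of "fst (z n)"] by metis
    thus ?thesis using assms(3)[of n] by (metis fst_conv prod.collapse)
  qed
  thus ?thesis using assms(4) by (auto simp: all_configurations_def less_imp_le)
qed

lemma billiard_map_boundary:
  "billiard_map \<xi> (s, 0) = (s, 0)" "billiard_map \<xi> (s, pi) = (s + 1, pi)"
  by (simp_all add: billiard_map_def)

lemma billiard_map_interior_neq: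
  assumes "0 < snd z" "snd z < pi"
  shows "billiard_map \<xi> z \<noteq> z" "billiard_map \<xi> z \<noteq> z + (1, 0)"
proof -
  obtain a v' where "billiard_map \<xi> (fst z, snd z) = (a, v')" "fst z < a" "a < fst z + 1"
    using billiard_map_interior[OF assms, of "fst z"] by metis
  thus "billiard_map \<xi> z \<noteq> z" "billiard_map \<xi> z \<noteq> z + (1, 0)" by (auto simp: prod_eq_iff)
qed

lemma angles_differentiable:
  assumes "s < a" "a < s + 1"
  shows "\<exists>d. ((\<lambda>a. arccos (dep s a)) has_real_derivative d) (at a)"
    "\<exists>d. ((\<lambda>a. arccos (arr s a)) has_real_derivative d) (at a)"
proof -
  have ne: "\<xi> a - \<xi> s \<noteq> 0" using curve_distinct[OF assms] by simp
  have u: "((\<lambda>a. \<xi> a - \<xi> s) has_derivative (\<lambda>t. t *\<^sub>R \<tau> a)) (at a)"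
    using has_vector_derivative_diff_const[of \<xi> "\<xi> s" "\<tau> a" "at a"] curve_derivative[of a UNIV]
    by (simp add: has_vector_derivative_def)
  have du: "(\<lambda>a. \<xi> a - \<xi> s) differentiable (at a)" using u by (rule differentiableI)
  have dn: "(\<lambda>a. norm (\<xi> a - \<xi> s)) differentiable (at a)"
    by (rule differentiable_compose[OF differentiable_norm_at[OF ne] du])
  have dt: "\<tau> differentiable (at a)" by (rule tangent_differentiable)
  have "(\<lambda>a. dep s a) differentiable (at a)" "(\<lambda>a. arr s a) differentiable (at a)"
    unfolding departure_cos_def arrival_cos_def
    using ne by (intro differentiable_divide differentiable_inner differentiable_const du dn dt; simp)+
  then obtain d1 d2 where "((\<lambda>a. dep s a) has_real_derivative d1) (at a)"
    "((\<lambda>a. arr s a) has_real_derivative d2) (at a)"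
    by (metis real_differentiable_def)
  moreover have "-1 < dep s a" "dep s a < 1" "-1 < arr s a" "arr s a < 1"
  proof -
    have "\<bar>cos v\<bar> < 1" if "0 < v" "v < pi" for v
      using that cos_monotone_0_pi[of 0 v] cos_monotone_0_pi[of v pi] by auto
    thus "-1 < dep s a" "dep s a < 1" "-1 < arr s a" "arr s a < 1"
      using billiard_map_chord(2-7)[OF assms] by (metis abs_less_iff minus_less_iff)+
  qed
  ultimately show "\<exists>d. ((\<lambda>a. arccos (dep s a)) has_real_derivative d) (at a)"
    "\<exists>d. ((\<lambda>a. arccos (arr s a)) has_real_derivative d) (at a)"
    using DERIV_chain2[OF DERIV_arccos, of "dep s" a d1 UNIV] DERIV_chain2[OF DERIV_arccos, of "arr s" a d2 UNIV]
    by blast+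
qed

text \<open>A short chord is almost tangent to the boundary at both ends.\<close>

lemma angles_at_start:
  "((\<lambda>a. arccos (dep s a)) \<longlongrightarrow> 0) (at_right s)" "((\<lambda>a. arccos (arr s a)) \<longlongrightarrow> 0) (at_right s)"
proof -
  have quot: "((\<lambda>a. (\<xi> a - \<xi> s) /\<^sub>R (a - s)) \<longlongrightarrow> \<tau> s) (at_right s)"
  proof -
    have "((\<lambda>a. (1 / \<bar>a - s\<bar>) *\<^sub>R (\<xi> a - (\<xi> s + (a - s) *\<^sub>R \<tau> s))) \<longlongrightarrow> 0) (at s)"
      using curve_derivative[of s UNIV] unfolding has_vector_derivative_def has_derivative_at2 by simp
    hence "((\<lambda>a. (1 / \<bar>a - s\<bar>) *\<^sub>R (\<xi> a - (\<xi> s + (a - s) *\<^sub>R \<tau> s))) \<longlongrightarrow> 0) (at_right s)"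
      by (rule tendsto_mono[OF at_le, rotated]) simp
    moreover have "eventually (\<lambda>a. (1 / \<bar>a - s\<bar>) *\<^sub>R (\<xi> a - (\<xi> s + (a - s) *\<^sub>R \<tau> s)) =
        (\<xi> a - \<xi> s) /\<^sub>R (a - s) - \<tau> s) (at_right s)"
    proof -
      have "(1 / \<bar>a - s\<bar>) *\<^sub>R (\<xi> a - (\<xi> s + (a - s) *\<^sub>R \<tau> s)) = (\<xi> a - \<xi> s) /\<^sub>R (a - s) - \<tau> s"
        if "s < a" for a
      proof -
        have "\<xi> a - (\<xi> s + (a - s) *\<^sub>R \<tau> s) = (\<xi> a - \<xi> s) - (a - s) *\<^sub>R \<tau> s" by simp
        moreover have "1 / \<bar>a - s\<bar> = inverse (a - s)" using that by (simp add: divide_inverse)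
        ultimately have "(1 / \<bar>a - s\<bar>) *\<^sub>R (\<xi> a - (\<xi> s + (a - s) *\<^sub>R \<tau> s)) =
            ((\<xi> a - \<xi> s) - (a - s) *\<^sub>R \<tau> s) /\<^sub>R (a - s)"
          by (simp only:)
        also have "\<dots> = (\<xi> a - \<xi> s) /\<^sub>R (a - s) - \<tau> s"
          using that by (simp only: scaleR_diff_right[of _ "\<xi> a - \<xi> s"]) simp
        finally show ?thesis .
      qed
      thus ?thesis by (auto simp: eventually_at_right_field intro!: exI[of _ "s + 1"])
    qed
    ultimately have "((\<lambda>a. (\<xi> a - \<xi> s) /\<^sub>R (a - s) - \<tau> s) \<longlongrightarrow> 0) (at_right s)"
      by (rule Lim_transform_eventually)
    thus ?thesis by (rule LIM_zero_cancel)
  qed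
  have unit: "((\<lambda>a. (\<xi> a - \<xi> s) /\<^sub>R norm (\<xi> a - \<xi> s)) \<longlongrightarrow> \<tau> s) (at_right s)"
  proof -
    have "((\<lambda>a. ((\<xi> a - \<xi> s) /\<^sub>R (a - s)) /\<^sub>R norm ((\<xi> a - \<xi> s) /\<^sub>R (a - s))) \<longlongrightarrow> \<tau> s /\<^sub>R norm (\<tau> s)) (at_right s)"
      by (intro tendsto_scaleR tendsto_inverse tendsto_norm quot) simp
    moreover have "eventually (\<lambda>a. ((\<xi> a - \<xi> s) /\<^sub>R (a - s)) /\<^sub>R norm ((\<xi> a - \<xi> s) /\<^sub>R (a - s)) =
        (\<xi> a - \<xi> s) /\<^sub>R norm (\<xi> a - \<xi> s)) (at_right s)"
      by (auto simp: eventually_at_right_field intro!: exI[of _ "s + 1"])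
    ultimately show ?thesis using Lim_transform_eventually by (fastforce simp: eventually_mono)
  qed
  have tau: "(\<tau> \<longlongrightarrow> \<tau> s) (at_right s)"
  proof -
    have "isCont \<tau> s" using continuous_tangent by (simp add: continuous_on_eq_continuous_at)
    thus ?thesis unfolding isCont_def by (rule tendsto_mono[OF at_le, rotated]) simp
  qed
  have one: "\<tau> s \<bullet> \<tau> s = 1" by (simp add: dot_square_norm)
  have "((\<lambda>a. dep s a) \<longlongrightarrow> \<tau> s \<bullet> \<tau> s) (at_right s)" "((\<lambda>a. arr s a) \<longlongrightarrow> \<tau> s \<bullet> \<tau> s) (at_right s)"
    unfolding departure_cos_alt arrival_cos_alt by (intro tendsto_inner tendsto_const unit tau)+
  hence lim: "((\<lambda>a. dep s a) \<longlongrightarrow> 1) (at_right s)" "((\<lambda>a. arr s a) \<longlongrightarrow> 1) (at_right s)"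
    unfolding one .
  have arccos: "((\<lambda>a. arccos (f a)) \<longlongrightarrow> 0) (at_right s)"
    if "(f \<longlongrightarrow> 1) (at_right s)" "\<And>a. \<bar>f a\<bar> \<le> 1" for f :: "real \<Rightarrow> real"
  proof -
    have "((\<lambda>a. arccos (f a)) \<longlongrightarrow> arccos 1) (at_right s)"
      by (rule continuous_on_tendsto_compose[OF continuous_on_arccos' that(1)])
         (use that(2) in \<open>auto simp: abs_le_iff minus_le_iff\<close>)
    thus ?thesis by simp
  qed
  show "((\<lambda>a. arccos (dep s a)) \<longlongrightarrow> 0) (at_right s)" "((\<lambda>a. arccos (arr s a)) \<longlongrightarrow> 0) (at_right s)"
    using arccos[OF lim(1) abs_departure_cos_le_1] arccos[OF lim(2)]
    unfolding arrival_cos_polar using abs_Re_div_norm_le_1 by blast+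
qed

end

section \<open>Conjugate billiards\<close>

text \<open>\<open>\<Psi>\<close> conjugates the billiard map of \<open>\<xi>'\<close> to that of \<open>\<xi>\<close> and preserves \<open>- cos v ds\<close> up to a
  differential.\<close>

locale conjugate_billiards = B: billiard \<Omega> \<xi> + B': billiard \<Omega>' \<xi>'
  for \<Omega> \<xi> \<Omega>' \<xi>' +
  fixes \<Psi> :: "real \<times> real \<Rightarrow> real \<times> real"
  assumes exact: "exact_symplectic annulus \<Psi> billiard_form billiard_form"
    and onto: "\<Psi> ` annulus = annulus"
    and conj: "z \<in> annulus \<Longrightarrow> \<Psi> (billiard_map \<xi>' z) = billiard_map \<xi> (\<Psi> z)"
begin

lemma chart: "annulus_chart annulus \<Psi>"
  using exact unfolding exact_symplectic_def by blast

lemmas chart_D = annulus_chart_D[OF chart]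

lemma annulus_cases:
  assumes "z \<in> annulus"
  obtains "snd z = 0" | "0 < snd z" "snd z < pi" | "snd z = pi"
  using assms that by (cases z) (auto simp: annulus_def le_less)

lemma shift_in_annulus: "z \<in> annulus \<Longrightarrow> z + (t, 0) \<in> annulus"
  by (cases z) (auto simp: annulus_def)

text \<open>On the boundary circles of the annulus the billiard map is the identity or the unit
  translation, in the interior it is neither; this distinction is preserved by the conjugacy.\<close>

lemma interior_iff:
  assumes z: "z \<in> annulus"
  shows "0 < snd (\<Psi> z) \<and> snd (\<Psi> z) < pi \<longleftrightarrow> 0 < snd z \<and> snd z < pi"
proof -
  have \<Psi>z: "\<Psi> z \<in> annulus" using chart_D(3) z by blast
  have f'z: "billiard_map \<xi>' z \<in> annulus" by (rule B'.billiard_map_annulus[OF z])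
  have fixed: "billiard_map \<xi>' z = z \<longleftrightarrow> billiard_map \<xi> (\<Psi> z) = \<Psi> z"
    using inj_onD[OF chart_D(2) _ f'z z] conj[OF z] by metis
  have turned: "billiard_map \<xi>' z = z + (1, 0) \<longleftrightarrow> billiard_map \<xi> (\<Psi> z) = \<Psi> z + (1, 0)"
    using inj_onD[OF chart_D(2) _ f'z shift_in_annulus[OF z]] conj[OF z] chart_D(5)[OF z] by metis
  have iff: "0 < snd w \<and> snd w < pi \<longleftrightarrow> billiard_map \<eta> w \<noteq> w \<and> billiard_map \<eta> w \<noteq> w + (1, 0)"
    if "w \<in> annulus" "billiard T \<eta>" for w \<eta> T
  proof (rule annulus_cases[OF that(1)])
    assume "snd w = 0"
    thus ?thesis using billiard.billiard_map_boundary(1)[OF that(2), of "fst w"] by (metis less_irrefl prod.collapse)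
  next
    assume "0 < snd w" "snd w < pi"
    thus ?thesis using billiard.billiard_map_interior_neq[OF that(2)] by blast
  next
    assume w: "snd w = pi"
    have "billiard_map \<eta> w = w + (1, 0)"
      using billiard.billiard_map_boundary(2)[OF that(2), of "fst w"] w by (cases w) simp
    thus ?thesis using w by simp
  qed
  show ?thesis
    unfolding iff[OF \<Psi>z B.billiard_axioms] iff[OF z B'.billiard_axioms] using fixed turned by simp
qed

lemma chart_shift_int:
  assumes "z \<in> annulus"
  shows "\<Psi> (z + (of_int k, 0)) = \<Psi> z + (of_int k, 0)"
proof -
  have line: "(x, snd z) \<in> annulus" for x using assms by (cases z) (auto simp: annulus_def)
  have "\<Psi> (x + 1, snd z) = \<Psi> (x, snd z) + (1, 0)" for x using chart_D(5)[OF line, of x] by simp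
  hence "fst (\<Psi> (fst z + of_int k, snd z)) = fst (\<Psi> (fst z, snd z)) + of_int k * 1"
    "snd (\<Psi> (fst z + of_int k, snd z)) = snd (\<Psi> (fst z, snd z)) + of_int k * 0"
    by (intro shift_int; simp)+
  moreover have eq: "z + (of_int k, 0) = (fst z + of_int k, snd z)" by (cases z) simp
  ultimately show ?thesis unfolding eq by (intro prod_eqI) simp_all
qed

text \<open>Both actions are primitives: \<open>dh\<close> is the difference of the one-form at the two ends of a
  chord. Hence the difference of corresponding actions, corrected by the generating function of
  \<open>\<Psi>\<close>, is constant along the chords from a point; it tends to 0 as the chord shrinks.\<close>

lemma action_transform:
  obtains g :: "real \<times> real \<Rightarrow> real" where "\<And>z k. z \<in> annulus \<Longrightarrow> g (z + (of_int k, 0)) = g z"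
    "\<And>z. 0 < snd z \<Longrightarrow> snd z < pi \<Longrightarrow>
      gen_fun \<xi> (fst (\<Psi> z)) (fst (\<Psi> (billiard_map \<xi>' z))) =
      gen_fun \<xi>' (fst z) (fst (billiard_map \<xi>' z)) - g (billiard_map \<xi>' z) + g z"
proof -
  obtain g :: "real \<times> real \<Rightarrow> real" where g: "smooth_on g annulus" "\<And>z. z \<in> annulus \<Longrightarrow> g (z + (1, 0)) = g z"
    "\<And>z w. z \<in> annulus \<Longrightarrow> frechet_derivative g (at z) w =
      billiard_form z w - billiard_form (\<Psi> z) (frechet_derivative \<Psi> (at z) w)"
    using exact unfolding exact_symplectic_def by blast
  have form: "billiard_form z w = - cos (snd z) * fst w" for z w
    by (simp add: billiard_form_def split_beta)
  show thesis
  proof (rule that[of g])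
    fix z :: "real \<times> real" and k :: int assume z: "z \<in> annulus"
    have "g (x + 1, snd z) = g (x, snd z) + 0" for x
      using g(2)[of "(x, snd z)"] z by (cases z) (auto simp: annulus_def)
    hence "g (fst z + of_int k, snd z) = g (fst z, snd z) + of_int k * 0" by (rule shift_int)
    thus "g (z + (of_int k, 0)) = g z" by (cases z) simp
  next
    fix z :: "real \<times> real" assume z: "0 < snd z" "snd z < pi"
    define s where "s = fst z"
    define Z where "Z a = (s, arccos (departure_cos \<xi>' s a))" for a
    define Y where "Y a = (a, arccos (arrival_cos \<xi>' s a))" for a
    define E where "E a = gen_fun \<xi> (fst (\<Psi> (Z a))) (fst (\<Psi> (Y a))) - gen_fun \<xi>' s a + g (Y a) - g (Z a)" for a
    have ZY: "billiard_map \<xi>' (Z a) = Y a" "Z a \<in> annulus" "Y a \<in> annulus" "0 < snd (Z a)" "snd (Z a) < pi"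
      if "s < a" "a < s + 1" for a
      using B'.billiard_map_chord[OF that] by (auto simp: Z_def Y_def annulus_def)
    have der: "(E has_real_derivative 0) (at a)" if a: "s < a" "a < s + 1" for a
    proof -
      obtain d1 d2 where d: "((\<lambda>a. arccos (departure_cos \<xi>' s a)) has_real_derivative d1) (at a)"
        "((\<lambda>a. arccos (arrival_cos \<xi>' s a)) has_real_derivative d2) (at a)"
        using B'.angles_differentiable[OF a] by blast
      define Z' where "Z' t = (0::real, d1 * t)" for t
      define Y' where "Y' t = (t::real, d2 * t)" for t
      have dZ: "(Z has_derivative Z') (at a)" and dY: "(Y has_derivative Y') (at a)"
        unfolding Z_def Y_def Z'_def Y'_def using d unfolding has_field_derivative_def
        by (intro has_derivative_Pair has_derivative_const has_derivative_ident; simp)+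
      note A = ZY(2,3)[OF a]
      let ?P = "\<lambda>z. frechet_derivative \<Psi> (at z)" and ?G = "\<lambda>z. frechet_derivative g (at z)"
      have dP: "(\<Psi> has_derivative ?P z) (at z)" and dG: "(g has_derivative ?G z) (at z)" if "z \<in> annulus" for z
        using smooth_on_has_derivative chart_D(1) g(1) that by blast+
      have dPZ: "((\<lambda>a. fst (\<Psi> (Z a))) has_derivative (\<lambda>t. fst (?P (Z a) (Z' t)))) (at a)"
        by (rule has_derivative_fst[OF has_derivative_compose[OF dZ dP[OF A(1)]]])
      have dPY: "((\<lambda>a. fst (\<Psi> (Y a))) has_derivative (\<lambda>t. fst (?P (Y a) (Y' t)))) (at a)"
        by (rule has_derivative_fst[OF has_derivative_compose[OF dY dP[OF A(2)]]])
      have dGZ: "((\<lambda>a. g (Z a)) has_derivative (\<lambda>t. ?G (Z a) (Z' t))) (at a)"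
        by (rule has_derivative_compose[OF dZ dG[OF A(1)]])
      have dGY: "((\<lambda>a. g (Y a)) has_derivative (\<lambda>t. ?G (Y a) (Y' t))) (at a)"
        by (rule has_derivative_compose[OF dY dG[OF A(2)]])
      have int: "0 < snd (\<Psi> (Z a))" "snd (\<Psi> (Z a)) < pi"
        using interior_iff[OF A(1)] ZY(4,5)[OF a] by blast+
      obtain b v where bv: "billiard_map \<xi> (fst (\<Psi> (Z a)), snd (\<Psi> (Z a))) = (b, v)"
        "fst (\<Psi> (Z a)) < b" "b < fst (\<Psi> (Z a)) + 1"
        "departure_cos \<xi> (fst (\<Psi> (Z a))) b = cos (snd (\<Psi> (Z a)))"
        "arrival_cos \<xi> (fst (\<Psi> (Z a))) b = cos v"
        using B.billiard_map_interior[OF int] by metis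
      have "\<Psi> (Y a) = (b, v)" using conj[OF A(1)] ZY(1)[OF a] bv(1) by simp
      hence b: "b = fst (\<Psi> (Y a))" "v = snd (\<Psi> (Y a))" by simp_all
      have "\<xi> (fst (\<Psi> (Z a))) \<noteq> \<xi> (fst (\<Psi> (Y a)))"
        using B.curve_distinct[OF bv(2,3)] b by metis
      from B.gen_fun_has_derivative[OF dPZ dPY this]
      have 1: "((\<lambda>a. gen_fun \<xi> (fst (\<Psi> (Z a))) (fst (\<Psi> (Y a)))) has_derivative
          (\<lambda>t. cos (snd (\<Psi> (Z a))) * fst (?P (Z a) (Z' t)) - cos (snd (\<Psi> (Y a))) * fst (?P (Y a) (Y' t)))) (at a)"
        using bv(4,5) b by simp
      have ne: "\<xi>' s \<noteq> \<xi>' a" using B'.curve_distinct[OF a] by metis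
      have 2: "((\<lambda>a. gen_fun \<xi>' s a) has_derivative
          (\<lambda>t. departure_cos \<xi>' s a * 0 - arrival_cos \<xi>' s a * t)) (at a)"
        by (rule B'.gen_fun_has_derivative[OF has_derivative_const has_derivative_ident ne])
      have "(E has_derivative (\<lambda>t. (cos (snd (\<Psi> (Z a))) * fst (?P (Z a) (Z' t))
          - cos (snd (\<Psi> (Y a))) * fst (?P (Y a) (Y' t)))
          - (departure_cos \<xi>' s a * 0 - arrival_cos \<xi>' s a * t) + ?G (Y a) (Y' t) - ?G (Z a) (Z' t))) (at a)"
        unfolding E_def by (intro has_derivative_diff has_derivative_add 1 2 dGZ dGY)
      moreover have "cos (snd (Y a)) = arrival_cos \<xi>' s a" 
        using B'.billiard_map_chord(7)[OF a] by (simp add: Y_def)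
      ultimately show ?thesis
        unfolding has_field_derivative_def g(3)[OF A(1)] g(3)[OF A(2)] form
        by (elim has_derivative_eq_rhs) (auto simp: Z'_def Y'_def fun_eq_iff)
    qed
    have zero: "E a = 0" if a: "s < a" "a < s + 1" for a
    proof -
      have const: "E t = E a" if t: "s < t" "t < s + 1" for t
      proof -
        have "\<exists>c. \<forall>x\<in>{s<..<s + 1}. E x = c"
          by (rule has_field_derivative_zero_constant)
             (use der in \<open>auto intro: has_field_derivative_at_within\<close>)
        thus ?thesis using a t by auto
      qed
      have ann: "(s, 0) \<in> annulus" by (simp add: annulus_def)
      have ev: "eventually (\<lambda>t. s < t \<and> t < s + 1) (at_right s)"
        by (auto simp: eventually_at_right_field intro!: exI[of _ "s + 1"])
      have limZ: "(Z \<longlongrightarrow> (s, 0)) (at_right s)" and limY: "(Y \<longlongrightarrow> (s, 0)) (at_right s)"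
        unfolding Z_def Y_def by (intro tendsto_Pair tendsto_const tendsto_ident_at B'.angles_at_start)+
      have comp: "((\<lambda>t. F (W t)) \<longlongrightarrow> F (s, 0)) (at_right s)"
        if "isCont F (s, 0)" "(W \<longlongrightarrow> (s, 0)) (at_right s)"
        for F :: "real \<times> real \<Rightarrow> 'a::topological_space" and W
        using isCont_tendsto_compose[OF that] .
      have cP: "isCont \<Psi> (s, 0)" and cg: "isCont g (s, 0)"
        using smooth_on_has_derivative[OF chart_D(1) ann] smooth_on_has_derivative[OF g(1) ann]
          has_derivative_continuous by blast+
      have hlim: "((\<lambda>t. gen_fun \<eta> (f t) (f' t)) \<longlongrightarrow> gen_fun \<eta> x x) (at_right s)"
        if "billiard T \<eta>" "(f \<longlongrightarrow> x) (at_right s)" "(f' \<longlongrightarrow> x) (at_right s)" for T \<eta> f f' x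
      proof -
        have "isCont \<eta> x"
          using billiard.continuous_curve[OF that(1), of UNIV] by (simp add: continuous_on_eq_continuous_at)
        thus ?thesis unfolding gen_fun_def
          by (intro tendsto_minus tendsto_norm tendsto_diff isCont_tendsto_compose[of x \<eta>] that)
      qed
      have "(E \<longlongrightarrow> gen_fun \<xi> (fst (\<Psi> (s, 0))) (fst (\<Psi> (s, 0))) - gen_fun \<xi>' s s + g (s, 0) - g (s, 0)) (at_right s)"
        unfolding E_def
        by (intro tendsto_diff tendsto_add hlim[OF B.billiard_axioms] hlim[OF B'.billiard_axioms]
            tendsto_fst comp[OF cP] comp[OF cg] limZ limY tendsto_const tendsto_ident_at)
      hence "(E \<longlongrightarrow> 0) (at_right s)" by (simp add: gen_fun_def)
      moreover have "(E \<longlongrightarrow> E a) (at_right s)"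
        by (rule tendsto_eventually) (use ev const in \<open>auto elim!: eventually_mono\<close>)
      ultimately show ?thesis using tendsto_unique[OF trivial_limit_at_right_real] by metis
    qed
    obtain a v where a: "billiard_map \<xi>' (s, snd z) = (a, v)" "s < a" "a < s + 1"
      "departure_cos \<xi>' s a = cos (snd z)" "arrival_cos \<xi>' s a = cos v" "0 < v" "v < pi"
      using B'.billiard_map_interior[OF z] by metis
    have "Z a = z" using a(4) z by (simp add: Z_def s_def arccos_cos)
    moreover have "Y a = billiard_map \<xi>' z"
      using ZY(1)[OF a(2,3)] \<open>Z a = z\<close> by simp
    moreover have "fst (Y a) = a" by (simp add: Y_def)
    ultimately show "gen_fun \<xi> (fst (\<Psi> z)) (fst (\<Psi> (billiard_map \<xi>' z))) =
      gen_fun \<xi>' (fst z) (fst (billiard_map \<xi>' z)) - g (billiard_map \<xi>' z) + g z"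
      using zero[OF a(2,3)] unfolding E_def s_def[symmetric] by simp
  qed
qed

lemma orbit_action:
  assumes "\<And>n. 0 < snd (z n)" "\<And>n. snd (z n) < pi" "\<And>n. billiard_map \<xi>' (z n) = z (Suc n)"
    and "z q = z 0 + (of_int p, 0)"
  shows "action \<xi> q (\<lambda>n. fst (\<Psi> (z n))) = action \<xi>' q (\<lambda>n. fst (z n))"
proof -
  obtain g :: "real \<times> real \<Rightarrow> real" where g: "\<And>z k. z \<in> annulus \<Longrightarrow> g (z + (of_int k, 0)) = g z"
    "\<And>z. 0 < snd z \<Longrightarrow> snd z < pi \<Longrightarrow>
      gen_fun \<xi> (fst (\<Psi> z)) (fst (\<Psi> (billiard_map \<xi>' z))) =
      gen_fun \<xi>' (fst z) (fst (billiard_map \<xi>' z)) - g (billiard_map \<xi>' z) + g z"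
    by (rule action_transform, rule that)
  have "z 0 \<in> annulus" using assms(1,2)[of 0] by (cases "z 0") (auto simp: annulus_def)
  hence gq: "g (z q) = g (z 0)" unfolding assms(4) by (rule g(1))
  have "action \<xi> q (\<lambda>n. fst (\<Psi> (z n))) =
      (\<Sum>n<q. gen_fun \<xi>' (fst (z n)) (fst (z (Suc n))) - (g (z (Suc n)) - g (z n)))"
    unfolding action_def using g(2)[OF assms(1,2)] assms(3) by (intro sum.cong) auto
  also have "\<dots> = action \<xi>' q (\<lambda>n. fst (z n)) - (g (z q) - g (z 0))"
    unfolding action_def sum_subtractf[of _ "\<lambda>n. g (z (Suc n)) - g (z n)"]
      sum_lessThan_telescope[of "\<lambda>n. g (z n)"] ..
  finally show ?thesis using gq by simp
qed

lemma least_action_eq: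
  assumes pq: "0 < p" "p < int q"
  shows "least_action \<xi> p q = least_action \<xi>' p q"
proof (rule antisym)
  obtain z where z: "\<And>n. 0 < snd (z n)" "\<And>n. snd (z n) < pi"
    "\<And>n. billiard_map \<xi>' (z n) = z (Suc n)" "z q = z 0 + (of_int p, 0)"
    "action \<xi>' q (\<lambda>n. fst (z n)) = least_action \<xi>' p q"
    by (rule B'.minimizing_orbit[OF pq], rule that)
  have ann: "z n \<in> annulus" for n using z(1,2)[of n] by (cases "z n") (auto simp: annulus_def)
  have "(\<lambda>n. fst (\<Psi> (z n))) \<in> all_configurations p q"
  proof (rule B.orbit_configuration)
    show "0 < snd (\<Psi> (z n))" "snd (\<Psi> (z n)) < pi" for n
      using interior_iff[OF ann] z(1,2) by blast+
    show "billiard_map \<xi> (\<Psi> (z n)) = \<Psi> (z (Suc n))" for n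
      using conj[OF ann] z(3) by metis
    show "\<Psi> (z q) = \<Psi> (z 0) + (of_int p, 0)" unfolding z(4) by (rule chart_shift_int[OF ann])
  qed
  thus "least_action \<xi> p q \<le> least_action \<xi>' p q"
    using B.least_action_le orbit_action[OF z(1-4)] z(5) by metis
next
  obtain z where z: "\<And>n. 0 < snd (z n)" "\<And>n. snd (z n) < pi"
    "\<And>n. billiard_map \<xi> (z n) = z (Suc n)" "z q = z 0 + (of_int p, 0)"
    "action \<xi> q (\<lambda>n. fst (z n)) = least_action \<xi> p q"
    by (rule B.minimizing_orbit[OF pq], rule that)
  have "z n \<in> annulus" for n using z(1,2)[of n] by (cases "z n") (auto simp: annulus_def)
  hence "\<forall>n. \<exists>w\<in>annulus. \<Psi> w = z n" using onto by (metis imageE)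
  then obtain w where w: "\<And>n. w n \<in> annulus" "\<And>n. \<Psi> (w n) = z n" by metis
  have int: "0 < snd (w n)" "snd (w n) < pi" for n
    using interior_iff[OF w(1)] z(1,2) unfolding w(2) by blast+
  have step: "billiard_map \<xi>' (w n) = w (Suc n)" for n
  proof (rule inj_onD[OF chart_D(2)])
    show "\<Psi> (billiard_map \<xi>' (w n)) = \<Psi> (w (Suc n))" using conj[OF w(1)] w(2) z(3) by simp
  qed (use w(1) B'.billiard_map_annulus in auto)
  have close: "w q = w 0 + (of_int p, 0)"
  proof (rule inj_onD[OF chart_D(2)])
    show "\<Psi> (w q) = \<Psi> (w 0 + (of_int p, 0))" unfolding chart_shift_int[OF w(1)] w(2) by (rule z(4))
  qed (use w(1) shift_in_annulus in auto)
  have "least_action \<xi>' p q \<le> action \<xi>' q (\<lambda>n. fst (w n))"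
    by (rule B'.least_action_le[OF B'.orbit_configuration[OF int step close]])
  also have "\<dots> = action \<xi> q (\<lambda>n. fst (\<Psi> (w n)))"
    using orbit_action[OF int step close] by simp
  finally show "least_action \<xi>' p q \<le> least_action \<xi> p q" using z(5) by (simp add: w(2))
qed

lemma beta_eq:
  assumes h: "0 < h" "h \<le> 1 / 2"
  shows "beta \<xi>' h = beta \<xi> h"
proof -
  have rational: "beta \<xi>' x = beta \<xi> x" if x: "x \<in> \<rat>" "0 < x" "x \<le> 1 / 2" for x
  proof -
    have "x \<le> 1" using x by simp
    then obtain p q where p: "0 < p" "p \<le> int q" "0 < q" "x = of_int p / real q"
      using B.rational_quotient[OF x(1,2)] by metis
    have "real_of_int p < real q" using x(3) p by (simp add: field_simps)
    hence "p < int q" by linarith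
    hence "least_action \<xi> p q = least_action \<xi>' p q" by (rule least_action_eq[OF p(1)])
    thus ?thesis
      using B.beta_quotient[OF less_imp_le[OF p(1)] p(2,3)] B'.beta_quotient[OF less_imp_le[OF p(1)] p(2,3)]
      by (simp add: p(4))
  qed
  show ?thesis
  proof (cases "h \<in> \<rat>")
    case True
    thus ?thesis using rational h by blast
  next
    case False
    let ?F = "at h within \<rat> \<inter> {0<..1/2}"
    have "eventually (\<lambda>x. beta \<xi>' x = beta \<xi> x) ?F"
      by (auto simp: eventually_at_filter intro!: always_eventually rational)
    with B'.beta_irrational_limit[OF False h] have "(beta \<xi> \<longlongrightarrow> beta \<xi>' h) ?F"
      by (rule Lim_transform_eventually)
    thus ?thesis
      using tendsto_unique[OF B.irrational_trivial_limit[OF h] _ B.beta_irrational_limit[OF False h]] by blast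
  qed
qed

end

theorem corollary1p14:
  fixes \<Omega> :: "complex set" and \<xi> :: "real \<Rightarrow> complex"
    and \<Phi> :: "real \<times> real \<Rightarrow> real \<times> real" and \<zeta> :: "real fps" and \<kappa> \<mu> :: real
  assumes "billiard_domain \<Omega> \<xi>"
    and "birkhoff_normal_form (billiard_map \<xi>) billiard_form \<Phi> \<zeta> \<kappa> \<mu>"
  shows "asymptotic_series (beta \<xi>) (formal_beta \<kappa> \<mu> \<zeta>) \<and>
    (\<forall>f' \<theta>' \<Phi>' \<zeta>' \<kappa>' \<mu>'.
      exact_symplectic_transform (billiard_map \<xi>) billiard_form f' \<theta>' \<longrightarrow>
      birkhoff_normal_form f' \<theta>' \<Phi>' \<zeta>' \<kappa>' \<mu>' \<longrightarrow>
      formal_beta \<kappa>' \<mu>' \<zeta>' = formal_beta \<kappa> \<mu> \<zeta>) \<and>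
    (\<forall>\<Omega>' \<xi>'.
      billiard_domain \<Omega>' \<xi>' \<longrightarrow>
      exact_symplectic_transform (billiard_map \<xi>) billiard_form (billiard_map \<xi>') billiard_form \<longrightarrow>
      (\<forall>h\<in>{0<..1/2}. beta \<xi>' h = beta \<xi> h))"
proof (intro conjI allI impI ballI)
  interpret billiard \<Omega> \<xi> by (rule billiard.intro[OF assms(1)])
  show series: "asymptotic_series (beta \<xi>) (formal_beta \<kappa> \<mu> \<zeta>)"
    by (rule beta_asymptotic[OF assms(2)])
  fix f' \<theta>' \<Phi>' \<zeta>' \<kappa>' \<mu>'
  assume "exact_symplectic_transform (billiard_map \<xi>) billiard_form f' \<theta>'"
    and "birkhoff_normal_form f' \<theta>' \<Phi>' \<zeta>' \<kappa>' \<mu>'"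
  hence "asymptotic_series (beta \<xi>) (formal_beta \<kappa>' \<mu>' \<zeta>')" by (rule beta_asymptotic_transform)
  thus "formal_beta \<kappa>' \<mu>' \<zeta>' = formal_beta \<kappa> \<mu> \<zeta>" using series by (rule asymptotic_series_unique)
next
  fix \<Omega>' \<xi>' h
  assume dom': "billiard_domain \<Omega>' \<xi>'"
    and tr: "exact_symplectic_transform (billiard_map \<xi>) billiard_form (billiard_map \<xi>') billiard_form"
    and h: "h \<in> {0<..1/2::real}"
  obtain \<Psi> where "exact_symplectic annulus \<Psi> billiard_form billiard_form" "\<Psi> ` annulus = annulus"
    "\<And>z. z \<in> annulus \<Longrightarrow> \<Psi> (billiard_map \<xi>' z) = billiard_map \<xi> (\<Psi> z)"
    using tr unfolding exact_symplectic_transform_def by blast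
  then interpret conjugate_billiards \<Omega> \<xi> \<Omega>' \<xi>' \<Psi>
    by (intro conjugate_billiards.intro conjugate_billiards_axioms.intro billiard.intro assms(1) dom')
  show "beta \<xi>' h = beta \<xi> h" by (rule beta_eq) (use h in auto)
qed

end
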